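(* Suppose that $\sigma(t)\ne0$ for all $t\ge0$. For fixed $a,b\in\mathbb R$ and $T>0$, let the process $(U_t)_{t\in[0,T)}$ be given by $$U_t:=n_{a,b}(0,t)+\int_0^t\frac{\gamma(t,T)}{\gamma(s,T)}\,e^{\bar q(t)-\bar q(s)}\sigma(s)\,\mathrm dB_s,\qquad t\in[0,T).$$ Then for any $t\in[0,T)$ the distribution of $U_t$ is Gauss with mean $n_{a,b}(0,t)$ and with variance $\sigma(0,t)$. Especially, $U_t\to b$ almost surely (and hence in probability) and in $L^2$ as $t\uparrow T$. Hence the process $(U_t)_{t\in[0,T)}$ can be extended to an almost surely (and hence stochastically) and $L^2$-continuous process $(U_t)_{t\in[0,T]}$ with $U_0=a$ and $U_T=b$. Moreover, $(U_t)_{t\in[0,T]}$ is a Gauss-Markov process, and for any $x\in\mathbb R$ and $0\le s<t<T$ the transition density $\mathbb R\ni y\mapsto p^U_{s,t}(x,y)$ of $U_t$ given $U_s=x$ is given by $$p^U_{s,t}(x,y)=\frac1{\sqrt{2\pi\sigma(s,t)}}\exp\left\{-\frac{(y-n_{x,b}(s,t))^2}{2\sigma(s,t)}\right\},\qquad y\in\mathbb R.$$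
   Context: $q,\sigma,r:\mathbb R_+\to\mathbb R$ are continuous functions, $(B_t)_{t\ge0}$ is a standard Wiener process, and $\bar q(t):=\int_0^tq(u)\,\mathrm du$. "Gauss" means normal (possibly degenerate). For $0\le s\le t$ and $x\in\mathbb R$, $$m_x(s,t):=e^{\bar q(t)-\bar q(s)}x+\int_s^te^{\bar q(t)-\bar q(u)}r(u)\,\mathrm du,\qquad \gamma(s,t):=\int_s^te^{2(\bar q(t)-\bar q(u))}\sigma^2(u)\,\mathrm du.$$ For fixed $T>0$, all $a,b\in\mathbb R$ and $0\le s\le t<T$, $$n_{a,b}(s,t):=\frac{\gamma(s,t)}{\gamma(s,T)}\,e^{\bar q(T)-\bar q(t)}\left(b-\int_t^Te^{\bar q(T)-\bar q(u)}r(u)\,\mathrm du\right)+\frac{\gamma(t,T)}{\gamma(s,T)}\,m_a(s,t),\qquad \sigma(s,t):=\frac{\gamma(s,t)\,\gamma(t,T)}{\gamma(s,T)}.$$ (The two-argument $\sigma(s,t)$ is different from the coefficient $\sigma(u)$.) *)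

theory Defs
  imports "HOL-Probability.Probability"
begin

section \<open>Normal laws and modes of convergence\<close>

text \<open>The second argument is the variance; variance \<open>0\<close> gives the point mass at the mean.\<close>

definition normal_law :: "real \<Rightarrow> real \<Rightarrow> real measure" where
  "normal_law \<mu> v =
     (if v = 0 then return borel \<mu> else density lborel (\<lambda>x. ennreal (normal_density \<mu> (sqrt v) x)))"

definition has_normal_law :: "'w measure \<Rightarrow> ('w \<Rightarrow> real) \<Rightarrow> real \<Rightarrow> real \<Rightarrow> bool" where
  "has_normal_law M X \<mu> v \<longleftrightarrow> X \<in> borel_measurable M \<and> 0 \<le> v \<and> distr M borel X = normal_law \<mu> v"

definition sq_integrable :: "'a measure \<Rightarrow> ('a \<Rightarrow> real) \<Rightarrow> bool" where
  "sq_integrable M f \<longleftrightarrow> f \<in> borel_measurable M \<and> integrable M (\<lambda>x. (f x)\<^sup>2)"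

definition tendsto_L2 :: "'a measure \<Rightarrow> ('i \<Rightarrow> 'a \<Rightarrow> real) \<Rightarrow> ('a \<Rightarrow> real) \<Rightarrow> 'i filter \<Rightarrow> bool" where
  "tendsto_L2 M X Y F \<longleftrightarrow>
     (\<forall>\<^sub>F i in F. sq_integrable M (X i)) \<and> sq_integrable M Y \<and>
     ((\<lambda>i. \<integral>\<^sup>+x. ennreal ((X i x - Y x)\<^sup>2) \<partial>M) \<longlongrightarrow> 0) F"

definition tendsto_prob :: "'a measure \<Rightarrow> ('i \<Rightarrow> 'a \<Rightarrow> real) \<Rightarrow> ('a \<Rightarrow> real) \<Rightarrow> 'i filter \<Rightarrow> bool" where
  "tendsto_prob M X Y F \<longleftrightarrow>
     (\<forall>\<^sub>F i in F. X i \<in> borel_measurable M) \<and> Y \<in> borel_measurable M \<and>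
     (\<forall>\<epsilon>>0. ((\<lambda>i. measure M {\<omega> \<in> space M. \<epsilon> < \<bar>X i \<omega> - Y \<omega>\<bar>}) \<longlongrightarrow> 0) F)"

section \<open>Wiener process and stochastic integrals of deterministic functions\<close>

definition wiener_process :: "'w measure \<Rightarrow> (real \<Rightarrow> 'w \<Rightarrow> real) \<Rightarrow> bool" where
  "wiener_process M B \<longleftrightarrow>
     prob_space M \<and>
     (\<forall>t\<ge>0. B t \<in> borel_measurable M) \<and>
     (AE \<omega> in M. B 0 \<omega> = 0) \<and>
     (\<forall>s t. 0 \<le> s \<and> s < t \<longrightarrow> has_normal_law M (\<lambda>\<omega>. B t \<omega> - B s \<omega>) 0 (t - s)) \<and>
     (\<forall>(n::nat) \<tau>. 0 \<le> \<tau> 0 \<and> (\<forall>i<n. \<tau> i \<le> \<tau> (Suc i)) \<longrightarrow>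
        prob_space.indep_vars M (\<lambda>_. borel) (\<lambda>i \<omega>. B (\<tau> (Suc i)) \<omega> - B (\<tau> i) \<omega>) {..<n}) \<and>
     (AE \<omega> in M. continuous_on {0..} (\<lambda>t. B t \<omega>))"

text \<open>
  A step function with \<open>n\<close> steps is given by its partition points \<open>\<tau> 0 \<le> \<dots> \<le> \<tau> n\<close> and its
  values \<open>c 0, \<dots>, c (n - 1)\<close>.
\<close>

definition is_partition :: "real \<Rightarrow> real \<Rightarrow> nat \<Rightarrow> (nat \<Rightarrow> real) \<Rightarrow> bool" where
  "is_partition u v n \<tau> \<longleftrightarrow> u \<le> \<tau> 0 \<and> (\<forall>i<n. \<tau> i \<le> \<tau> (Suc i)) \<and> \<tau> n \<le> v"

definition step_fun :: "nat \<Rightarrow> (nat \<Rightarrow> real) \<Rightarrow> (nat \<Rightarrow> real) \<Rightarrow> real \<Rightarrow> real" where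
  "step_fun n \<tau> c x = (\<Sum>i<n. c i * indicator {\<tau> i<..\<tau> (Suc i)} x)"

definition step_integral ::
  "(real \<Rightarrow> 'w \<Rightarrow> real) \<Rightarrow> nat \<Rightarrow> (nat \<Rightarrow> real) \<Rightarrow> (nat \<Rightarrow> real) \<Rightarrow> 'w \<Rightarrow> real" where
  "step_integral B n \<tau> c \<omega> = (\<Sum>i<n. c i * (B (\<tau> (Suc i)) \<omega> - B (\<tau> i) \<omega>))"

text \<open>
  \<open>X\<close> is a version of the Ito integral \<open>\<integral>\<^sub>u\<^sup>v f(x) dB\<^sub>x\<close> of the deterministic function \<open>f\<close>: the
  \<open>L\<^sup>2\<close>-limit of the integrals of step functions approximating \<open>f\<close> in \<open>L\<^sup>2[u,v]\<close>. By the Ito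
  isometry the limit does not depend on the approximating sequence, and it is unique up to null sets.
\<close>

definition has_wiener_integral ::
  "'w measure \<Rightarrow> (real \<Rightarrow> 'w \<Rightarrow> real) \<Rightarrow> real \<Rightarrow> real \<Rightarrow> (real \<Rightarrow> real) \<Rightarrow> ('w \<Rightarrow> real) \<Rightarrow> bool" where
  "has_wiener_integral M B u v f X \<longleftrightarrow>
     (\<exists>(n :: nat \<Rightarrow> nat) \<tau> c.
        (\<forall>k. is_partition u v (n k) (\<tau> k)) \<and>
        tendsto_L2 (restrict_space lborel {u..v}) (\<lambda>k. step_fun (n k) (\<tau> k) (c k)) f sequentially \<and>
        tendsto_L2 M (\<lambda>k. step_integral B (n k) (\<tau> k) (c k)) X sequentially)"

section \<open>Gaussian and Markov processes, transition densities\<close>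

text \<open>Multivariate normality of all finite-dimensional distributions, via linear combinations.\<close>

definition gauss_process :: "'w measure \<Rightarrow> real set \<Rightarrow> (real \<Rightarrow> 'w \<Rightarrow> real) \<Rightarrow> bool" where
  "gauss_process M I X \<longleftrightarrow>
     (\<forall>J c. finite J \<and> J \<subseteq> I \<longrightarrow> (\<exists>\<mu> v. has_normal_law M (\<lambda>\<omega>. \<Sum>t\<in>J. c t * X t \<omega>) \<mu> v))"

definition natural_filtration ::
  "'w measure \<Rightarrow> real set \<Rightarrow> (real \<Rightarrow> 'w \<Rightarrow> real) \<Rightarrow> real \<Rightarrow> 'w measure" where
  "natural_filtration M I X s =
     sigma (space M) {X u -` A \<inter> space M | u A. u \<in> I \<and> u \<le> s \<and> A \<in> sets borel}"

definition markov_process :: "'w measure \<Rightarrow> real set \<Rightarrow> (real \<Rightarrow> 'w \<Rightarrow> real) \<Rightarrow> bool" where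
  "markov_process M I X \<longleftrightarrow>
     (\<forall>t\<in>I. X t \<in> borel_measurable M) \<and>
     (\<forall>s\<in>I. \<forall>t\<in>I. s \<le> t \<longrightarrow> (\<forall>A\<in>sets borel. AE \<omega> in M.
        real_cond_exp M (natural_filtration M I X s) (indicator (X t -` A \<inter> space M)) \<omega> =
        real_cond_exp M (vimage_algebra (space M) (X s) borel) (indicator (X t -` A \<inter> space M)) \<omega>))"

text \<open>
  \<open>p s t x\<close> is the transition density of \<open>X\<^sub>t\<close> given \<open>X\<^sub>s = x\<close>: for every \<open>x\<close> it is a
  probability density, the resulting kernels satisfy the Chapman-Kolmogorov equations, and they are
  regular versions of the conditional laws of \<open>X\<^sub>t\<close> given the past up to time \<open>s\<close>.
\<close>

definition has_transition_density ::
  "'w measure \<Rightarrow> real set \<Rightarrow> (real \<Rightarrow> 'w \<Rightarrow> real) \<Rightarrow> (real \<Rightarrow> real \<Rightarrow> real \<Rightarrow> real \<Rightarrow> real) \<Rightarrow> bool" where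
  "has_transition_density M I X p \<longleftrightarrow>
     (\<forall>t\<in>I. X t \<in> borel_measurable M) \<and>
     (\<forall>s\<in>I. \<forall>t\<in>I. s < t \<longrightarrow>
        (\<lambda>(x, y). p s t x y) \<in> borel_measurable (borel \<Otimes>\<^sub>M borel) \<and>
        (\<forall>x. (\<forall>y. 0 \<le> p s t x y) \<and> (\<integral>\<^sup>+y. ennreal (p s t x y) \<partial>lborel) = 1) \<and>
        (\<forall>A\<in>sets borel. AE \<omega> in M.
           real_cond_exp M (natural_filtration M I X s) (indicator (X t -` A \<inter> space M)) \<omega> =
           (LINT y:A|lborel. p s t (X s \<omega>) y))) \<and>
     (\<forall>s\<in>I. \<forall>u\<in>I. \<forall>t\<in>I. s < u \<and> u < t \<longrightarrow> (\<forall>x. AE y in lborel.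
        ennreal (p s t x y) = (\<integral>\<^sup>+z. ennreal (p s u x z * p u t z y) \<partial>lborel)))"

section \<open>Coefficients of the bridge\<close>

definition qbar :: "(real \<Rightarrow> real) \<Rightarrow> real \<Rightarrow> real" where
  "qbar q t = integral {0..t} q"

definition mean_fn :: "(real \<Rightarrow> real) \<Rightarrow> (real \<Rightarrow> real) \<Rightarrow> real \<Rightarrow> real \<Rightarrow> real \<Rightarrow> real" where
  "mean_fn q r x s t =
     exp (qbar q t - qbar q s) * x + integral {s..t} (\<lambda>u. exp (qbar q t - qbar q u) * r u)"

definition gam :: "(real \<Rightarrow> real) \<Rightarrow> (real \<Rightarrow> real) \<Rightarrow> real \<Rightarrow> real \<Rightarrow> real" where
  "gam q \<sigma> s t = integral {s..t} (\<lambda>u. exp (2 * (qbar q t - qbar q u)) * (\<sigma> u)\<^sup>2)"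

definition bridge_mean ::
  "(real \<Rightarrow> real) \<Rightarrow> (real \<Rightarrow> real) \<Rightarrow> (real \<Rightarrow> real) \<Rightarrow> real \<Rightarrow> real \<Rightarrow> real \<Rightarrow> real \<Rightarrow> real \<Rightarrow> real" where
  "bridge_mean q \<sigma> r T a b s t =
     gam q \<sigma> s t / gam q \<sigma> s T * exp (qbar q T - qbar q t) *
       (b - integral {t..T} (\<lambda>u. exp (qbar q T - qbar q u) * r u)) +
     gam q \<sigma> t T / gam q \<sigma> s T * mean_fn q r a s t"

text \<open>The two-argument \<open>\<sigma>(s,t)\<close>, as opposed to the coefficient \<open>\<sigma>(u)\<close>.\<close>

definition bridge_var ::
  "(real \<Rightarrow> real) \<Rightarrow> (real \<Rightarrow> real) \<Rightarrow> real \<Rightarrow> real \<Rightarrow> real \<Rightarrow> real" where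
  "bridge_var q \<sigma> T s t = gam q \<sigma> s t * gam q \<sigma> t T / gam q \<sigma> s T"

end

theory Submission
  imports Defs
begin

text \<open>
  Put \<open>E = exp (qbar q)\<close>, \<open>\<psi> t = \<integral>\<^sub>0\<^sup>t \<sigma>\<^sup>2 / E\<^sup>2\<close> and \<open>D = \<psi> T - \<psi>\<close>. Then \<open>gam s t = (E t)\<^sup>2 (D s - D t)\<close>,
  so the integrand factorizes as \<open>E t * D t * h s\<close> with \<open>h = \<sigma> / (E D)\<close>, and
  \<open>U t = bridge_mean 0 t + E t * D t * Z t\<close> for the single process \<open>Z t = \<integral>\<^sub>0\<^sup>t h dB\<close>. Since
  \<open>(1 / D)' = h\<^sup>2\<close>, the process \<open>Z\<close> is a Brownian motion at the clock \<open>1 / D t - 1 / D 0\<close>: its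
  increments are centred normal and independent of the past, which is inherited from step integrals
  through the conditional characteristic functions. This yields the Gauss and Markov properties and
  the transition kernels. The convergence \<open>D t * Z t \<rightarrow> 0\<close> is the strong law of large numbers for
  Brownian motion; it follows from Kolmogorov's maximal inequality and Borel-Cantelli along times
  at which \<open>D\<close> halves.
\<close>

section \<open>Normal laws\<close>

text \<open>Each \<open>J t\<close> is given for its own \<open>t\<close>, up to a null set, by an
  approximating sequence unrelated to those of other times. Statements about two times must
  reconcile such sequences; the isometry for step integrals over arbitrary, possibly overlapping
  intervals does this. For the same reason \<open>Z t\<close> is a function of the past of
  \<open>B\<close> only up to null sets, so independence is carried over to the natural filtration
  of \<open>Z\<close> by comparing events almost surely, without completing a sigma-algebra.

  The function \<open>h\<close> is not square integrable up to \<open>T\<close>, hence the family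
  \<open>Z t\<close> is unbounded in mean square as \<open>t\<close> tends to \<open>T\<close>. In
  mean square the factor \<open>E t * D t\<close> compensates exactly: the variance is
  \<open>(E t)\<^sup>2 * D t * (1 - D t / D 0)\<close>, which vanishes at \<open>T\<close>. For
  paths this is not enough, since uncountably many times must be controlled at once; hence the
  maximal inequality on blocks of time and the use of path continuity.

  Characteristic functions treat it together with the other cases.\<close>

lemma sets_normal_law [simp, measurable_cong]: "sets (normal_law \<mu> v) = sets borel"
  by (simp add: normal_law_def)

lemma space_normal_law [simp]: "space (normal_law \<mu> v) = UNIV"
  by (simp add: normal_law_def)

text \<open>Moments and characteristic functions are known for the standard normal law; the affine
  image transports them to every nondegenerate one.\<close>

lemma normal_law_eq_distr_std:
  assumes "0 < v"
  shows "normal_law \<mu> v = distr std_normal_distribution borel (\<lambda>x. \<mu> + sqrt v * x)"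
proof -
  interpret N: prob_space std_normal_distribution
    by (rule prob_space_normal_density) simp
  have id: "distr std_normal_distribution lborel (\<lambda>x. x) = std_normal_distribution"
    by (rule distr_id2) simp
  have "distributed std_normal_distribution lborel (\<lambda>x. x) std_normal_density"
    unfolding distributed_def using id by simp
  from N.normal_density_affine[OF this, of "sqrt v" \<mu>] assms
  have "distributed std_normal_distribution lborel (\<lambda>x. \<mu> + sqrt v * x) (normal_density \<mu> (sqrt v))"
    by simp
  then have "distr std_normal_distribution lborel (\<lambda>x. \<mu> + sqrt v * x) = normal_law \<mu> v"
    using assms by (simp add: distributed_def normal_law_def)
  moreover have "distr std_normal_distribution lborel (\<lambda>x. \<mu> + sqrt v * x) =
      distr std_normal_distribution borel (\<lambda>x. \<mu> + sqrt v * x)"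
    by (rule distr_cong) auto
  ultimately show ?thesis by simp
qed

lemma real_distribution_normal_law:
  assumes "0 \<le> v"
  shows "real_distribution (normal_law \<mu> v)"
proof -
  have "prob_space (normal_law \<mu> v)"
  proof (cases "v = 0")
    case True
    then show ?thesis by (simp add: normal_law_def prob_space_return)
  next
    case False
    then show ?thesis
      using assms by (simp add: normal_law_def prob_space_normal_density)
  qed
  then show ?thesis
    by (simp add: real_distribution_def real_distribution_axioms_def)
qed

text \<open>One formula covers the point mass as well, so identifications of laws by Levy uniqueness
  need no case distinction on the variance.\<close>

lemma char_normal_law:
  assumes "0 \<le> v"
  shows "char (normal_law \<mu> v) t = exp (\<i> * of_real (t * \<mu>)) * of_real (exp (- (v * t\<^sup>2) / 2))"
proof (cases "v = 0")
  case True
  then show ?thesis by (simp add: char_def normal_law_def integral_return)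
next
  case False
  with assms have v: "0 < v" by simp
  have "char (normal_law \<mu> v) t = (CLINT x|std_normal_distribution. iexp (t * (\<mu> + sqrt v * x)))"
    by (simp add: char_def normal_law_eq_distr_std[OF v] integral_distr)
  also have "\<dots> = (CLINT x|std_normal_distribution. iexp (t * \<mu>) * iexp ((t * sqrt v) * x))"
    by (simp add: exp_add[symmetric] algebra_simps)
  also have "\<dots> = iexp (t * \<mu>) * char std_normal_distribution (t * sqrt v)"
    unfolding char_def by (rule integral_mult_right_zero)
  also have "\<dots> = exp (\<i> * of_real (t * \<mu>)) * of_real (exp (- (v * t\<^sup>2) / 2))"
    using assms by (simp add: char_std_normal_distribution power_mult_distrib mult.commute)
  finally show ?thesis .
qed

section \<open>Normal random variables through characteristic functions\<close>

context prob_space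
begin

lemma has_normal_lawI_char:
  assumes [measurable]: "X \<in> borel_measurable M" and "0 \<le> v"
    and "\<And>t. (CLINT \<omega>|M. iexp (t * X \<omega>)) = iexp (t * \<mu>) * of_real (exp (- (v * t\<^sup>2) / 2))"
  shows "has_normal_law M X \<mu> v"
proof -
  have "char (distr M borel X) = char (normal_law \<mu> v)"
    using assms by (auto simp: char_normal_law fun_eq_iff) (simp add: char_def integral_distr)
  then have "distr M borel X = normal_law \<mu> v"
    using assms by (intro Levy_uniqueness real_distribution_normal_law) auto
  then show ?thesis using assms by (simp add: has_normal_law_def)
qed

lemma has_normal_law_char:
  assumes "has_normal_law M X \<mu> v"
  shows "(CLINT \<omega>|M. iexp (t * X \<omega>)) = iexp (t * \<mu>) * of_real (exp (- (v * t\<^sup>2) / 2))"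
proof -
  have [measurable]: "X \<in> borel_measurable M" using assms by (simp add: has_normal_law_def)
  have "(CLINT \<omega>|M. iexp (t * X \<omega>)) = char (distr M borel X) t"
    by (simp add: char_def integral_distr)
  then show ?thesis
    using assms by (simp add: has_normal_law_def char_normal_law)
qed

lemma has_normal_law_affine:
  assumes "has_normal_law M X \<mu> v"
  shows "has_normal_law M (\<lambda>\<omega>. a + b * X \<omega>) (a + b * \<mu>) (b\<^sup>2 * v)"
proof (rule has_normal_lawI_char)
  show "(\<lambda>\<omega>. a + b * X \<omega>) \<in> borel_measurable M" "0 \<le> b\<^sup>2 * v"
    using assms by (auto simp: has_normal_law_def)
  fix t
  have "(CLINT \<omega>|M. iexp (t * (a + b * X \<omega>))) = (CLINT \<omega>|M. iexp (t * a) * iexp ((t * b) * X \<omega>))"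
    by (simp add: exp_add[symmetric] algebra_simps)
  also have "\<dots> = iexp (t * a) * (CLINT \<omega>|M. iexp ((t * b) * X \<omega>))"
    by (rule integral_mult_right_zero)
  also have "\<dots> = iexp (t * a) * (iexp ((t * b) * \<mu>) * of_real (exp (- (v * (t * b)\<^sup>2) / 2)))"
    by (simp only: has_normal_law_char[OF assms])
  also have "\<dots> = iexp (t * (a + b * \<mu>)) * of_real (exp (- (b\<^sup>2 * v * t\<^sup>2) / 2))"
    by (simp add: exp_add[symmetric] algebra_simps power_mult_distrib)
  finally show "(CLINT \<omega>|M. iexp (t * (a + b * X \<omega>))) =
      iexp (t * (a + b * \<mu>)) * of_real (exp (- (b\<^sup>2 * v * t\<^sup>2) / 2))" .
qed

lemma has_normal_law_const: "has_normal_law M (\<lambda>\<omega>. a) a 0"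
  by (rule has_normal_lawI_char) (auto simp: prob_space)

lemma has_normal_law_add_indep:
  assumes X: "has_normal_law M X \<mu> v" and Y: "has_normal_law M Y \<nu> w"
    and ind: "indep_var borel X borel Y"
  shows "has_normal_law M (\<lambda>\<omega>. X \<omega> + Y \<omega>) (\<mu> + \<nu>) (v + w)"
proof -
  have [measurable]: "X \<in> borel_measurable M" "Y \<in> borel_measurable M" and vw: "0 \<le> v" "0 \<le> w"
    using X Y by (auto simp: has_normal_law_def)
  have "char (distr M borel (\<lambda>\<omega>. X \<omega> + Y \<omega>)) = char (normal_law (\<mu> + \<nu>) (v + w))"
    unfolding fun_eq_iff char_distr_add[OF ind]
    using X Y vw
    by (auto simp: has_normal_law_def char_normal_law exp_add[symmetric] algebra_simps
      add_divide_distrib diff_divide_distrib simp flip: exp_of_real)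
  then have "distr M borel (\<lambda>\<omega>. X \<omega> + Y \<omega>) = normal_law (\<mu> + \<nu>) (v + w)"
    using vw by (intro Levy_uniqueness real_distribution_normal_law) auto
  then show ?thesis using vw by (simp add: has_normal_law_def)
qed

lemma has_normal_law_sum_indep:
  assumes "finite I" and "\<And>i. i \<in> I \<Longrightarrow> has_normal_law M (X i) (\<mu> i) (v i)"
    and "indep_vars (\<lambda>_. borel) X I"
  shows "has_normal_law M (\<lambda>\<omega>. \<Sum>i\<in>I. X i \<omega>) (\<Sum>i\<in>I. \<mu> i) (\<Sum>i\<in>I. v i)"
  using assms
proof (induction I rule: finite_induct)
  case empty
  then show ?case by (simp add: has_normal_law_const)
next
  case (insert i I)
  have "indep_var borel (X i) borel (\<lambda>\<omega>. \<Sum>i\<in>I. X i \<omega>)"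
    using insert by (intro indep_vars_sum) auto
  moreover have "indep_vars (\<lambda>_. borel) X I"
    using insert.prems(2) by (rule indep_vars_subset) auto
  ultimately show ?case
    using insert by (simp add: has_normal_law_add_indep)
qed

text \<open>The parameter \<open>v\<close> of a centred normal law is thereby tied to an
  expectation, which the isometry can compute and which passes to limits in mean square.\<close>

lemma has_normal_law_second_moment:
  assumes "has_normal_law M X 0 v"
  shows "integrable M X" "integrable M (\<lambda>\<omega>. (X \<omega>)\<^sup>2)" "expectation X = 0"
    "expectation (\<lambda>\<omega>. (X \<omega>)\<^sup>2) = v"
proof -
  have [measurable]: "X \<in> borel_measurable M" and v0: "0 \<le> v"
    and D: "distr M borel X = normal_law 0 v"
    using assms by (auto simp: has_normal_law_def)
  have *: "integrable (normal_law 0 v) (\<lambda>x. x) \<and> integrable (normal_law 0 v) (\<lambda>x. x\<^sup>2) \<and>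
    (\<integral>x. x \<partial>normal_law 0 v) = 0 \<and> (\<integral>x. x\<^sup>2 \<partial>normal_law 0 v) = v"
  proof (cases "v = 0")
    case True
    have "integrable (return borel (0::real)) (\<lambda>x. x)" "integrable (return borel (0::real)) (\<lambda>x. x\<^sup>2)"
      by (simp_all add: integrable_iff_bounded nn_integral_return)
    moreover have "(\<integral>x. x \<partial>return borel (0::real)) = 0" "(\<integral>x. x\<^sup>2 \<partial>return borel (0::real)) = 0"
      by (subst integral_return; simp)+
    moreover have "normal_law 0 v = return borel 0" using True by (simp add: normal_law_def)
    ultimately show ?thesis using True by metis
  next
    case False
    then have v: "0 < v" using v0 by simp
    have i: "integrable std_normal_distribution (\<lambda>x. x)" "integrable std_normal_distribution (\<lambda>x. x\<^sup>2)"
      using integrable_std_normal_distribution_moment[of 1] integrable_std_normal_distribution_moment[of 2] by auto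
    have m: "(\<integral>x. x \<partial>std_normal_distribution) = 0" "(\<integral>x. x\<^sup>2 \<partial>std_normal_distribution) = 1"
      using integral_std_normal_distribution_moment_odd[of 1] std_normal_distribution_even_moments(1)[of 1]
      by (auto simp: fact_numeral)
    have sq: "(0 + sqrt v * x)\<^sup>2 = v * x\<^sup>2" for x :: real
      using v by (simp add: power_mult_distrib)
    have meas: "(\<lambda>x. 0 + sqrt v * x) \<in> measurable std_normal_distribution borel"
      by simp
    have idm: "(\<lambda>x::real. x) \<in> borel_measurable borel" and sqm: "(\<lambda>x::real. x\<^sup>2) \<in> borel_measurable borel"
      by simp_all
    have 1: "integrable (normal_law 0 v) (\<lambda>x. x)"
      unfolding normal_law_eq_distr_std[OF v] integrable_distr_eq[OF meas idm]
      using integrable_mult_right[OF i(1), of "sqrt v"] by (simp only: add_0)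
    have 2: "integrable (normal_law 0 v) (\<lambda>x. x\<^sup>2)"
      unfolding normal_law_eq_distr_std[OF v] integrable_distr_eq[OF meas sqm] sq
      by (rule integrable_mult_right[OF i(2), of v])
    have 3: "(\<integral>x. x \<partial>normal_law 0 v) = 0"
      unfolding normal_law_eq_distr_std[OF v] integral_distr[OF meas idm]
      unfolding add_0 integral_mult_right_zero m by (rule mult_zero_right)
    have 4: "(\<integral>x. x\<^sup>2 \<partial>normal_law 0 v) = v"
      unfolding normal_law_eq_distr_std[OF v] integral_distr[OF meas sqm]
      unfolding sq integral_mult_right_zero m by (rule mult_1_right)
    show ?thesis using 1 2 3 4 by blast
  qed
  have "integrable (distr M borel X) (\<lambda>x. x) \<longleftrightarrow> integrable M X"
    "integrable (distr M borel X) (\<lambda>x. x\<^sup>2) \<longleftrightarrow> integrable M (\<lambda>\<omega>. (X \<omega>)\<^sup>2)"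
    by (rule integrable_distr_eq; simp)+
  moreover have "(\<integral>x. x \<partial>distr M borel X) = expectation X"
    "(\<integral>x. x\<^sup>2 \<partial>distr M borel X) = expectation (\<lambda>\<omega>. (X \<omega>)\<^sup>2)"
    by (rule integral_distr; simp)+
  ultimately have "integrable M X \<and> integrable M (\<lambda>\<omega>. (X \<omega>)\<^sup>2) \<and> expectation X = 0 \<and>
    expectation (\<lambda>\<omega>. (X \<omega>)\<^sup>2) = v"
    using * unfolding D by metis
  then show "integrable M X" "integrable M (\<lambda>\<omega>. (X \<omega>)\<^sup>2)" "expectation X = 0"
    "expectation (\<lambda>\<omega>. (X \<omega>)\<^sup>2) = v" by auto
qed

text \<open>On the event \<open>A\<close> the law of \<open>X\<close> is identified by its conditional characteristic function.\<close>

lemma indep_normal_lawI_char: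
  assumes [measurable]: "X \<in> borel_measurable M" "A \<in> events" "C \<in> sets borel" and v: "0 \<le> v"
    and char: "\<And>t. (CLINT \<omega>|M. indicator A \<omega> * iexp (t * X \<omega>)) = of_real (prob A * exp (- (v * t\<^sup>2) / 2))"
  shows "prob (A \<inter> (X -` C \<inter> space M)) = prob A * measure (normal_law 0 v) C"
proof (cases "prob A = 0")
  case True
  have "prob (A \<inter> (X -` C \<inter> space M)) \<le> prob A" by (intro finite_measure_mono) auto
  then show ?thesis using True by (simp add: measure_le_0_iff)
next
  case False
  \<comment> \<open>Conditioning on a non-null \<open>A\<close>: under the normalized restriction of
    \<open>M\<close> to \<open>A\<close>, the hypothesis \<open>char\<close> is the characteristic
    function of a centred normal law.\<close>
  let ?N = "uniform_measure M A"
  have p: "0 < prob A" using False by (simp add: zero_less_measure_iff)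
  have A0: "emeasure M A \<noteq> 0" using p by (auto simp: emeasure_eq_measure)
  interpret N: prob_space ?N
    using A0 by (intro prob_space_uniform_measure) auto
  have [measurable]: "X \<in> borel_measurable ?N" by simp
  have "has_normal_law ?N X 0 v"
  proof (rule N.has_normal_lawI_char)
    fix t
    have "(CLINT \<omega>|?N. iexp (t * X \<omega>)) = (CLINT \<omega>|M. indicator A \<omega> * iexp (t * X \<omega>)) / of_real (prob A)"
    proof -
      have "?N = density M (\<lambda>\<omega>. ennreal (indicator A \<omega> / prob A))"
        unfolding uniform_measure_def using p
        by (intro density_cong)
           (auto simp: emeasure_eq_measure indicator_def divide_ennreal ennreal_1[symmetric] simp del: ennreal_1)
      then have "(CLINT \<omega>|?N. iexp (t * X \<omega>)) = (CLINT \<omega>|M. (indicator A \<omega> / prob A) *\<^sub>R iexp (t * X \<omega>))"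
        using p by (simp add: integral_density)
      also have "\<dots> = (CLINT \<omega>|M. (indicator A \<omega> * iexp (t * X \<omega>)) / of_real (prob A))"
        by (intro Bochner_Integration.integral_cong) (auto simp: indicator_def scaleR_conv_of_real)
      finally show ?thesis by simp
    qed
    from this[unfolded char] show "(CLINT \<omega>|?N. iexp (t * X \<omega>)) = iexp (t * 0) * of_real (exp (- (v * t\<^sup>2) / 2))"
      using p by simp
  qed (auto simp: v)
  then have "measure ?N (X -` C \<inter> space ?N) = measure (normal_law 0 v) C"
    by (subst measure_distr[where N = borel, symmetric]) (auto simp: has_normal_law_def)
  moreover have "measure ?N (X -` C \<inter> space M) = prob (A \<inter> (X -` C \<inter> space M)) / prob A"
    using A0 by (subst measure_uniform_measure) auto
  ultimately show ?thesis using p by (simp add: field_simps)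
qed

end

section \<open>Mean square convergence and independence\<close>

lemma sq_integrable_cmult: "sq_integrable N f \<Longrightarrow> sq_integrable N (\<lambda>x. c * f x)"
  by (auto simp: sq_integrable_def power_mult_distrib)

lemma sq_integrable_add:
  assumes "sq_integrable N f" "sq_integrable N g"
  shows "sq_integrable N (\<lambda>x. f x + g x)"
proof -
  have [measurable]: "f \<in> borel_measurable N" "g \<in> borel_measurable N"
    using assms by (auto simp: sq_integrable_def)
  have "integrable N (\<lambda>x. 2 * (f x)\<^sup>2 + 2 * (g x)\<^sup>2)"
    using assms by (auto simp: sq_integrable_def)
  then have "integrable N (\<lambda>x. (f x + g x)\<^sup>2)"
  proof (rule Bochner_Integration.integrable_bound)
    show "AE x in N. norm ((f x + g x)\<^sup>2) \<le> norm (2 * (f x)\<^sup>2 + 2 * (g x)\<^sup>2)"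
    proof (rule AE_I2)
      fix x
      show "norm ((f x + g x)\<^sup>2) \<le> norm (2 * (f x)\<^sup>2 + 2 * (g x)\<^sup>2)"
      proof -
        have "(f x + g x)\<^sup>2 \<le> 2 * (f x)\<^sup>2 + 2 * (g x)\<^sup>2"
          using sum_squares_bound[of "f x" "g x"] by (simp add: power2_sum)
        then show ?thesis by simp
      qed
    qed
  qed simp
  then show ?thesis by (simp add: sq_integrable_def)
qed

lemma sq_integrable_diff:
  assumes "sq_integrable N f" "sq_integrable N g"
  shows "sq_integrable N (\<lambda>x. f x - g x)"
  using sq_integrable_add[OF assms(1) sq_integrable_cmult[OF assms(2), of "-1"]] by simp

lemma sq_integrable_sum:
  assumes "\<And>i. i \<in> I \<Longrightarrow> sq_integrable N (f i)"
  shows "sq_integrable N (\<lambda>x. \<Sum>i\<in>I. f i x)"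
  using assms
proof (induction I rule: infinite_finite_induct)
  case (insert i I)
  then show ?case by (simp add: sq_integrable_add)
qed (simp_all add: sq_integrable_def)

lemma sq_integrable_mult:
  assumes "sq_integrable N f" "sq_integrable N g"
  shows "integrable N (\<lambda>x. f x * g x)"
proof -
  have [measurable]: "f \<in> borel_measurable N" "g \<in> borel_measurable N"
    using assms by (auto simp: sq_integrable_def)
  have "integrable N (\<lambda>x. (f x)\<^sup>2 + (g x)\<^sup>2)"
    using assms by (auto simp: sq_integrable_def)
  then show ?thesis
  proof (rule Bochner_Integration.integrable_bound)
    show "AE x in N. norm (f x * g x) \<le> norm ((f x)\<^sup>2 + (g x)\<^sup>2)"
    proof (rule AE_I2)
      fix x
      show "norm (f x * g x) \<le> norm ((f x)\<^sup>2 + (g x)\<^sup>2)"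
      proof -
        have "2 * (\<bar>f x\<bar> * \<bar>g x\<bar>) \<le> (f x)\<^sup>2 + (g x)\<^sup>2"
          using sum_squares_bound[of "\<bar>f x\<bar>" "\<bar>g x\<bar>"] by simp
        moreover have "0 \<le> \<bar>f x\<bar> * \<bar>g x\<bar>" by simp
        ultimately have "\<bar>f x\<bar> * \<bar>g x\<bar> \<le> (f x)\<^sup>2 + (g x)\<^sup>2" by linarith
        then show ?thesis by (simp add: abs_mult)
      qed
    qed
  qed simp
qed

section \<open>Convergence in mean square\<close>

lemma nn_integral_sq:
  assumes "sq_integrable N f"
  shows "(\<integral>\<^sup>+x. ennreal ((f x)\<^sup>2) \<partial>N) = ennreal (\<integral>x. (f x)\<^sup>2 \<partial>N)"
  using assms by (intro nn_integral_eq_integral) (auto simp: sq_integrable_def)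

lemma tendsto_L2_iff:
  assumes "\<And>i. sq_integrable N (X i)" "sq_integrable N Y"
  shows "tendsto_L2 N X Y F \<longleftrightarrow> ((\<lambda>i. \<integral>x. (X i x - Y x)\<^sup>2 \<partial>N) \<longlongrightarrow> 0) F"
proof -
  have "(\<integral>\<^sup>+x. ennreal ((X i x - Y x)\<^sup>2) \<partial>N) = ennreal (\<integral>x. (X i x - Y x)\<^sup>2 \<partial>N)" for i
    using assms by (intro nn_integral_sq sq_integrable_diff) auto
  then show ?thesis
    using assms tendsto_ennreal_iff[where F = F and f = "\<lambda>i. \<integral>x. (X i x - Y x)\<^sup>2 \<partial>N" and x = 0]
    by (auto simp: tendsto_L2_def)
qed

lemma tendsto_L2_cmult:
  assumes "tendsto_L2 N X Y F"
  shows "tendsto_L2 N (\<lambda>i x. c * X i x) (\<lambda>x. c * Y x) F"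
proof -
  have Y: "sq_integrable N Y" and X: "\<forall>\<^sub>F i in F. sq_integrable N (X i)"
    and lim: "((\<lambda>i. \<integral>\<^sup>+x. ennreal ((X i x - Y x)\<^sup>2) \<partial>N) \<longlongrightarrow> 0) F"
    using assms by (auto simp: tendsto_L2_def)
  have "((\<lambda>i. ennreal (c\<^sup>2) * (\<integral>\<^sup>+x. ennreal ((X i x - Y x)\<^sup>2) \<partial>N)) \<longlongrightarrow> ennreal (c\<^sup>2) * 0) F"
    by (intro ennreal_tendsto_cmult lim) simp
  moreover have "\<forall>\<^sub>F i in F. ennreal (c\<^sup>2) * (\<integral>\<^sup>+x. ennreal ((X i x - Y x)\<^sup>2) \<partial>N) =
      (\<integral>\<^sup>+x. ennreal ((c * X i x - c * Y x)\<^sup>2) \<partial>N)"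
    using X
  proof eventually_elim
    case (elim i)
    then have [measurable]: "X i \<in> borel_measurable N" "Y \<in> borel_measurable N"
      using Y by (auto simp: sq_integrable_def)
    show ?case
      by (subst nn_integral_cmult[symmetric])
         (auto simp: ennreal_mult[symmetric] power_mult_distrib right_diff_distrib[symmetric])
  qed
  ultimately have "((\<lambda>i. \<integral>\<^sup>+x. ennreal ((c * X i x - c * Y x)\<^sup>2) \<partial>N) \<longlongrightarrow> 0) F"
    by (simp add: tendsto_cong)
  then show ?thesis
    using Y X by (auto simp: tendsto_L2_def sq_integrable_cmult elim: eventually_mono)
qed

text \<open>The elementary bound (x + y)^2 \<le> 2 x^2 + 2 y^2 takes the place of Minkowski's
  inequality, so no square roots of integrals appear.\<close>

lemma tendsto_L2_add:
  assumes "tendsto_L2 N X Y F" "tendsto_L2 N X' Y' F"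
  shows "tendsto_L2 N (\<lambda>i x. X i x + X' i x) (\<lambda>x. Y x + Y' x) F"
proof -
  have Y: "sq_integrable N Y" "sq_integrable N Y'"
    and X: "\<forall>\<^sub>F i in F. sq_integrable N (X i) \<and> sq_integrable N (X' i)"
    and lim: "((\<lambda>i. \<integral>\<^sup>+x. ennreal ((X i x - Y x)\<^sup>2) \<partial>N) \<longlongrightarrow> 0) F"
      "((\<lambda>i. \<integral>\<^sup>+x. ennreal ((X' i x - Y' x)\<^sup>2) \<partial>N) \<longlongrightarrow> 0) F"
    using assms by (auto simp: tendsto_L2_def eventually_conj_iff)
  have "((\<lambda>i. ennreal 2 * (\<integral>\<^sup>+x. ennreal ((X i x - Y x)\<^sup>2) \<partial>N) +
      ennreal 2 * (\<integral>\<^sup>+x. ennreal ((X' i x - Y' x)\<^sup>2) \<partial>N)) \<longlongrightarrow> ennreal 2 * 0 + ennreal 2 * 0) F"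
    by (intro tendsto_add ennreal_tendsto_cmult lim) simp_all
  then have *: "((\<lambda>i. ennreal 2 * (\<integral>\<^sup>+x. ennreal ((X i x - Y x)\<^sup>2) \<partial>N) +
      ennreal 2 * (\<integral>\<^sup>+x. ennreal ((X' i x - Y' x)\<^sup>2) \<partial>N)) \<longlongrightarrow> 0) F" by simp
  have "((\<lambda>i. \<integral>\<^sup>+x. ennreal (((X i x + X' i x) - (Y x + Y' x))\<^sup>2) \<partial>N) \<longlongrightarrow> 0) F"
  proof (rule tendsto_sandwich[OF _ _ tendsto_const *])
    show "\<forall>\<^sub>F i in F. (\<integral>\<^sup>+x. ennreal (((X i x + X' i x) - (Y x + Y' x))\<^sup>2) \<partial>N) \<le>
      ennreal 2 * (\<integral>\<^sup>+x. ennreal ((X i x - Y x)\<^sup>2) \<partial>N) + ennreal 2 * (\<integral>\<^sup>+x. ennreal ((X' i x - Y' x)\<^sup>2) \<partial>N)"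
      using X
    proof eventually_elim
      case (elim i)
      then have [measurable]: "X i \<in> borel_measurable N" "Y \<in> borel_measurable N"
          "X' i \<in> borel_measurable N" "Y' \<in> borel_measurable N"
        using Y by (auto simp: sq_integrable_def)
      have le: "((p + p') - (r + r'))\<^sup>2 \<le> 2 * (p - r)\<^sup>2 + 2 * (p' - r')\<^sup>2" for p p' r r' :: real
        using sum_squares_bound[of "p - r" "p' - r'"] by (simp add: power2_eq_square algebra_simps)
      have "(\<integral>\<^sup>+x. ennreal (((X i x + X' i x) - (Y x + Y' x))\<^sup>2) \<partial>N) \<le>
        (\<integral>\<^sup>+x. ennreal 2 * ennreal ((X i x - Y x)\<^sup>2) + ennreal 2 * ennreal ((X' i x - Y' x)\<^sup>2) \<partial>N)"
        by (intro nn_integral_mono) (simp add: ennreal_mult[symmetric] ennreal_plus[symmetric] le del: ennreal_plus ennreal_numeral)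
      also have "\<dots> = ennreal 2 * (\<integral>\<^sup>+x. ennreal ((X i x - Y x)\<^sup>2) \<partial>N) +
          ennreal 2 * (\<integral>\<^sup>+x. ennreal ((X' i x - Y' x)\<^sup>2) \<partial>N)"
        by (simp add: nn_integral_add nn_integral_cmult)
      finally show ?case .
    qed
  qed simp
  then show ?thesis
    using Y X by (auto simp: tendsto_L2_def sq_integrable_add elim: eventually_mono)
qed

lemma tendsto_L2_diff:
  assumes "tendsto_L2 N X Y F" "tendsto_L2 N X' Y' F"
  shows "tendsto_L2 N (\<lambda>i x. X i x - X' i x) (\<lambda>x. Y x - Y' x) F"
  using tendsto_L2_add[OF assms(1) tendsto_L2_cmult[OF assms(2), of "-1"]] by simp

text \<open>Young's inequality in the form |p^2 - r^2| \<le> (1 + 1/e) (p - r)^2 + e r^2: the first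
  term tends to zero for fixed \<open>e\<close>, the second is small uniformly in \<open>i\<close>
  for small \<open>e\<close>.\<close>

lemma tendsto_L2_norm:
  assumes X: "\<And>i. sq_integrable N (X i)" and lim: "tendsto_L2 N X Y F"
  shows "((\<lambda>i. \<integral>x. (X i x)\<^sup>2 \<partial>N) \<longlongrightarrow> (\<integral>x. (Y x)\<^sup>2 \<partial>N)) F"
proof -
  have Y: "sq_integrable N Y" using lim by (simp add: tendsto_L2_def)
  have d: "((\<lambda>i. \<integral>x. (X i x - Y x)\<^sup>2 \<partial>N) \<longlongrightarrow> 0) F"
    using tendsto_L2_iff[of N X Y F, OF X Y] lim by simp
  define C where "C = (\<integral>x. (Y x)\<^sup>2 \<partial>N)"
  have C0: "0 \<le> C" by (simp add: C_def)
  have bound: "\<bar>(\<integral>x. (X i x)\<^sup>2 \<partial>N) - C\<bar> \<le> (1 + 1 / e) * (\<integral>x. (X i x - Y x)\<^sup>2 \<partial>N) + e * C"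
    if e: "0 < e" for e i
  proof -
    have i: "integrable N (\<lambda>x. (X i x)\<^sup>2)" "integrable N (\<lambda>x. (Y x)\<^sup>2)" "integrable N (\<lambda>x. (X i x - Y x)\<^sup>2)"
      using X[of i] Y sq_integrable_diff[OF X[of i] Y] by (auto simp: sq_integrable_def)
    have le: "\<bar>p\<^sup>2 - r\<^sup>2\<bar> \<le> (1 + 1 / e) * (p - r)\<^sup>2 + e * r\<^sup>2" for p r :: real
    proof -
      have "2 * (\<bar>p - r\<bar> * \<bar>r\<bar>) \<le> (p - r)\<^sup>2 / e + e * r\<^sup>2"
      proof -
        have "0 \<le> (\<bar>p - r\<bar> - e * \<bar>r\<bar>)\<^sup>2 / e" using e by simp
        also have "\<dots> = ((p - r)\<^sup>2 + e\<^sup>2 * r\<^sup>2 - 2 * e * (\<bar>p - r\<bar> * \<bar>r\<bar>)) / e"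
          by (simp add: power2_diff power_mult_distrib algebra_simps)
        also have "\<dots> = (p - r)\<^sup>2 / e + e * r\<^sup>2 - 2 * (\<bar>p - r\<bar> * \<bar>r\<bar>)"
          using e by (simp add: field_simps power2_eq_square)
        finally show ?thesis by simp
      qed
      moreover have "\<bar>p\<^sup>2 - r\<^sup>2\<bar> \<le> (p - r)\<^sup>2 + 2 * (\<bar>p - r\<bar> * \<bar>r\<bar>)"
      proof -
        have "p\<^sup>2 - r\<^sup>2 = (p - r)\<^sup>2 + 2 * ((p - r) * r)" by (simp add: power2_eq_square algebra_simps)
        then have "\<bar>p\<^sup>2 - r\<^sup>2\<bar> \<le> \<bar>(p - r)\<^sup>2\<bar> + \<bar>2 * ((p - r) * r)\<bar>" by linarith
        then show ?thesis by (simp add: abs_mult)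
      qed
      ultimately show ?thesis by (simp add: algebra_simps)
    qed
    have "\<bar>(\<integral>x. (X i x)\<^sup>2 \<partial>N) - C\<bar> = \<bar>\<integral>x. (X i x)\<^sup>2 - (Y x)\<^sup>2 \<partial>N\<bar>"
      using i by (simp add: C_def)
    also have "\<dots> \<le> (\<integral>x. \<bar>(X i x)\<^sup>2 - (Y x)\<^sup>2\<bar> \<partial>N)" by (rule integral_abs_bound)
    also have "\<dots> \<le> (\<integral>x. (1 + 1 / e) * (X i x - Y x)\<^sup>2 + e * (Y x)\<^sup>2 \<partial>N)"
      using i le by (intro integral_mono) auto
    also have "\<dots> = (1 + 1 / e) * (\<integral>x. (X i x - Y x)\<^sup>2 \<partial>N) + e * C"
      using i by (simp add: C_def)
    finally show ?thesis .
  qed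
  show ?thesis
    unfolding C_def[symmetric]
  proof (rule tendstoI)
    fix \<epsilon> :: real assume \<epsilon>: "0 < \<epsilon>"
    \<comment> \<open>Chosen so that \<open>e * C\<close> is at most half of the tolerance;
      \<open>C + 1\<close> keeps the denominator positive when \<open>Y\<close> vanishes.\<close>
    define e where "e = \<epsilon> / (2 * (C + 1))"
    have e0: "0 < e" using \<epsilon> C0 by (simp add: e_def)
    have "e * C \<le> e * (C + 1)" using e0 by simp
    also have "\<dots> = \<epsilon> / 2" using C0 by (simp add: e_def field_simps)
    finally have e: "0 < e" "e * C < \<epsilon> / 2 + \<epsilon> / 4" using e0 \<epsilon> by auto
    have "((\<lambda>i. (1 + 1 / e) * (\<integral>x. (X i x - Y x)\<^sup>2 \<partial>N)) \<longlongrightarrow> (1 + 1 / e) * 0) F"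
      by (intro tendsto_mult tendsto_const d)
    then have "\<forall>\<^sub>F i in F. (1 + 1 / e) * (\<integral>x. (X i x - Y x)\<^sup>2 \<partial>N) < \<epsilon> / 4"
      using \<epsilon> by (intro order_tendstoD(2)) auto
    then show "\<forall>\<^sub>F i in F. dist (\<integral>x. (X i x)\<^sup>2 \<partial>N) C < \<epsilon>"
    proof eventually_elim
      case (elim i)
      then show ?case using bound[OF e(1), of i] e(2) unfolding dist_real_def by linarith
    qed
  qed
qed

lemma tendsto_L2_cong_eventually:
  assumes "tendsto_L2 M X Y F" "\<forall>\<^sub>F i in F. X i = X' i" "\<And>\<omega>. \<omega> \<in> space M \<Longrightarrow> Y \<omega> = Y' \<omega>"
  shows "tendsto_L2 M X' Y' F"
proof -
  have Y': "sq_integrable M Y'"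
  proof -
    have "Y \<in> borel_measurable M \<longleftrightarrow> Y' \<in> borel_measurable M"
      using assms(3) by (intro measurable_cong) auto
    moreover have "integrable M (\<lambda>x. (Y x)\<^sup>2) \<longleftrightarrow> integrable M (\<lambda>x. (Y' x)\<^sup>2)"
      using assms(3) by (intro Bochner_Integration.integrable_cong) auto
    ultimately show ?thesis using assms(1) by (simp add: tendsto_L2_def sq_integrable_def)
  qed
  have X': "\<forall>\<^sub>F i in F. sq_integrable M (X' i)"
  proof -
    have "\<forall>\<^sub>F i in F. sq_integrable M (X i)" using assms(1) by (simp add: tendsto_L2_def)
    with assms(2) show ?thesis by eventually_elim simp
  qed
  have "\<forall>\<^sub>F i in F. (\<integral>\<^sup>+x. ennreal ((X i x - Y x)\<^sup>2) \<partial>M) = (\<integral>\<^sup>+x. ennreal ((X' i x - Y' x)\<^sup>2) \<partial>M)"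
    using assms(2) by eventually_elim (use assms(3) in \<open>auto intro!: nn_integral_cong\<close>)
  then have "((\<lambda>i. \<integral>\<^sup>+x. ennreal ((X' i x - Y' x)\<^sup>2) \<partial>M) \<longlongrightarrow> 0) F"
    using assms(1) by (auto simp: tendsto_L2_def elim: Lim_transform_eventually)
  with X' Y' show ?thesis by (simp add: tendsto_L2_def)
qed

text \<open>The squared differences converge in L1, which yields an almost everywhere convergent
  subsequence. Pointwise convergence is needed for dominated convergence of characteristic functions
  and for finding measurable versions of limits.\<close>

lemma tendsto_L2_AE_subseq:
  assumes "\<And>k. sq_integrable N (X k)" "tendsto_L2 N X Y sequentially"
  obtains r where "strict_mono r" "AE x in N. (\<lambda>k. X (r k) x) \<longlonglongrightarrow> Y x"
proof -
  have Y: "sq_integrable N Y" using assms by (simp add: tendsto_L2_def)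
  have "integrable N (\<lambda>x. (X k x - Y x)\<^sup>2)" for k
    using sq_integrable_diff[OF assms(1) Y] by (auto simp: sq_integrable_def)
  moreover have "(\<lambda>k. \<integral>x. norm ((X k x - Y x)\<^sup>2) \<partial>N) \<longlonglongrightarrow> 0"
    using tendsto_L2_iff[of N X Y sequentially, OF assms(1) Y] assms(2) by simp
  ultimately obtain r :: "nat \<Rightarrow> nat" where r: "strict_mono r" "AE x in N. (\<lambda>k. (X (r k) x - Y x)\<^sup>2) \<longlonglongrightarrow> 0"
    using tendsto_L1_AE_subseq[of N "\<lambda>k x. (X k x - Y x)\<^sup>2"] by blast
  from r(2) have "AE x in N. (\<lambda>k. X (r k) x) \<longlonglongrightarrow> Y x"
  proof (rule AE_mp, intro AE_I2 impI)
    fix x assume "(\<lambda>k. (X (r k) x - Y x)\<^sup>2) \<longlonglongrightarrow> 0"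
    from tendsto_real_sqrt[OF this] have "(\<lambda>k. X (r k) x - Y x) \<longlonglongrightarrow> 0"
      by (simp add: tendsto_rabs_zero_iff)
    then show "(\<lambda>k. X (r k) x) \<longlonglongrightarrow> Y x" by (simp add: LIM_zero_iff)
  qed
  with r(1) show thesis by (rule that)
qed

text \<open>Chebyshev's inequality with the second moment of the difference.\<close>

lemma tendsto_L2_imp_prob:
  assumes "prob_space M" "tendsto_L2 M X Y F"
  shows "tendsto_prob M X Y F"
proof -
  interpret prob_space M by fact
  have Y: "sq_integrable M Y" and X: "\<forall>\<^sub>F i in F. sq_integrable M (X i)"
    and lim: "((\<lambda>i. \<integral>\<^sup>+x. ennreal ((X i x - Y x)\<^sup>2) \<partial>M) \<longlongrightarrow> 0) F"
    using assms by (auto simp: tendsto_L2_def)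
  have "((\<lambda>i. measure M {\<omega> \<in> space M. \<epsilon> < \<bar>X i \<omega> - Y \<omega>\<bar>}) \<longlongrightarrow> 0) F" if \<epsilon>: "0 < \<epsilon>" for \<epsilon> :: real
  proof -
    have "((\<lambda>i. ennreal (1 / \<epsilon>\<^sup>2) * (\<integral>\<^sup>+x. ennreal ((X i x - Y x)\<^sup>2) \<partial>M)) \<longlongrightarrow> ennreal (1 / \<epsilon>\<^sup>2) * 0) F"
      by (intro ennreal_tendsto_cmult lim) simp
    then have *: "((\<lambda>i. ennreal (1 / \<epsilon>\<^sup>2) * (\<integral>\<^sup>+x. ennreal ((X i x - Y x)\<^sup>2) \<partial>M)) \<longlongrightarrow> 0) F" by simp
    have "((\<lambda>i. ennreal (measure M {\<omega> \<in> space M. \<epsilon> < \<bar>X i \<omega> - Y \<omega>\<bar>})) \<longlongrightarrow> ennreal 0) F"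
    proof (subst ennreal_0, rule tendsto_sandwich[OF _ _ tendsto_const *])
      show "\<forall>\<^sub>F i in F. ennreal (measure M {\<omega> \<in> space M. \<epsilon> < \<bar>X i \<omega> - Y \<omega>\<bar>}) \<le>
        ennreal (1 / \<epsilon>\<^sup>2) * (\<integral>\<^sup>+x. ennreal ((X i x - Y x)\<^sup>2) \<partial>M)"
        using X
      proof eventually_elim
        case (elim i)
        then have [measurable]: "X i \<in> borel_measurable M" "Y \<in> borel_measurable M"
          using Y by (auto simp: sq_integrable_def)
        have "emeasure M {\<omega> \<in> space M. \<epsilon> < \<bar>X i \<omega> - Y \<omega>\<bar>} =
          (\<integral>\<^sup>+x. indicator {\<omega> \<in> space M. \<epsilon> < \<bar>X i \<omega> - Y \<omega>\<bar>} x \<partial>M)" by simp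
        also have "\<dots> \<le> (\<integral>\<^sup>+x. ennreal (1 / \<epsilon>\<^sup>2) * ennreal ((X i x - Y x)\<^sup>2) \<partial>M)"
        proof (rule nn_integral_mono)
          fix x
          show "indicator {\<omega> \<in> space M. \<epsilon> < \<bar>X i \<omega> - Y \<omega>\<bar>} x \<le> ennreal (1 / \<epsilon>\<^sup>2) * ennreal ((X i x - Y x)\<^sup>2)"
          proof (cases "\<epsilon> < \<bar>X i x - Y x\<bar>")
            case True
            then have "\<epsilon>\<^sup>2 \<le> \<bar>X i x - Y x\<bar>\<^sup>2" using \<epsilon> by (intro power_mono) auto
            then have "1 \<le> 1 / \<epsilon>\<^sup>2 * (X i x - Y x)\<^sup>2" using \<epsilon> by (simp add: field_simps)
            then have "1 \<le> ennreal (1 / \<epsilon>\<^sup>2 * (X i x - Y x)\<^sup>2)"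
              by (simp add: ennreal_1[symmetric] del: ennreal_1)
            then have "1 \<le> ennreal (1 / \<epsilon>\<^sup>2) * ennreal ((X i x - Y x)\<^sup>2)"
              by (subst ennreal_mult[symmetric]) auto
            then show ?thesis by (simp only: indicator_def) auto
          qed simp
        qed
        also have "\<dots> = ennreal (1 / \<epsilon>\<^sup>2) * (\<integral>\<^sup>+x. ennreal ((X i x - Y x)\<^sup>2) \<partial>M)"
          by (simp add: nn_integral_cmult)
        finally show ?case by (simp add: emeasure_eq_measure)
      qed
    qed simp
    then show ?thesis by (subst (asm) tendsto_ennreal_iff) auto
  qed
  moreover have "\<forall>\<^sub>F i in F. X i \<in> borel_measurable M"
    using X by (auto simp: sq_integrable_def elim: eventually_mono)
  ultimately show ?thesis using Y by (auto simp: tendsto_prob_def sq_integrable_def)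
qed

text \<open>The library's \<open>indep_var\<close> needs both variables to have the same type, so independence of
  a random variable from a sub-\<open>\<sigma>\<close>-algebra is spelled out.\<close>

definition indep_of :: "'w measure \<Rightarrow> 'w measure \<Rightarrow> ('w \<Rightarrow> real) \<Rightarrow> bool" where
  "indep_of M G X \<longleftrightarrow> X \<in> borel_measurable M \<and>
     (\<forall>A\<in>sets G. \<forall>C\<in>sets borel.
        measure M (A \<inter> (X -` C \<inter> space M)) = measure M A * measure M (X -` C \<inter> space M))"

context prob_space
begin

text \<open>A real function measurable with respect to \<open>G\<close> brings both variables to the
  same type, so the product rules for expectations of an \<open>indep_var\<close> pair become
  available.\<close>

lemma indep_var_of_indep_of:
  assumes G: "subalgebra M G" and X: "indep_of M G X" and f: "f \<in> borel_measurable G"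
  shows "indep_var borel f borel X"
proof -
  have sp: "space G = space M" using G by (auto simp: subalgebra_def)
  have fM [measurable]: "f \<in> borel_measurable M" by (rule measurable_from_subalg[OF G f])
  have XM [measurable]: "X \<in> borel_measurable M" using X by (simp add: indep_of_def)
  have stable: "Int_stable {Y -` A \<inter> space M |A. A \<in> sets borel}" for Y :: "'a \<Rightarrow> real"
    unfolding Int_stable_def
  proof (intro ballI)
    fix a b assume "a \<in> {Y -` A \<inter> space M |A. A \<in> sets borel}" "b \<in> {Y -` A \<inter> space M |A. A \<in> sets borel}"
    then obtain A A' where "A \<in> sets borel" "A' \<in> sets borel" "a = Y -` A \<inter> space M" "b = Y -` A' \<inter> space M" by auto
    then show "a \<inter> b \<in> {Y -` A \<inter> space M |A. A \<in> sets borel}"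
      by (intro CollectI exI[of _ "A \<inter> A'"]) auto
  qed
  have "indep_set {f -` A \<inter> space M |A. A \<in> sets borel} {X -` A \<inter> space M |A. A \<in> sets borel}"
  proof (rule indep_setI)
    show "{f -` A \<inter> space M |A. A \<in> sets borel} \<subseteq> events" "{X -` A \<inter> space M |A. A \<in> sets borel} \<subseteq> events"
      by auto
    fix a b assume "a \<in> {f -` A \<inter> space M |A. A \<in> sets borel}" "b \<in> {X -` A \<inter> space M |A. A \<in> sets borel}"
    then obtain A C where AC: "A \<in> sets borel" "a = f -` A \<inter> space G" "C \<in> sets borel" "b = X -` C \<inter> space M"
      by (auto simp: sp)
    then have "a \<in> sets G" using f by auto
    with AC show "prob (a \<inter> b) = prob a * prob b" using X by (simp add: indep_of_def)
  qed
  then have "indep_set (sigma_sets (space M) {f -` A \<inter> space M |A. A \<in> sets borel})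
      (sigma_sets (space M) {X -` A \<inter> space M |A. A \<in> sets borel})"
    by (intro indep_set_sigma_sets stable)
  then show ?thesis by (simp add: indep_var_eq)
qed

text \<open>For \<open>A\<close> in \<open>G\<close> the expectation of
  \<open>iexp (t * X k)\<close> over \<open>A\<close> is \<open>prob A\<close> times a Gaussian
  factor. This product form survives dominated convergence along a subsequence, while the
  \<open>v k\<close>, being second moments, converge to that of \<open>Y\<close>. The limiting
  identity gives independence and normality at once.\<close>

lemma indep_normal_L2_limit:
  assumes G: "subalgebra M G" and ind: "\<And>k. indep_of M G (X k)"
    and nrm: "\<And>k. has_normal_law M (X k) 0 (v k)" and lim: "tendsto_L2 M X Y sequentially"
  shows "indep_of M G Y" "has_normal_law M Y 0 (expectation (\<lambda>\<omega>. (Y \<omega>)\<^sup>2))"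
proof -
  define w where "w = expectation (\<lambda>\<omega>. (Y \<omega>)\<^sup>2)"
  have w0: "0 \<le> w" by (simp add: w_def)
  have [measurable]: "X k \<in> borel_measurable M" "Y \<in> borel_measurable M" for k
    using nrm lim by (auto simp: has_normal_law_def tendsto_L2_def sq_integrable_def)
  have X: "sq_integrable M (X k)" for k
    using has_normal_law_second_moment(2)[OF nrm] by (simp add: sq_integrable_def)
  have "v = (\<lambda>k. expectation (\<lambda>\<omega>. (X k \<omega>)\<^sup>2))"
    using has_normal_law_second_moment(4)[OF nrm] by auto
  with tendsto_L2_norm[OF X lim] have v: "v \<longlonglongrightarrow> w" by (simp add: w_def)
  obtain r where r: "strict_mono r" "AE \<omega> in M. (\<lambda>k. X (r k) \<omega>) \<longlonglongrightarrow> Y \<omega>"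
    using tendsto_L2_AE_subseq[OF X lim] by blast
  have char: "(CLINT \<omega>|M. indicator A \<omega> * iexp (t * Y \<omega>)) = of_real (prob A * exp (- (w * t\<^sup>2) / 2))"
    if A: "A \<in> sets G" for A t
  proof -
    have AM [measurable]: "A \<in> events" using A G by (auto simp: subalgebra_def)
    have ind_c: "indicator A = (\<lambda>\<omega>. complex_of_real (indicator A \<omega>))"
      by (simp add: fun_eq_iff indicator_def)
    have c1: "(CLINT \<omega>|M. indicator A \<omega> * iexp (t * X k \<omega>)) = of_real (prob A * exp (- (v k * t\<^sup>2) / 2))" for k
    proof -
      have "indep_var borel (complex_of_real \<circ> indicator A) borel ((\<lambda>x. iexp (t * x)) \<circ> X k)"
        using A by (intro indep_var_compose[OF indep_var_of_indep_of[OF G ind, of "indicator A"]]) auto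
      then have "indep_var borel (\<lambda>\<omega>. indicator A \<omega> :: complex) borel (\<lambda>\<omega>. iexp (t * X k \<omega>))"
        by (simp add: comp_def of_real_indicator)
      moreover have "integrable M (\<lambda>\<omega>. indicator A \<omega> :: complex)"
        unfolding ind_c by (intro integrable_of_real integrable_real_indicator) (auto simp: emeasure_eq_measure)
      moreover have "integrable M (\<lambda>\<omega>. iexp (t * X k \<omega>))" by (intro integrable_iexp) auto
      ultimately have "(CLINT \<omega>|M. indicator A \<omega> * iexp (t * X k \<omega>)) =
          (CLINT \<omega>|M. indicator A \<omega>) * (CLINT \<omega>|M. iexp (t * X k \<omega>))"
        by (rule indep_var_lebesgue_integral)
      also have "(CLINT \<omega>|M. indicator A \<omega>) = of_real (prob A)"
        unfolding ind_c by (simp del: of_real_indicator)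
      finally show ?thesis unfolding has_normal_law_char[OF nrm] by simp
    qed
    have c2: "(\<lambda>k. CLINT \<omega>|M. indicator A \<omega> * iexp (t * X (r k) \<omega>)) \<longlonglongrightarrow>
        (CLINT \<omega>|M. indicator A \<omega> * iexp (t * Y \<omega>))"
    proof (rule integral_dominated_convergence[where w="\<lambda>_. 1"])
      show "AE \<omega> in M. (\<lambda>k. indicator A \<omega> * iexp (t * X (r k) \<omega>)) \<longlonglongrightarrow> indicator A \<omega> * iexp (t * Y \<omega>)"
        using r(2) by eventually_elim (auto intro!: tendsto_intros)
    qed (auto simp: norm_mult indicator_def)
    have "(\<lambda>k. complex_of_real (prob A * exp (- (v (r k) * t\<^sup>2) / 2))) \<longlonglongrightarrow> of_real (prob A * exp (- (w * t\<^sup>2) / 2))"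
      using LIMSEQ_subseq_LIMSEQ[OF v r(1)] unfolding comp_def by (intro tendsto_intros) auto
    from LIMSEQ_unique[OF c2[unfolded c1] this] show ?thesis .
  qed
  have key: "prob (A \<inter> (Y -` C \<inter> space M)) = prob A * measure (normal_law 0 w) C"
    if "A \<in> sets G" "C \<in> sets borel" for A C
  proof (rule indep_normal_lawI_char)
    show "A \<in> events" using that(1) G by (auto simp: subalgebra_def)
    show "(CLINT \<omega>|M. indicator A \<omega> * iexp (t * Y \<omega>)) = of_real (prob A * exp (- (w * t\<^sup>2) / 2))" for t
      by (rule char) fact
  qed (use that w0 in auto)
  \<comment> \<open>The whole space as conditioning event yields the unconditional law of
    \<open>Y\<close>, which turns \<open>key\<close> into a product formula.\<close>
  have sp: "space M \<in> sets G" using G sets.top[of G] by (simp add: subalgebra_def)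
  have law: "prob (Y -` C \<inter> space M) = measure (normal_law 0 w) C" if "C \<in> sets borel" for C
    using key[OF sp that] by (simp add: prob_space Int_absorb1)
  show "indep_of M G Y"
    unfolding indep_of_def by (intro conjI ballI) (simp_all only: key law, measurable)
  have "distr M borel Y = normal_law 0 w"
  proof (rule measure_eqI)
    interpret N: real_distribution "normal_law 0 w" by (rule real_distribution_normal_law) fact
    fix C assume "C \<in> sets (distr M borel Y)"
    then show "emeasure (distr M borel Y) C = emeasure (normal_law 0 w) C"
      using law by (simp add: emeasure_distr emeasure_eq_measure N.emeasure_eq_measure)
  qed simp
  then show "has_normal_law M Y 0 w" using w0 by (simp add: has_normal_law_def)
qed

end

section \<open>Step integrals against the Wiener process\<close>

lemma sets_natural_filtration:
  assumes "\<And>u. u \<in> I \<Longrightarrow> X u \<in> borel_measurable M"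
  shows "sets (natural_filtration M I X s) =
      sigma_sets (space M) {X u -` A \<inter> space M | u A. u \<in> I \<and> u \<le> s \<and> A \<in> sets borel}"
  unfolding natural_filtration_def by (rule sets_measure_of) auto

lemma space_natural_filtration [simp]: "space (natural_filtration M I X s) = space M"
  unfolding natural_filtration_def by (rule space_measure_of) auto

lemma subalgebra_natural_filtration:
  assumes "\<And>u. u \<in> I \<Longrightarrow> X u \<in> borel_measurable M"
  shows "subalgebra M (natural_filtration M I X s)"
proof -
  have "sigma_sets (space M) {X u -` A \<inter> space M | u A. u \<in> I \<and> u \<le> s \<and> A \<in> sets borel} \<subseteq> sets M"
    using assms by (intro sets.sigma_sets_subset) (auto dest: measurable_sets)
  then show ?thesis
    using sets_natural_filtration[OF assms] by (simp add: subalgebra_def)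
qed

lemma measurable_natural_filtration:
  assumes "\<And>u. u \<in> I \<Longrightarrow> X u \<in> borel_measurable M" "u \<in> I" "u \<le> s"
  shows "X u \<in> borel_measurable (natural_filtration M I X s)"
proof (rule measurableI)
  fix A :: "real set" assume "A \<in> sets borel"
  then have "X u -` A \<inter> space M \<in> sigma_sets (space M) {X u -` A \<inter> space M | u A. u \<in> I \<and> u \<le> s \<and> A \<in> sets borel}"
    using assms by (intro sigma_sets.Basic) auto
  then show "X u -` A \<inter> space (natural_filtration M I X s) \<in> sets (natural_filtration M I X s)"
    using sets_natural_filtration[OF assms(1)] by simp
qed simp

lemma partition_mono:
  assumes "is_partition u v n \<tau>" "i \<le> j" "j \<le> n"
  shows "\<tau> i \<le> \<tau> j"
  using assms(2,3)
proof (induction j rule: dec_induct)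
  case (step k)
  then have "\<tau> k \<le> \<tau> (Suc k)" using assms(1) by (simp add: is_partition_def)
  with step show ?case by simp
qed simp

lemma partition_bounds:
  assumes "is_partition u v n \<tau>" "i \<le> n"
  shows "u \<le> \<tau> i" "\<tau> i \<le> v"
  using partition_mono[OF assms(1), of 0 i] partition_mono[OF assms(1), of i n] assms
  by (auto simp: is_partition_def)

section \<open>Second moments and normality of step integrals\<close>

locale wiener = prob_space M for M :: "'w measure" +
  fixes B :: "real \<Rightarrow> 'w \<Rightarrow> real"
  assumes wiener: "wiener_process M B"
begin

lemma measurable_B [measurable]: "0 \<le> t \<Longrightarrow> B t \<in> borel_measurable M"
  using wiener by (simp add: wiener_process_def)

lemma incr_normal:
  assumes "0 \<le> s" "s \<le> t"
  shows "has_normal_law M (\<lambda>\<omega>. B t \<omega> - B s \<omega>) 0 (t - s)"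
proof (cases "s = t")
  case True
  then show ?thesis using has_normal_law_const[of 0] by simp
next
  case False
  then show ?thesis using wiener assms by (simp add: wiener_process_def)
qed

lemma incr_indep:
  assumes "0 \<le> \<tau> 0" "\<And>i. i < n \<Longrightarrow> \<tau> i \<le> \<tau> (Suc i)"
  shows "indep_vars (\<lambda>_. borel) (\<lambda>i \<omega>. B (\<tau> (Suc i)) \<omega> - B (\<tau> i) \<omega>) {..<n}"
  using wiener assms unfolding wiener_process_def by blast

lemma incr_sq:
  assumes "0 \<le> s" "0 \<le> t"
  shows "sq_integrable M (\<lambda>\<omega>. B t \<omega> - B s \<omega>)" "expectation (\<lambda>\<omega>. (B t \<omega> - B s \<omega>)\<^sup>2) = \<bar>t - s\<bar>"
proof -
  have "sq_integrable M (\<lambda>\<omega>. B t \<omega> - B s \<omega>) \<and> expectation (\<lambda>\<omega>. (B t \<omega> - B s \<omega>)\<^sup>2) = \<bar>t - s\<bar>"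
    if "0 \<le> s" "s \<le> t" for s t
    using has_normal_law_second_moment[OF incr_normal[OF that]] incr_normal[OF that] that
    by (simp add: sq_integrable_def has_normal_law_def)
  from this[of s t] this[of t s] assms
  show "sq_integrable M (\<lambda>\<omega>. B t \<omega> - B s \<omega>)" "expectation (\<lambda>\<omega>. (B t \<omega> - B s \<omega>)\<^sup>2) = \<bar>t - s\<bar>"
    by (cases "s \<le> t"; auto simp: sq_integrable_def power2_commute abs_if)+
qed

text \<open>By polarization, the second moments of the increments alone determine their covariances.\<close>

lemma incr_cov:
  assumes "0 \<le> a" "a \<le> b" "0 \<le> c" "c \<le> d"
  shows "expectation (\<lambda>\<omega>. (B b \<omega> - B a \<omega>) * (B d \<omega> - B c \<omega>)) =
    (\<integral>x. indicator {a<..b} x * indicator {c<..d} x \<partial>lborel)"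
proof -
  have i: "integrable M (\<lambda>\<omega>. (B t \<omega> - B s \<omega>)\<^sup>2)" if "0 \<le> s" "0 \<le> t" for s t
    using incr_sq(1)[OF that] by (simp add: sq_integrable_def)
  have b0: "0 \<le> b" and d0: "0 \<le> d" using assms by auto
  have "expectation (\<lambda>\<omega>. (B b \<omega> - B a \<omega>) * (B d \<omega> - B c \<omega>)) =
    expectation (\<lambda>\<omega>. ((B b \<omega> - B c \<omega>)\<^sup>2 + (B a \<omega> - B d \<omega>)\<^sup>2 - (B b \<omega> - B d \<omega>)\<^sup>2 - (B a \<omega> - B c \<omega>)\<^sup>2) / 2)"
    by (intro Bochner_Integration.integral_cong refl) (simp add: power2_eq_square field_simps)
  also have "\<dots> = (\<bar>b - c\<bar> + \<bar>a - d\<bar> - \<bar>b - d\<bar> - \<bar>a - c\<bar>) / 2"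
    using assms(1,3) b0 d0 i by (simp add: incr_sq)
  \<comment> \<open>The combination of absolute values is twice the length of the overlap of the two
    intervals before the division by 2; if they are disjoint, the half-open interval is empty and
    both sides vanish.\<close>
  also have "\<dots> = measure lborel {max a c<..min b d}"
    using assms by (auto simp: max_def min_def abs_if)
  also have "\<dots> = (\<integral>x. indicator {max a c<..min b d} x \<partial>lborel)" by simp
  also have "\<dots> = (\<integral>x. indicator {a<..b} x * indicator {c<..d} x \<partial>lborel)"
    by (intro Bochner_Integration.integral_cong refl) (auto simp: indicator_def)
  finally show ?thesis .
qed

text \<open>Expanding the square reduces everything to pairwise covariances, and
  \<open>incr_cov\<close> equates these with the integrals of products of indicators. The intervals
  may overlap, so step functions over different partitions need no common refinement.\<close>

lemma wiener_isometry:
  assumes I: "finite I" and lu: "\<And>i. i \<in> I \<Longrightarrow> 0 \<le> l i \<and> l i \<le> u i"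
  shows "sq_integrable M (\<lambda>\<omega>. \<Sum>i\<in>I. a i * (B (u i) \<omega> - B (l i) \<omega>))"
    and "expectation (\<lambda>\<omega>. (\<Sum>i\<in>I. a i * (B (u i) \<omega> - B (l i) \<omega>))\<^sup>2) =
      (\<integral>x. (\<Sum>i\<in>I. a i * indicator {l i<..u i} x)\<^sup>2 \<partial>lborel)"
proof -
  have sq: "sq_integrable M (\<lambda>\<omega>. B (u i) \<omega> - B (l i) \<omega>)" if "i \<in> I" for i
    using lu[OF that] by (intro incr_sq) auto
  then show "sq_integrable M (\<lambda>\<omega>. \<Sum>i\<in>I. a i * (B (u i) \<omega> - B (l i) \<omega>))"
    by (intro sq_integrable_sum sq_integrable_cmult)
  have int1: "integrable M (\<lambda>\<omega>. (B (u i) \<omega> - B (l i) \<omega>) * (B (u j) \<omega> - B (l j) \<omega>))" if "i \<in> I" "j \<in> I" for i j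
    using that by (intro sq_integrable_mult sq)
  have int2: "integrable lborel (\<lambda>x. indicator {l i<..u i} x * indicator {l j<..u j} x :: real)" for i j
  proof -
    have eq: "(\<lambda>x. indicator {l i<..u i} x * indicator {l j<..u j} x :: real) = indicator ({l i<..u i} \<inter> {l j<..u j})"
      by (auto simp: fun_eq_iff indicator_def)
    have "emeasure lborel ({l i<..u i} \<inter> {l j<..u j}) \<le> emeasure lborel {l i..u i}"
      by (intro emeasure_mono) auto
    also have "\<dots> < \<infinity>" by (simp add: emeasure_lborel_Icc_eq)
    finally show ?thesis unfolding eq by (intro integrable_real_indicator) auto
  qed
  have "expectation (\<lambda>\<omega>. (\<Sum>i\<in>I. a i * (B (u i) \<omega> - B (l i) \<omega>))\<^sup>2) =
    expectation (\<lambda>\<omega>. \<Sum>i\<in>I. \<Sum>j\<in>I. (a i * a j) * ((B (u i) \<omega> - B (l i) \<omega>) * (B (u j) \<omega> - B (l j) \<omega>)))"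
    by (intro Bochner_Integration.integral_cong refl)
       (simp add: power2_eq_square sum_product mult_ac)
  also have "\<dots> = (\<Sum>i\<in>I. \<Sum>j\<in>I. (a i * a j) *
      expectation (\<lambda>\<omega>. (B (u i) \<omega> - B (l i) \<omega>) * (B (u j) \<omega> - B (l j) \<omega>)))"
    using int1 by (simp add: Bochner_Integration.integral_sum)
  also have "\<dots> = (\<Sum>i\<in>I. \<Sum>j\<in>I. (a i * a j) *
      (\<integral>x. indicator {l i<..u i} x * indicator {l j<..u j} x \<partial>lborel))"
    using lu by (intro sum.cong refl arg_cong2[where f = "(*)"] incr_cov) auto
  also have "\<dots> = (\<integral>x. (\<Sum>i\<in>I. \<Sum>j\<in>I. (a i * a j) * (indicator {l i<..u i} x * indicator {l j<..u j} x)) \<partial>lborel)"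
    using int2 by (simp add: Bochner_Integration.integral_sum)
  also have "\<dots> = (\<integral>x. (\<Sum>i\<in>I. a i * indicator {l i<..u i} x)\<^sup>2 \<partial>lborel)"
    by (intro Bochner_Integration.integral_cong refl)
       (simp add: power2_eq_square sum_product mult_ac)
  finally show "expectation (\<lambda>\<omega>. (\<Sum>i\<in>I. a i * (B (u i) \<omega> - B (l i) \<omega>))\<^sup>2) =
      (\<integral>x. (\<Sum>i\<in>I. a i * indicator {l i<..u i} x)\<^sup>2 \<partial>lborel)" .
qed

lemma step_integral_diff_isometry:
  assumes "0 \<le> u" "0 \<le> u'" "is_partition u v n \<tau>" "is_partition u' v' n' \<tau>'"
  shows "expectation (\<lambda>\<omega>. (step_integral B n \<tau> c \<omega> - step_integral B n' \<tau>' c' \<omega>)\<^sup>2) =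
    (\<integral>x. (step_fun n \<tau> c x - step_fun n' \<tau>' c' x)\<^sup>2 \<partial>lborel)"
proof -
  \<comment> \<open>The steps of both partitions are put side by side as one family over the
    disjoint union of the index sets, the second family with negated coefficients.\<close>
  let ?I = "{..<n} <+> {..<n'}"
  define l where "l = case_sum \<tau> \<tau>'"
  define r where "r = case_sum (\<lambda>i. \<tau> (Suc i)) (\<lambda>i. \<tau>' (Suc i))"
  define a where "a = case_sum c (\<lambda>i. - c' i)"
  have "0 \<le> \<tau> i \<and> \<tau> i \<le> \<tau> (Suc i)" if "i < n" for i
    using that partition_bounds(1)[OF assms(3), of i] assms(1,3) by (auto simp: is_partition_def)
  moreover have "0 \<le> \<tau>' i \<and> \<tau>' i \<le> \<tau>' (Suc i)" if "i < n'" for i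
    using that partition_bounds(1)[OF assms(4), of i] assms(2,4) by (auto simp: is_partition_def)
  ultimately have lr: "0 \<le> l i \<and> l i \<le> r i" if "i \<in> ?I" for i
    using that unfolding l_def r_def by (elim PlusE) simp_all
  have "step_integral B n \<tau> c \<omega> - step_integral B n' \<tau>' c' \<omega> = (\<Sum>i\<in>?I. a i * (B (r i) \<omega> - B (l i) \<omega>))" for \<omega>
    by (simp add: sum.Plus step_integral_def a_def l_def r_def sum_negf)
  moreover have "step_fun n \<tau> c x - step_fun n' \<tau>' c' x = (\<Sum>i\<in>?I. a i * indicator {l i<..r i} x)" for x
    unfolding step_fun_def a_def l_def r_def
    by (simp only: sum.Plus finite_lessThan sum.case comp_def mult_minus_left sum_negf diff_conv_add_uminus)
  ultimately show ?thesis
    using wiener_isometry(2)[of ?I l r a] lr by simp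
qed

lemma sq_integrable_step_integral:
  assumes "0 \<le> u" "is_partition u v n \<tau>"
  shows "sq_integrable M (step_integral B n \<tau> c)"
proof -
  have "0 \<le> \<tau> i \<and> \<tau> i \<le> \<tau> (Suc i)" if "i < n" for i
    using that partition_bounds(1)[OF assms(2), of i] assms by (auto simp: is_partition_def)
  then show ?thesis
    using wiener_isometry(1)[of "{..<n}" \<tau> "\<lambda>i. \<tau> (Suc i)" c] by (simp add: step_integral_def[abs_def])
qed

text \<open>A sum of independent scaled increments. The variance is recorded as a second moment, the
  form in which the isometry and limits in mean square handle it.\<close>

lemma step_integral_normal:
  assumes "0 \<le> u" "is_partition u v n \<tau>"
  shows "has_normal_law M (step_integral B n \<tau> c) 0 (expectation (\<lambda>\<omega>. (step_integral B n \<tau> c \<omega>)\<^sup>2))"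
proof -
  have \<tau>: "0 \<le> \<tau> i \<and> \<tau> i \<le> \<tau> (Suc i)" if "i < n" for i
    using that partition_bounds(1)[OF assms(2), of i] assms by (auto simp: is_partition_def)
  have "has_normal_law M (\<lambda>\<omega>. \<Sum>i<n. c i * (B (\<tau> (Suc i)) \<omega> - B (\<tau> i) \<omega>)) (\<Sum>i<n. 0) (\<Sum>i<n. (c i)\<^sup>2 * (\<tau> (Suc i) - \<tau> i))"
  proof (rule has_normal_law_sum_indep)
    show "has_normal_law M (\<lambda>\<omega>. c i * (B (\<tau> (Suc i)) \<omega> - B (\<tau> i) \<omega>)) 0 ((c i)\<^sup>2 * (\<tau> (Suc i) - \<tau> i))" if "i \<in> {..<n}" for i
      using has_normal_law_affine[OF incr_normal[of "\<tau> i" "\<tau> (Suc i)"], of 0 "c i"] \<tau>[of i] that by simp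
    have "0 \<le> \<tau> 0" using partition_bounds(1)[OF assms(2), of 0] assms(1) by auto
    then have "indep_vars (\<lambda>_. borel) (\<lambda>i \<omega>. B (\<tau> (Suc i)) \<omega> - B (\<tau> i) \<omega>) {..<n}"
      using \<tau> by (intro incr_indep) auto
    from indep_vars_compose2[OF this, of "\<lambda>i x. c i * x" "\<lambda>_. borel"]
    show "indep_vars (\<lambda>_. borel) (\<lambda>i \<omega>. c i * (B (\<tau> (Suc i)) \<omega> - B (\<tau> i) \<omega>)) {..<n}" by simp
  qed simp
  then have "has_normal_law M (step_integral B n \<tau> c) 0 (\<Sum>i<n. (c i)\<^sup>2 * (\<tau> (Suc i) - \<tau> i))"
    by (simp add: step_integral_def[abs_def])
  from this has_normal_law_second_moment(4)[OF this] show ?thesis by simp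
qed

text \<open>Generated by increments from time 0 instead of values of \<open>B\<close>: independence
  is assumed for increments, and \<open>B 0\<close> vanishes only almost surely.\<close>

definition past :: "real \<Rightarrow> 'w measure" where
  "past s = natural_filtration M {0..} (\<lambda>u \<omega>. B u \<omega> - B 0 \<omega>) s"

lemma subalgebra_past: "subalgebra M (past s)"
  unfolding past_def by (rule subalgebra_natural_filtration) auto

lemma measurable_incr_past:
  assumes "0 \<le> u" "u \<le> s" "0 \<le> v" "v \<le> s"
  shows "(\<lambda>\<omega>. B u \<omega> - B v \<omega>) \<in> borel_measurable (past s)"
proof -
  have "(\<lambda>\<omega>. B w \<omega> - B 0 \<omega>) \<in> borel_measurable (past s)" if "0 \<le> w" "w \<le> s" for w
    unfolding past_def using that by (intro measurable_natural_filtration) auto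
  from borel_measurable_diff[OF this[of u] this[of v]] assms show ?thesis by simp
qed

lemma measurable_step_integral_past:
  assumes "0 \<le> u" "is_partition u s n \<tau>"
  shows "step_integral B n \<tau> c \<in> borel_measurable (past s)"
proof -
  have "(\<lambda>\<omega>. c i * (B (\<tau> (Suc i)) \<omega> - B (\<tau> i) \<omega>)) \<in> borel_measurable (past s)" if "i < n" for i
    using that assms(1) partition_bounds[OF assms(2), of i] partition_bounds[OF assms(2), of "Suc i"]
    by (intro borel_measurable_times borel_measurable_const measurable_incr_past) auto
  then show ?thesis unfolding step_integral_def[abs_def] by (intro borel_measurable_sum) auto
qed

text \<open>Joining the sorted observation times up to \<open>s\<close> with the partition after
  \<open>s\<close> gives one grid with independent increments. The cylinder event depends on the
  first block of increments, the step integral on the last one.\<close>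

lemma step_integral_indep_cylinder:
  assumes s0: "0 \<le> s" and part: "is_partition s v n \<tau>"
    and J: "finite J" "J \<subseteq> {0..s}" and C: "\<And>u. C u \<in> sets borel" and D: "D \<in> sets borel"
  defines "A \<equiv> {\<omega>\<in>space M. \<forall>u\<in>J. B u \<omega> - B 0 \<omega> \<in> C u}"
  shows "prob (A \<inter> (step_integral B n \<tau> c -` D \<inter> space M)) = prob A * prob (step_integral B n \<tau> c -` D \<inter> space M)"
proof -
  define xs where "xs = sorted_list_of_set (insert 0 (insert s J))"
  define m where "m = length xs"
  define \<rho> where "\<rho> i = (if i < m then xs ! i else \<tau> (i - m))" for i
  define \<Delta> where "\<Delta> i \<omega> = B (\<rho> (Suc i)) \<omega> - B (\<rho> i) \<omega>" for i \<omega>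
  have xs: "set xs = insert 0 (insert s J)" "sorted xs" using J unfolding xs_def by (intro set_sorted_list_of_set sorted_sorted_list_of_set; simp)+
  have xs_in: "0 \<le> xs ! i" "xs ! i \<le> s" if "i < m" for i
    using that J s0 xs(1) nth_mem[of i xs] unfolding m_def by auto
  have m0: "0 < m" using xs(1) by (auto simp: m_def intro: ccontr)
  have x0: "xs ! 0 = 0"
  proof -
    obtain i where "i < m" "xs ! i = 0" using xs(1) by (metis in_set_conv_nth insertI1 m_def)
    with sorted_nth_mono[OF xs(2), of 0 i] xs_in(1)[OF m0] show ?thesis by (simp add: m_def)
  qed
  have \<tau>: "s \<le> \<tau> 0" "\<And>i. i < n \<Longrightarrow> \<tau> i \<le> \<tau> (Suc i)" using part by (auto simp: is_partition_def)
  have mono: "\<rho> i \<le> \<rho> (Suc i)" if "i < m + n" for i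
  proof -
    consider "Suc i < m" | "Suc i = m" | "m \<le> i" by linarith
    then show ?thesis
    proof cases
      case 1
      then show ?thesis using sorted_nth_mono[OF xs(2), of i "Suc i"] by (simp add: \<rho>_def m_def)
    next
      case 2
      then show ?thesis using xs_in(2)[of i] \<tau>(1) by (auto simp: \<rho>_def)
    next
      case 3
      then show ?thesis using that \<tau>(2)[of "i - m"] by (simp add: \<rho>_def Suc_diff_le)
    qed
  qed
  \<comment> \<open>The increment with index \<open>m - 1\<close> leads from the last observation
    time to \<open>\<tau> 0\<close> and belongs to neither block.\<close>
  have sub: "{..<m - 1} \<inter> {m..<m + n} = {}" "{..<m - 1} \<subseteq> {..<m + n}" "{m..<m + n} \<subseteq> {..<m + n}"
    by auto
  have "indep_vars (\<lambda>_. borel) \<Delta> {..<m + n}"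
    unfolding \<Delta>_def[abs_def] using mono x0 m0 by (intro incr_indep) (auto simp: \<rho>_def)
  from indep_var_restrict[OF this sub] have ind: "indep_var (PiM {..<m - 1} (\<lambda>_. borel)) (\<lambda>\<omega>. restrict (\<lambda>i. \<Delta> i \<omega>) {..<m - 1})
      (PiM {m..<m + n} (\<lambda>_. borel)) (\<lambda>\<omega>. restrict (\<lambda>i. \<Delta> i \<omega>) {m..<m + n})" .
  \<comment> \<open>\<open>P\<close> and \<open>Q\<close> express the two events through the
    coordinates of the blocks; the values of \<open>B\<close> relative to time 0 are recovered as
    partial sums, which telescope because the grid starts at 0.\<close>
  define P where "P = {f \<in> space (PiM {..<m - 1} (\<lambda>_. borel :: real measure)).
      \<forall>j\<in>{j. j < m \<and> xs ! j \<in> J}. (\<Sum>i<j. f i) \<in> C (xs ! j)}"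
  define Q where "Q = {f \<in> space (PiM {m..<m + n} (\<lambda>_. borel :: real measure)). (\<Sum>i<n. c i * f (m + i)) \<in> D}"
  have P: "P \<in> sets (PiM {..<m - 1} (\<lambda>_. borel))"
    unfolding P_def
  proof (intro sets.sets_Collect_finite_All)
    fix j assume "j \<in> {j. j < m \<and> xs ! j \<in> J}"
    then have "(\<lambda>f. \<Sum>i<j. f i) \<in> borel_measurable (PiM {..<m - 1} (\<lambda>_. borel :: real measure))"
      by (intro borel_measurable_sum measurable_component_singleton) auto
    from measurable_sets[OF this C[of "xs ! j"]]
    show "{f \<in> space (PiM {..<m - 1} (\<lambda>_. borel)). (\<Sum>i<j. f i) \<in> C (xs ! j)} \<in> sets (PiM {..<m - 1} (\<lambda>_. borel))"
      by (simp add: vimage_def Int_def conj_commute)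
  qed simp
  have "(\<lambda>f. \<Sum>i<n. c i * f (m + i)) \<in> borel_measurable (PiM {m..<m + n} (\<lambda>_. borel :: real measure))"
    by (intro borel_measurable_sum borel_measurable_times borel_measurable_const measurable_component_singleton) auto
  from measurable_sets[OF this D] have Q: "Q \<in> sets (PiM {m..<m + n} (\<lambda>_. borel))"
    by (simp add: Q_def vimage_def Int_def conj_commute)
  have tele: "(\<Sum>i<j. \<Delta> i \<omega>) = B (xs ! j) \<omega> - B 0 \<omega>" if "j < m" for j \<omega>
    using sum_lessThan_telescope[of "\<lambda>i. B (\<rho> i) \<omega>" j] that x0 m0 by (simp add: \<Delta>_def \<rho>_def)
  have A: "A = (\<lambda>\<omega>. restrict (\<lambda>i. \<Delta> i \<omega>) {..<m - 1}) -` P \<inter> space M"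
  proof -
    have "(\<Sum>i<j. restrict (\<lambda>i. \<Delta> i \<omega>) {..<m - 1} i) = B (xs ! j) \<omega> - B 0 \<omega>" if "j < m" for j \<omega>
      unfolding tele[OF that, symmetric] using that by (intro sum.cong) auto
    moreover have "(\<forall>u\<in>J. B u \<omega> - B 0 \<omega> \<in> C u) \<longleftrightarrow>
      (\<forall>j\<in>{j. j < m \<and> xs ! j \<in> J}. B (xs ! j) \<omega> - B 0 \<omega> \<in> C (xs ! j))" for \<omega>
    proof -
      have "\<exists>j<m. xs ! j = u" if "u \<in> J" for u
        using that xs(1) by (metis in_set_conv_nth insertI2 m_def)
      then show ?thesis by blast
    qed
    ultimately show ?thesis unfolding A_def P_def by (auto simp: space_PiM)
  qed
  have X: "step_integral B n \<tau> c -` D \<inter> space M = (\<lambda>\<omega>. restrict (\<lambda>i. \<Delta> i \<omega>) {m..<m + n}) -` Q \<inter> space M"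
  proof -
    have "(\<Sum>i<n. c i * restrict (\<lambda>i. \<Delta> i \<omega>) {m..<m + n} (m + i)) = step_integral B n \<tau> c \<omega>" for \<omega>
      unfolding step_integral_def by (intro sum.cong) (auto simp: \<Delta>_def \<rho>_def)
    then show ?thesis unfolding Q_def by (auto simp: space_PiM)
  qed
  have "A \<inter> (step_integral B n \<tau> c -` D \<inter> space M) =
    (\<lambda>\<omega>. (restrict (\<lambda>i. \<Delta> i \<omega>) {..<m - 1}, restrict (\<lambda>i. \<Delta> i \<omega>) {m..<m + n})) -` (P \<times> Q) \<inter> space M"
    unfolding A X by auto
  then show ?thesis
    using indep_varD[OF ind P Q] unfolding A[symmetric] X[symmetric] by simp
qed

text \<open>Cylinder events form a generator of \<open>past s\<close> that is stable under
  intersection, so independence extends from them to the whole sigma-algebra.\<close>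

lemma past_indep_step_integral:
  assumes s0: "0 \<le> s" and part: "is_partition s v n \<tau>"
  shows "indep_of M (past s) (step_integral B n \<tau> c)"
proof -
  let ?X = "step_integral B n \<tau> c"
  define E where "E = {{\<omega>\<in>space M. \<forall>u\<in>J. B u \<omega> - B 0 \<omega> \<in> C u} | J C.
    finite J \<and> J \<subseteq> {0..s} \<and> (\<forall>u. C u \<in> sets borel)}"
  have X [measurable]: "?X \<in> borel_measurable M"
    using sq_integrable_step_integral[OF s0 part] by (simp add: sq_integrable_def)
  have cyl: "{\<omega>\<in>space M. B u \<omega> - B 0 \<omega> \<in> C} \<in> events" if "0 \<le> u" "C \<in> sets borel" for u C
    using that by measurable
  have "indep_set E {?X -` D \<inter> space M | D. D \<in> sets borel}"
  proof (rule indep_setI)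
    show "E \<subseteq> events"
      unfolding E_def by (auto intro!: sets.sets_Collect_finite_All cyl)
    show "{?X -` D \<inter> space M | D. D \<in> sets borel} \<subseteq> events" by auto
    show "prob (a \<inter> b) = prob a * prob b" if "a \<in> E" "b \<in> {?X -` D \<inter> space M | D. D \<in> sets borel}" for a b
      using that step_integral_indep_cylinder[OF s0 part] unfolding E_def by blast
  qed
  moreover have "Int_stable E"
    unfolding Int_stable_def
  proof (intro ballI)
    fix a b assume "a \<in> E" "b \<in> E"
    then obtain J C J' C' where JC: "finite J" "J \<subseteq> {0..s}" "\<forall>u. C u \<in> sets borel"
      "finite J'" "J' \<subseteq> {0..s}" "\<forall>u. C' u \<in> sets borel"
      and ab: "a = {\<omega>\<in>space M. \<forall>u\<in>J. B u \<omega> - B 0 \<omega> \<in> C u}" "b = {\<omega>\<in>space M. \<forall>u\<in>J'. B u \<omega> - B 0 \<omega> \<in> C' u}"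
      unfolding E_def by blast
    \<comment> \<open>A time observed by only one of the two cylinders is left unrestricted by the
      other, which makes the intersection a cylinder over the union of the time sets.\<close>
    let ?C = "\<lambda>u. (if u \<in> J then C u else UNIV) \<inter> (if u \<in> J' then C' u else UNIV)"
    have "a \<inter> b = {\<omega>\<in>space M. \<forall>u\<in>J \<union> J'. B u \<omega> - B 0 \<omega> \<in> ?C u}"
      unfolding ab by auto
    moreover have "\<forall>u. ?C u \<in> sets borel" using JC by auto
    ultimately show "a \<inter> b \<in> E"
      unfolding E_def using JC by (intro CollectI exI[of _ "J \<union> J'"] exI[of _ ?C]) auto
  qed
  moreover have "Int_stable {?X -` D \<inter> space M | D. D \<in> sets borel}"
    unfolding Int_stable_def
  proof (intro ballI)
    fix a b assume "a \<in> {?X -` D \<inter> space M | D. D \<in> sets borel}" "b \<in> {?X -` D \<inter> space M | D. D \<in> sets borel}"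
    then obtain D D' where "D \<in> sets borel" "D' \<in> sets borel" "a = ?X -` D \<inter> space M" "b = ?X -` D' \<inter> space M" by auto
    then show "a \<inter> b \<in> {?X -` D \<inter> space M | D. D \<in> sets borel}"
      by (intro CollectI exI[of _ "D \<inter> D'"]) auto
  qed
  ultimately have ind: "indep_set (sigma_sets (space M) E) (sigma_sets (space M) {?X -` D \<inter> space M | D. D \<in> sets borel})"
    by (rule indep_set_sigma_sets)
  have "sets (past s) \<subseteq> sigma_sets (space M) E"
    unfolding past_def
  proof (subst sets_natural_filtration)
    show "sigma_sets (space M) {(\<lambda>\<omega>. B u \<omega> - B 0 \<omega>) -` A \<inter> space M |u A. u \<in> {0..} \<and> u \<le> s \<and> A \<in> sets borel}
      \<subseteq> sigma_sets (space M) E"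
    proof (rule sigma_sets_mono')
      show "{(\<lambda>\<omega>. B u \<omega> - B 0 \<omega>) -` A \<inter> space M |u A. u \<in> {0..} \<and> u \<le> s \<and> A \<in> sets borel} \<subseteq> E"
      proof safe
        fix u and A :: "real set" assume "0 \<le> u" "u \<le> s" "A \<in> sets borel"
        then show "(\<lambda>\<omega>. B u \<omega> - B 0 \<omega>) -` A \<inter> space M \<in> E"
          unfolding E_def by (intro CollectI exI[of _ "{u}"] exI[of _ "\<lambda>_. A"]) auto
      qed
    qed
  qed auto
  then show ?thesis
    unfolding indep_of_def using X indep_setD[OF ind] by (blast intro: sigma_sets.Basic)
qed

end

section \<open>Increments of Wiener integrals\<close>

text \<open>One approximation of the integrand up to the later time thus serves also up to the
  earlier time and on the interval between them.\<close>

lemma tendsto_L2_restrict_mono: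
  assumes lim: "tendsto_L2 (restrict_space N A) f g F" and "A \<in> sets N" "A' \<in> sets N" "A' \<subseteq> A"
  shows "tendsto_L2 (restrict_space N A') f g F"
proof -
  have sub: "restrict_space N A' = restrict_space (restrict_space N A) A'"
    using assms by (subst restrict_restrict_space) (auto simp: Int_absorb1)
  have A': "A' \<inter> space (restrict_space N A) \<in> sets (restrict_space N A)"
    using assms sets.sets_into_space by (auto simp: space_restrict_space sets_restrict_space_iff)
  have sq: "sq_integrable (restrict_space N A') \<phi>" if "sq_integrable (restrict_space N A) \<phi>" for \<phi>
  proof -
    have "\<phi> \<in> borel_measurable (restrict_space N A')"
      unfolding sub by (rule measurable_restrict_space1) (use that in \<open>simp add: sq_integrable_def\<close>)
    moreover have "integrable (restrict_space N A) (\<lambda>x. indicator A' x *\<^sub>R (\<phi> x)\<^sup>2)"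
      by (rule integrable_mult_indicator)
        (use that assms in \<open>auto simp: sq_integrable_def sets_restrict_space_iff\<close>)
    then have "integrable (restrict_space N A') (\<lambda>x. (\<phi> x)\<^sup>2)"
      unfolding sub by (rule integrable_restrict_space[OF A', THEN iffD2])
    ultimately show ?thesis by (simp add: sq_integrable_def)
  qed
  have g: "sq_integrable (restrict_space N A) g" and f: "\<forall>\<^sub>F i in F. sq_integrable (restrict_space N A) (f i)"
    and l: "((\<lambda>i. \<integral>\<^sup>+x. ennreal ((f i x - g x)\<^sup>2) \<partial>restrict_space N A) \<longlongrightarrow> 0) F"
    using lim by (auto simp: tendsto_L2_def)
  have "((\<lambda>i. \<integral>\<^sup>+x. ennreal ((f i x - g x)\<^sup>2) \<partial>restrict_space N A') \<longlongrightarrow> 0) F"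
  proof (rule tendsto_sandwich[OF _ _ tendsto_const l])
    show "\<forall>\<^sub>F i in F. (\<integral>\<^sup>+x. ennreal ((f i x - g x)\<^sup>2) \<partial>restrict_space N A') \<le>
        (\<integral>\<^sup>+x. ennreal ((f i x - g x)\<^sup>2) \<partial>restrict_space N A)"
    proof (intro always_eventually allI)
      fix i
      have "A \<inter> space N \<in> sets N" "A' \<inter> space N \<in> sets N" using assms by auto
      then show "(\<integral>\<^sup>+x. ennreal ((f i x - g x)\<^sup>2) \<partial>restrict_space N A') \<le>
        (\<integral>\<^sup>+x. ennreal ((f i x - g x)\<^sup>2) \<partial>restrict_space N A)"
        using assms(4) by (auto simp: nn_integral_restrict_space intro!: nn_integral_mono split: split_indicator)
    qed
  qed simp
  then show ?thesis using g f by (auto simp: tendsto_L2_def sq elim: eventually_mono)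
qed

lemma sq_integrable_step_fun: "sq_integrable lborel (step_fun n \<tau> c)"
proof -
  have "sq_integrable lborel (indicator {a<..b} :: real \<Rightarrow> real)" for a b :: real
  proof -
    have eq: "(\<lambda>x. (indicator {a<..b} x :: real)\<^sup>2) = indicator {a<..b}"
      by (auto simp: fun_eq_iff indicator_def)
    have "emeasure lborel {a<..b} \<le> emeasure lborel {a..b}"
      by (intro emeasure_mono) auto
    also have "\<dots> < \<infinity>" by (simp add: emeasure_lborel_Icc_eq)
    finally show ?thesis unfolding sq_integrable_def eq by (intro conjI integrable_real_indicator) auto
  qed
  then show ?thesis unfolding step_fun_def[abs_def] by (intro sq_integrable_sum sq_integrable_cmult)
qed

lemma sq_integrable_step_fun_restrict:
  assumes "A \<in> sets lborel"
  shows "sq_integrable (restrict_space lborel A) (step_fun n \<tau> c)"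
proof -
  have "step_fun n \<tau> c \<in> borel_measurable (restrict_space lborel A)"
    using sq_integrable_step_fun[of n \<tau> c] by (intro measurable_restrict_space1) (simp add: sq_integrable_def)
  moreover have "integrable lborel (\<lambda>x. indicator A x *\<^sub>R (step_fun n \<tau> c x)\<^sup>2)"
    using sq_integrable_step_fun[of n \<tau> c] assms by (intro integrable_mult_indicator) (auto simp: sq_integrable_def)
  then have "integrable (restrict_space lborel A) (\<lambda>x. (step_fun n \<tau> c x)\<^sup>2)"
    using assms by (intro integrable_restrict_space[THEN iffD2]) auto
  ultimately show ?thesis by (simp add: sq_integrable_def)
qed

lemma has_wiener_integral_cong:
  assumes "has_wiener_integral M B u v f X" and eq: "\<And>x. x \<in> {u..v} \<Longrightarrow> f x = f' x"
  shows "has_wiener_integral M B u v f' X"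
proof -
  let ?N = "restrict_space lborel {u..v}"
  have sp: "space ?N = {u..v}" by (simp add: space_restrict_space)
  have "tendsto_L2 ?N \<phi> f' sequentially" if "tendsto_L2 ?N \<phi> f sequentially" for \<phi>
  proof -
    have "f \<in> borel_measurable ?N \<longleftrightarrow> f' \<in> borel_measurable ?N"
      using eq sp by (intro measurable_cong) auto
    moreover have "integrable ?N (\<lambda>x. (f x)\<^sup>2) \<longleftrightarrow> integrable ?N (\<lambda>x. (f' x)\<^sup>2)"
      using eq sp by (intro Bochner_Integration.integrable_cong) auto
    moreover have "(\<integral>\<^sup>+x. ennreal ((\<phi> i x - f x)\<^sup>2) \<partial>?N) = (\<integral>\<^sup>+x. ennreal ((\<phi> i x - f' x)\<^sup>2) \<partial>?N)" for i
      using eq sp by (intro nn_integral_cong) auto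
    ultimately show ?thesis using that unfolding tendsto_L2_def sq_integrable_def by simp
  qed
  then show ?thesis using assms(1) unfolding has_wiener_integral_def by blast
qed

text \<open>Removes from the integrand a factor that depends only on the upper limit of
  integration.\<close>

lemma has_wiener_integral_cmult:
  assumes "has_wiener_integral M B u v f X"
  shows "has_wiener_integral M B u v (\<lambda>x. k * f x) (\<lambda>\<omega>. k * X \<omega>)"
proof -
  obtain n :: "nat \<Rightarrow> nat" and \<tau> c where
    p: "\<forall>i. is_partition u v (n i) (\<tau> i)"
    and l: "tendsto_L2 (restrict_space lborel {u..v}) (\<lambda>i. step_fun (n i) (\<tau> i) (c i)) f sequentially"
      "tendsto_L2 M (\<lambda>i. step_integral B (n i) (\<tau> i) (c i)) X sequentially"
    using assms unfolding has_wiener_integral_def by blast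
  have e1: "(\<lambda>i x. k * step_fun (n i) (\<tau> i) (c i) x) = (\<lambda>i. step_fun (n i) (\<tau> i) (\<lambda>j. k * c i j))"
    by (intro ext) (simp only: step_fun_def sum_distrib_left mult.assoc)
  have e2: "(\<lambda>i x. k * step_integral B (n i) (\<tau> i) (c i) x) = (\<lambda>i. step_integral B (n i) (\<tau> i) (\<lambda>j. k * c i j))"
    by (intro ext) (simp only: step_integral_def sum_distrib_left mult.assoc)
  show ?thesis
    unfolding has_wiener_integral_def
    by (rule exI[of _ n], rule exI[of _ \<tau>], rule exI[of _ "\<lambda>i j. k * c i j"], intro conjI)
      (rule p, rule tendsto_L2_cmult[OF l(1), of k, unfolded e1], rule tendsto_L2_cmult[OF l(2), of k, unfolded e2])
qed

text \<open>Clamping the partition points cuts a step function at \<open>s\<close> while keeping the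
  number of steps and the coefficients: steps beyond \<open>s\<close> collapse to empty intervals
  and the step across \<open>s\<close> is shortened.\<close>

lemma step_fun_min: "step_fun n (\<lambda>i. min s (\<tau> i)) c x = indicator {..s} x * step_fun n \<tau> c x"
  unfolding step_fun_def sum_distrib_left by (intro sum.cong) (auto simp: indicator_def)

lemma step_fun_max: "step_fun n (\<lambda>i. max s (\<tau> i)) c x = indicator {s<..} x * step_fun n \<tau> c x"
  unfolding step_fun_def sum_distrib_left by (intro sum.cong) (auto simp: indicator_def)

text \<open>Termwise from \<open>B x + B s = B (min s x) + B (max s x)\<close>, in which the
  contribution of \<open>s\<close> cancels on taking increments.\<close>

lemma step_integral_split:
  "step_integral B n \<tau> c \<omega> = step_integral B n (\<lambda>i. min s (\<tau> i)) c \<omega> + step_integral B n (\<lambda>i. max s (\<tau> i)) c \<omega>"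
proof -
  have "B x \<omega> + B s \<omega> = B (min s x) \<omega> + B (max s x) \<omega>" for x
    by (cases "s \<le> x") (auto simp: min_def max_def)
  from this[of "\<tau> (Suc i)" for i] this[of "\<tau> i" for i]
  have "B (\<tau> (Suc i)) \<omega> - B (\<tau> i) \<omega> =
     (B (min s (\<tau> (Suc i))) \<omega> - B (min s (\<tau> i)) \<omega>) + (B (max s (\<tau> (Suc i))) \<omega> - B (max s (\<tau> i)) \<omega>)" for i
    by (smt (verit))
  then show ?thesis unfolding step_integral_def by (simp add: sum.distrib[symmetric] distrib_left[symmetric])
qed

lemma step_fun_eq_0:
  assumes "is_partition u v n \<tau>" "x \<notin> {u<..v}"
  shows "step_fun n \<tau> c x = 0"
proof -
  have "x \<notin> {\<tau> i<..\<tau> (Suc i)}" if "i < n" for i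
    using that assms(2) partition_bounds[OF assms(1), of i] partition_bounds[OF assms(1), of "Suc i"] by auto
  then show ?thesis unfolding step_fun_def by (intro sum.neutral) auto
qed

section \<open>Wiener integrals with a common integrand and varying upper limit\<close>

context wiener
begin

text \<open>The approximations behind \<open>X\<close> and \<open>Y\<close> are unrelated. By the
  isometry, the part up to \<open>s\<close> of those for \<open>Y\<close> has the same limit as
  those for \<open>X\<close>, so \<open>Y - X\<close> is a limit of step integrals living on
  \<open>{s..t}\<close>. These are normal and independent of the past, and both properties pass to
  the limit.\<close>

lemma wiener_integral_increment:
  assumes st: "0 \<le> s" "s \<le> t"
    and X: "has_wiener_integral M B 0 s h X" and Y: "has_wiener_integral M B 0 t h Y"
  shows "indep_of M (past s) (\<lambda>\<omega>. Y \<omega> - X \<omega>)"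
    and "has_normal_law M (\<lambda>\<omega>. Y \<omega> - X \<omega>) 0 (\<integral>x. (h x)\<^sup>2 \<partial>restrict_space lborel {s<..t})"
proof -
  obtain n :: "nat \<Rightarrow> nat" and \<tau> c where p: "\<And>k. is_partition 0 t (n k) (\<tau> k)"
    and f: "tendsto_L2 (restrict_space lborel {0..t}) (\<lambda>k. step_fun (n k) (\<tau> k) (c k)) h sequentially"
    and i: "tendsto_L2 M (\<lambda>k. step_integral B (n k) (\<tau> k) (c k)) Y sequentially"
    using Y unfolding has_wiener_integral_def by blast
  obtain n' :: "nat \<Rightarrow> nat" and \<tau>' c' where p': "\<And>k. is_partition 0 s (n' k) (\<tau>' k)"
    and f': "tendsto_L2 (restrict_space lborel {0..s}) (\<lambda>k. step_fun (n' k) (\<tau>' k) (c' k)) h sequentially"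
    and i': "tendsto_L2 M (\<lambda>k. step_integral B (n' k) (\<tau>' k) (c' k)) X sequentially"
    using X unfolding has_wiener_integral_def by blast
  define lo where "lo k i = min s (\<tau> k i)" for k i
  define hi where "hi k i = max s (\<tau> k i)" for k i
  have plo: "is_partition 0 s (n k) (lo k)" and phi: "is_partition s t (n k) (hi k)" for k
    using p[of k] st by (auto simp: is_partition_def lo_def hi_def intro: min.mono max.mono)
  have sqX: "sq_integrable M (step_integral B (n' k) (\<tau>' k) (c' k))" for k
    using p' by (rule sq_integrable_step_integral[OF order_refl])
  have sqlo: "sq_integrable M (step_integral B (n k) (lo k) (c k))" for k
    using plo by (rule sq_integrable_step_integral[OF order_refl])
  have sqhi: "sq_integrable M (step_integral B (n k) (hi k) (c k))" for k
    using phi by (rule sq_integrable_step_integral[OF st(1)])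
  \<comment> \<open>On \<open>{0..s}\<close> both sequences of step functions approximate
    \<open>h\<close>, so their difference tends to zero; the isometry then transfers this to the
    step integrals.\<close>
  have "(\<lambda>k. \<integral>x. (step_fun (n k) (\<tau> k) (c k) x - step_fun (n' k) (\<tau>' k) (c' k) x)\<^sup>2 \<partial>restrict_space lborel {0..s}) \<longlonglongrightarrow> 0"
  proof -
    have "tendsto_L2 (restrict_space lborel {0..s}) (\<lambda>k. step_fun (n k) (\<tau> k) (c k)) h sequentially"
      using st by (intro tendsto_L2_restrict_mono[OF f]) auto
    from tendsto_L2_diff[OF this f']
    have "tendsto_L2 (restrict_space lborel {0..s})
        (\<lambda>k x. step_fun (n k) (\<tau> k) (c k) x - step_fun (n' k) (\<tau>' k) (c' k) x) (\<lambda>x. h x - h x) sequentially" .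
    from tendsto_L2_norm[OF _ this] show ?thesis
      by (simp add: sq_integrable_diff sq_integrable_step_fun_restrict)
  qed
  also have "(\<lambda>k. \<integral>x. (step_fun (n k) (\<tau> k) (c k) x - step_fun (n' k) (\<tau>' k) (c' k) x)\<^sup>2 \<partial>restrict_space lborel {0..s}) =
    (\<lambda>k. expectation (\<lambda>\<omega>. (step_integral B (n k) (lo k) (c k) \<omega> - step_integral B (n' k) (\<tau>' k) (c' k) \<omega>)\<^sup>2))"
  proof
    fix k
    have "(\<integral>x. (step_fun (n k) (\<tau> k) (c k) x - step_fun (n' k) (\<tau>' k) (c' k) x)\<^sup>2 \<partial>restrict_space lborel {0..s}) =
      (\<integral>x. indicator {0..s} x *\<^sub>R (step_fun (n k) (\<tau> k) (c k) x - step_fun (n' k) (\<tau>' k) (c' k) x)\<^sup>2 \<partial>lborel)"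
      by (rule integral_restrict_space) simp
    also have "\<dots> = (\<integral>x. (step_fun (n k) (lo k) (c k) x - step_fun (n' k) (\<tau>' k) (c' k) x)\<^sup>2 \<partial>lborel)"
    proof (intro Bochner_Integration.integral_cong refl)
      fix x
      show "indicator {0..s} x *\<^sub>R (step_fun (n k) (\<tau> k) (c k) x - step_fun (n' k) (\<tau>' k) (c' k) x)\<^sup>2 =
        (step_fun (n k) (lo k) (c k) x - step_fun (n' k) (\<tau>' k) (c' k) x)\<^sup>2"
      proof (cases "x \<in> {0..s}")
        case True
        then have "step_fun (n k) (lo k) (c k) x = step_fun (n k) (\<tau> k) (c k) x"
          unfolding lo_def[abs_def] step_fun_min by simp
        then show ?thesis using True by simp
      next
        case False
        then have "x \<notin> {0<..s}" by auto
        then show ?thesis using False by (simp add: step_fun_eq_0[OF plo] step_fun_eq_0[OF p'])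
      qed
    qed
    also have "\<dots> = expectation (\<lambda>\<omega>. (step_integral B (n k) (lo k) (c k) \<omega> - step_integral B (n' k) (\<tau>' k) (c' k) \<omega>)\<^sup>2)"
      by (rule step_integral_diff_isometry[OF order_refl order_refl plo p', symmetric])
    finally show "(\<integral>x. (step_fun (n k) (\<tau> k) (c k) x - step_fun (n' k) (\<tau>' k) (c' k) x)\<^sup>2 \<partial>restrict_space lborel {0..s}) =
      expectation (\<lambda>\<omega>. (step_integral B (n k) (lo k) (c k) \<omega> - step_integral B (n' k) (\<tau>' k) (c' k) \<omega>)\<^sup>2)" .
  qed
  finally have "tendsto_L2 M (\<lambda>k \<omega>. step_integral B (n k) (lo k) (c k) \<omega> - step_integral B (n' k) (\<tau>' k) (c' k) \<omega>) (\<lambda>\<omega>. 0) sequentially"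
    by (subst tendsto_L2_iff) (auto intro!: sq_integrable_diff sqlo sqX simp: sq_integrable_def[of _ "\<lambda>_. 0"])
  from tendsto_L2_diff[OF i tendsto_L2_add[OF this i']]
  have "tendsto_L2 M (\<lambda>k \<omega>. step_integral B (n k) (\<tau> k) (c k) \<omega> - step_integral B (n k) (lo k) (c k) \<omega>) (\<lambda>\<omega>. Y \<omega> - X \<omega>) sequentially"
    by simp
  also have "(\<lambda>k \<omega>. step_integral B (n k) (\<tau> k) (c k) \<omega> - step_integral B (n k) (lo k) (c k) \<omega>) =
      (\<lambda>k. step_integral B (n k) (hi k) (c k))"
    unfolding lo_def[abs_def] hi_def[abs_def] by (subst step_integral_split[where s = s]) simp
  finally have lim: "tendsto_L2 M (\<lambda>k. step_integral B (n k) (hi k) (c k)) (\<lambda>\<omega>. Y \<omega> - X \<omega>) sequentially" .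
  note L = indep_normal_L2_limit[OF subalgebra_past past_indep_step_integral[OF st(1) phi]
      step_integral_normal[OF st(1) phi] lim]
  show "indep_of M (past s) (\<lambda>\<omega>. Y \<omega> - X \<omega>)" by (rule L(1))
  have l1: "(\<lambda>k. expectation (\<lambda>\<omega>. (step_integral B (n k) (hi k) (c k) \<omega>)\<^sup>2)) \<longlonglongrightarrow> expectation (\<lambda>\<omega>. (Y \<omega> - X \<omega>)\<^sup>2)"
    by (rule tendsto_L2_norm[OF sqhi lim])
  have e1: "(\<lambda>k. expectation (\<lambda>\<omega>. (step_integral B (n k) (hi k) (c k) \<omega>)\<^sup>2)) =
    (\<lambda>k. \<integral>x. (step_fun (n k) (\<tau> k) (c k) x)\<^sup>2 \<partial>restrict_space lborel {s<..t})"
  proof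
    fix k
    have "(\<integral>x. (step_fun (n k) (\<tau> k) (c k) x)\<^sup>2 \<partial>restrict_space lborel {s<..t}) =
      (\<integral>x. indicator {s<..t} x *\<^sub>R (step_fun (n k) (\<tau> k) (c k) x)\<^sup>2 \<partial>lborel)"
      by (rule integral_restrict_space) simp
    \<comment> \<open>Subtracting the step function with no steps allows the isometry for
      differences to be applied to a single step integral.\<close>
    also have "\<dots> = (\<integral>x. (step_fun (n k) (hi k) (c k) x - step_fun 0 (\<lambda>_. 0) (c k) x)\<^sup>2 \<partial>lborel)"
    proof (intro Bochner_Integration.integral_cong refl)
      fix x
      show "indicator {s<..t} x *\<^sub>R (step_fun (n k) (\<tau> k) (c k) x)\<^sup>2 =
        (step_fun (n k) (hi k) (c k) x - step_fun 0 (\<lambda>_. 0) (c k) x)\<^sup>2"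
      proof (cases "x \<in> {s<..t}")
        case True
        then have "step_fun (n k) (hi k) (c k) x = step_fun (n k) (\<tau> k) (c k) x"
          unfolding hi_def[abs_def] step_fun_max by simp
        then show ?thesis using True by (simp add: step_fun_def[of 0])
      next
        case False
        then show ?thesis by (simp add: step_fun_eq_0[OF phi] step_fun_def[of 0])
      qed
    qed
    also have "\<dots> = expectation (\<lambda>\<omega>. (step_integral B (n k) (hi k) (c k) \<omega> - step_integral B 0 (\<lambda>_. 0) (c k) \<omega>)\<^sup>2)"
      by (rule step_integral_diff_isometry[OF st(1) order_refl phi, of 0 0, symmetric]) (simp add: is_partition_def)
    finally show "expectation (\<lambda>\<omega>. (step_integral B (n k) (hi k) (c k) \<omega>)\<^sup>2) =
      (\<integral>x. (step_fun (n k) (\<tau> k) (c k) x)\<^sup>2 \<partial>restrict_space lborel {s<..t})"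
      by (simp add: step_integral_def[of B 0])
  qed
  \<comment> \<open>The same sequence as in \<open>l1\<close> after the isometry; uniqueness of
    limits identifies the variance.\<close>
  have l2: "(\<lambda>k. \<integral>x. (step_fun (n k) (\<tau> k) (c k) x)\<^sup>2 \<partial>restrict_space lborel {s<..t}) \<longlonglongrightarrow>
      (\<integral>x. (h x)\<^sup>2 \<partial>restrict_space lborel {s<..t})"
    using st by (intro tendsto_L2_norm sq_integrable_step_fun_restrict tendsto_L2_restrict_mono[OF f]) auto
  show "has_normal_law M (\<lambda>\<omega>. Y \<omega> - X \<omega>) 0 (\<integral>x. (h x)\<^sup>2 \<partial>restrict_space lborel {s<..t})"
    using L(2) unfolding LIMSEQ_unique[OF l1[unfolded e1] l2] .
qed

text \<open>Step integrals over \<open>{0..s}\<close> are measurable for the past, and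
  \<open>lim\<close> of an almost surely convergent subsequence is a version of \<open>X\<close>
  that is measurable for it without exception.\<close>

lemma wiener_integral_AE_past:
  assumes s: "0 \<le> s" and X: "has_wiener_integral M B 0 s h X"
  obtains X' where "X' \<in> borel_measurable (past s)" "AE \<omega> in M. X \<omega> = X' \<omega>"
proof -
  obtain n :: "nat \<Rightarrow> nat" and \<tau> c where p: "\<And>k. is_partition 0 s (n k) (\<tau> k)"
    and i: "tendsto_L2 M (\<lambda>k. step_integral B (n k) (\<tau> k) (c k)) X sequentially"
    using X unfolding has_wiener_integral_def by blast
  have sq: "sq_integrable M (step_integral B (n k) (\<tau> k) (c k))" for k
    using p by (rule sq_integrable_step_integral[OF order_refl])
  obtain r where r: "AE \<omega> in M. (\<lambda>k. step_integral B (n (r k)) (\<tau> (r k)) (c (r k)) \<omega>) \<longlonglongrightarrow> X \<omega>"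
    using tendsto_L2_AE_subseq[OF sq i] by blast
  show thesis
  proof
    show "(\<lambda>\<omega>. lim (\<lambda>k. step_integral B (n (r k)) (\<tau> (r k)) (c (r k)) \<omega>)) \<in> borel_measurable (past s)"
      using measurable_step_integral_past[OF order_refl p] by (intro borel_measurable_lim_metric)
    show "AE \<omega> in M. X \<omega> = lim (\<lambda>k. step_integral B (n (r k)) (\<tau> (r k)) (c (r k)) \<omega>)"
      using r by eventually_elim (simp add: limI)
  qed
qed

text \<open>All partition points of the one-point interval are 0, so every approximating step
  integral vanishes.\<close>

lemma wiener_integral_trivial:
  assumes X: "has_wiener_integral M B 0 0 h X"
  shows "AE \<omega> in M. X \<omega> = 0"
proof -
  obtain n :: "nat \<Rightarrow> nat" and \<tau> c where p: "\<And>k. is_partition 0 0 (n k) (\<tau> k)"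
    and i: "tendsto_L2 M (\<lambda>k. step_integral B (n k) (\<tau> k) (c k)) X sequentially"
    using X unfolding has_wiener_integral_def by blast
  have sq: "sq_integrable M (step_integral B (n k) (\<tau> k) (c k))" for k
    using p by (rule sq_integrable_step_integral[OF order_refl])
  have "\<tau> k i = 0" if "i \<le> n k" for k i
    using partition_bounds[OF p that] by simp
  then have "step_integral B (n k) (\<tau> k) (c k) \<omega> = 0" for k \<omega>
    unfolding step_integral_def by (intro sum.neutral) auto
  then have "(\<lambda>k. 0) \<longlonglongrightarrow> expectation (\<lambda>\<omega>. (X \<omega>)\<^sup>2)"
    using tendsto_L2_norm[OF sq i] by simp
  then have "expectation (\<lambda>\<omega>. (X \<omega>)\<^sup>2) = 0" by (simp add: LIMSEQ_const_iff)
  moreover have "integrable M (\<lambda>\<omega>. (X \<omega>)\<^sup>2)" using i by (auto simp: tendsto_L2_def sq_integrable_def)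
  ultimately show ?thesis by (simp add: integral_nonneg_eq_0_iff_AE)
qed

text \<open>The events that agree almost surely with an event of \<open>past s\<close> form a
  sigma-algebra containing the events generated by \<open>Z u\<close> for \<open>u \<le> s\<close>.
  Replacing an event by such a partner changes none of the probabilities in the product
  formula.\<close>

lemma wiener_integral_process_indep:
  assumes Z: "\<And>t. t \<in> I \<Longrightarrow> has_wiener_integral M B 0 t h (Z t)" and I: "I \<subseteq> {0..}"
    and st: "s \<in> I" "t \<in> I" "s \<le> t"
  shows "indep_of M (natural_filtration M I Z s) (\<lambda>\<omega>. Z t \<omega> - Z s \<omega>)"
proof -
  have Zm [measurable]: "Z u \<in> borel_measurable M" if "u \<in> I" for u
    using Z[OF that] unfolding has_wiener_integral_def by (auto simp: tendsto_L2_def sq_integrable_def)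
  have past_mono: "X \<in> borel_measurable (past s)" if "X \<in> borel_measurable (past u)" "u \<le> s" for X :: "'w \<Rightarrow> real" and u
  proof -
    have "sets (past u) \<subseteq> sets (past s)"
    proof -
      have m: "(\<lambda>\<omega>. B w \<omega> - B 0 \<omega>) \<in> borel_measurable M" if "w \<in> {0..}" for w
        using that by auto
      have "{(\<lambda>\<omega>. B w \<omega> - B 0 \<omega>) -` A \<inter> space M |w A. w \<in> {0..} \<and> w \<le> u \<and> A \<in> sets borel} \<subseteq>
        {(\<lambda>\<omega>. B w \<omega> - B 0 \<omega>) -` A \<inter> space M |w A. w \<in> {0..} \<and> w \<le> s \<and> A \<in> sets borel}"
        using that(2) by (blast intro: order_trans)
      moreover have "sets (past v) = sigma_sets (space M)
          {(\<lambda>\<omega>. B w \<omega> - B 0 \<omega>) -` A \<inter> space M |w A. w \<in> {0..} \<and> w \<le> v \<and> A \<in> sets borel}" for v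
        unfolding past_def by (rule sets_natural_filtration) (rule m)
      ultimately show ?thesis by (simp only: sigma_sets_mono')
    qed
    moreover have "space (past u) = space (past s)" by (simp add: past_def)
    ultimately show ?thesis using that(1) by (auto simp: measurable_def)
  qed
  define \<A> where "\<A> = {A. A \<in> events \<and> (\<exists>A'\<in>sets (past s). AE \<omega> in M. \<omega> \<in> A \<longleftrightarrow> \<omega> \<in> A')}"
  have \<A>I: "A \<in> \<A>" if "A \<in> events" "A' \<in> sets (past s)" "AE \<omega> in M. \<omega> \<in> A \<longleftrightarrow> \<omega> \<in> A'" for A A'
    using that by (auto simp: \<A>_def)
  have past_sp: "space (past s) = space M" by (simp add: past_def)
  have sub: "A \<in> \<A>" if "A \<in> sigma_sets (space M) {Z u -` A \<inter> space M | u A. u \<in> I \<and> u \<le> s \<and> A \<in> sets borel}" for A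
    using that
  proof induction
    case (Basic a)
    then obtain u C where u: "u \<in> I" "u \<le> s" "C \<in> sets borel" "a = Z u -` C \<inter> space M" by blast
    obtain Z' where Z': "Z' \<in> borel_measurable (past u)" "AE \<omega> in M. Z u \<omega> = Z' \<omega>"
      using wiener_integral_AE_past[OF _ Z[OF u(1)]] u(1) I by auto
    have "Z' -` C \<inter> space M \<in> sets (past s)"
      using measurable_sets[OF past_mono[OF Z'(1) u(2)] u(3)] past_sp by simp
    moreover have "AE \<omega> in M. \<omega> \<in> a \<longleftrightarrow> \<omega> \<in> Z' -` C \<inter> space M"
      using Z'(2) by eventually_elim (simp add: u(4))
    moreover have "a \<in> events" using measurable_sets[OF Zm[OF u(1)] u(3)] u(4) by simp
    ultimately show ?case by (intro \<A>I)
  next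
    case Empty
    show ?case by (intro \<A>I[of _ "{}"]) auto
  next
    case (Compl a)
    then obtain A' where A': "a \<in> events" "A' \<in> sets (past s)" "AE \<omega> in M. \<omega> \<in> a \<longleftrightarrow> \<omega> \<in> A'"
      by (auto simp: \<A>_def)
    have "space M - A' \<in> sets (past s)" using sets.compl_sets[OF A'(2)] past_sp by simp
    moreover have "AE \<omega> in M. \<omega> \<in> space M - a \<longleftrightarrow> \<omega> \<in> space M - A'"
      using A'(3) by eventually_elim auto
    moreover have "space M - a \<in> events" using A'(1) by auto
    ultimately show ?case by (intro \<A>I)
  next
    case (Union a)
    then have "\<forall>i. \<exists>A'. A' \<in> sets (past s) \<and> (AE \<omega> in M. \<omega> \<in> a i \<longleftrightarrow> \<omega> \<in> A')" by (auto simp: \<A>_def)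
    then obtain A' where A': "\<And>i. A' i \<in> sets (past s)" "\<And>i. AE \<omega> in M. \<omega> \<in> a i \<longleftrightarrow> \<omega> \<in> A' i"
      by metis
    have "AE \<omega> in M. \<forall>i. \<omega> \<in> a i \<longleftrightarrow> \<omega> \<in> A' i" using A'(2) by (simp add: AE_all_countable)
    then have "AE \<omega> in M. \<omega> \<in> (\<Union>i. a i) \<longleftrightarrow> \<omega> \<in> (\<Union>i. A' i)" by eventually_elim auto
    moreover have "(\<Union>i. A' i) \<in> sets (past s)" using A'(1) by auto
    moreover have "(\<Union>i. a i) \<in> events" using Union by (auto simp: \<A>_def)
    ultimately show ?case by (intro \<A>I)
  qed
  have s0: "0 \<le> s" using st I by auto
  have past: "indep_of M (past s) (\<lambda>\<omega>. Z t \<omega> - Z s \<omega>)"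
    by (rule wiener_integral_increment(1)[OF s0 st(3) Z[OF st(1)] Z[OF st(2)]])
  show ?thesis
    unfolding indep_of_def
  proof (intro conjI ballI)
    show "(\<lambda>\<omega>. Z t \<omega> - Z s \<omega>) \<in> borel_measurable M" using st by measurable
    fix A and C :: "real set" assume "A \<in> sets (natural_filtration M I Z s)" and C: "C \<in> sets borel"
    then have "A \<in> \<A>" using sub by (simp add: sets_natural_filtration)
    then obtain A' where A': "A \<in> events" "A' \<in> sets (past s)" "AE \<omega> in M. \<omega> \<in> A \<longleftrightarrow> \<omega> \<in> A'"
      by (auto simp: \<A>_def)
    let ?D = "(\<lambda>\<omega>. Z t \<omega> - Z s \<omega>) -` C \<inter> space M"
    have A'M: "A' \<in> events" using A'(2) subalgebra_past by (auto simp: subalgebra_def)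
    have D: "?D \<in> events" using past C by (auto simp: indep_of_def)
    have "prob (A \<inter> ?D) = prob (A' \<inter> ?D)"
      using A'(1,3) A'M D by (intro finite_measure_eq_AE) auto
    moreover have "prob A = prob A'"
      using A'(1,3) A'M by (intro finite_measure_eq_AE) auto
    ultimately show "prob (A \<inter> ?D) = prob A * prob ?D"
      using past A'(2) C by (auto simp: indep_of_def)
  qed
qed

end

section \<open>Gaussian conditional laws\<close>

text \<open>Links the two forms of the kernel: integrating out centred noise produces the left side,
  while a transition density calls for the right side.\<close>

lemma normal_kernel_eq:
  assumes v: "0 < v" and A: "A \<in> sets borel"
  shows "(\<integral>\<^sup>+y. indicator A (x + y) \<partial>normal_law 0 v) = ennreal (LINT y:A|lborel. normal_density x (sqrt v) y)"
proof -
  have nd: "normal_density x (sqrt v) (x + y) = normal_density 0 (sqrt v) y" for y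
    by (simp add: normal_density_def)
  have int: "integrable lborel (\<lambda>y. indicator A y *\<^sub>R normal_density x (sqrt v) y)"
    using A v by (intro integrable_mult_indicator) auto
  have "(\<integral>\<^sup>+y. indicator A (x + y) \<partial>normal_law 0 v) =
      (\<integral>\<^sup>+y. ennreal (normal_density 0 (sqrt v) y) * indicator A (x + y) \<partial>lborel)"
    using v A by (simp add: normal_law_def nn_integral_density)
  also have "\<dots> = (\<integral>\<^sup>+y. ennreal (normal_density x (sqrt v) y) * indicator A y \<partial>lborel)"
    using A by (subst (2) nn_integral_real_affine[where c = 1 and t = x]) (auto simp: nd)
  also have "\<dots> = (\<integral>\<^sup>+y. ennreal (indicator A y *\<^sub>R normal_density x (sqrt v) y) \<partial>lborel)"
    by (intro nn_integral_cong) (auto simp: indicator_def)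
  also have "\<dots> = ennreal (\<integral>y. indicator A y *\<^sub>R normal_density x (sqrt v) y \<partial>lborel)"
    using int by (intro nn_integral_eq_integral) auto
  finally show ?thesis by (simp add: set_lebesgue_integral_def)
qed

text \<open>The computation behind Chapman-Kolmogorov for kernels with affine mean. The substitution
  \<open>x = \<beta> * (z - m)\<close> reduces it to the convolution of two centred normal
  densities.\<close>

lemma normal_kernel_convolution:
  assumes "0 < \<beta>" "0 < v" "0 < w"
  shows "(\<integral>\<^sup>+z. ennreal (normal_density m (sqrt v) z * normal_density (\<alpha> + \<beta> * z) (sqrt w) y) \<partial>lborel) =
    ennreal (normal_density (\<alpha> + \<beta> * m) (sqrt (\<beta>\<^sup>2 * v + w)) y)"
proof -
  have scale: "\<beta> * normal_density 0 (\<beta> * sqrt v) (- (\<beta> * m) + \<beta> * z) = normal_density m (sqrt v) z" for z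
  proof -
    have "(- (\<beta> * m) + \<beta> * z)\<^sup>2 = \<beta>\<^sup>2 * (z - m)\<^sup>2" by (simp add: power2_eq_square algebra_simps)
    then show ?thesis using assms
      by (simp add: normal_density_def power_mult_distrib real_sqrt_mult field_simps)
  qed
  have shift: "normal_density 0 (sqrt w) (y - (\<alpha> + \<beta> * m) - (- (\<beta> * m) + \<beta> * z)) = normal_density (\<alpha> + \<beta> * z) (sqrt w) y" for z
    by (simp add: normal_density_def algebra_simps)
  have "ennreal (normal_density (\<alpha> + \<beta> * m) (sqrt (\<beta>\<^sup>2 * v + w)) y) =
      ennreal (normal_density 0 (sqrt ((sqrt w)\<^sup>2 + (\<beta> * sqrt v)\<^sup>2)) (y - (\<alpha> + \<beta> * m)))"
    using assms by (simp add: normal_density_def power_mult_distrib add.commute)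
  also have "\<dots> = (\<integral>\<^sup>+x. ennreal (normal_density 0 (sqrt w) (y - (\<alpha> + \<beta> * m) - x) * normal_density 0 (\<beta> * sqrt v) x) \<partial>lborel)"
    using assms conv_normal_density_zero_mean[of "sqrt w" "\<beta> * sqrt v"] by (simp add: fun_eq_iff)
  also have "\<dots> = ennreal \<beta> * (\<integral>\<^sup>+z. ennreal (normal_density 0 (sqrt w) (y - (\<alpha> + \<beta> * m) - (- (\<beta> * m) + \<beta> * z)) *
      normal_density 0 (\<beta> * sqrt v) (- (\<beta> * m) + \<beta> * z)) \<partial>lborel)"
    using assms by (subst nn_integral_real_affine[where c = \<beta> and t = "- (\<beta> * m)"]) auto
  also have "\<dots> = (\<integral>\<^sup>+z. ennreal \<beta> * ennreal (normal_density 0 (sqrt w) (y - (\<alpha> + \<beta> * m) - (- (\<beta> * m) + \<beta> * z)) *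
      normal_density 0 (\<beta> * sqrt v) (- (\<beta> * m) + \<beta> * z)) \<partial>lborel)"
    by (rule nn_integral_cmult[symmetric]) simp
  also have "\<dots> = (\<integral>\<^sup>+z. ennreal (normal_density m (sqrt v) z * normal_density (\<alpha> + \<beta> * z) (sqrt w) y) \<partial>lborel)"
  proof (rule nn_integral_cong)
    fix z
    have "ennreal \<beta> * ennreal (normal_density (\<alpha> + \<beta> * z) (sqrt w) y * normal_density 0 (\<beta> * sqrt v) (- (\<beta> * m) + \<beta> * z)) =
      ennreal (normal_density (\<alpha> + \<beta> * z) (sqrt w) y * (\<beta> * normal_density 0 (\<beta> * sqrt v) (- (\<beta> * m) + \<beta> * z)))"
      using assms by (subst ennreal_mult[symmetric]) (auto simp: mult_ac)
    then show "ennreal \<beta> * ennreal (normal_density 0 (sqrt w) (y - (\<alpha> + \<beta> * m) - (- (\<beta> * m) + \<beta> * z)) *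
      normal_density 0 (\<beta> * sqrt v) (- (\<beta> * m) + \<beta> * z)) = ennreal (normal_density m (sqrt v) z * normal_density (\<alpha> + \<beta> * z) (sqrt w) y)"
      unfolding shift scale by (simp add: mult.commute)
  qed
  finally show ?thesis by simp
qed

section \<open>Conditional laws of a known part plus independent noise\<close>

context prob_space
begin

lemma sigma_finite_subalgebraI:
  assumes "subalgebra M G"
  shows "sigma_finite_subalgebra M G"
proof (intro sigma_finite_subalgebra.intro assms)
  interpret R: prob_space "restr_to_subalg M G"
    by (rule prob_space_restr_to_subalg[OF assms]) unfold_locales
  show "sigma_finite_measure (restr_to_subalg M G)" by unfold_locales
qed

text \<open>Given \<open>G\<close>, the summand \<open>X\<close> is frozen and the noise keeps its
  law. Fubini on the joint law of the sample point, seen through \<open>G\<close>, and the noise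
  verifies the defining integrals of the conditional probability.\<close>

lemma cond_prob_indep_normal:
  assumes G: "subalgebra M G" and X: "X \<in> borel_measurable G" and \<xi>: "indep_of M G \<xi>"
    and N: "has_normal_law M \<xi> 0 v" and v: "0 < v" and A: "A \<in> sets borel"
    and Y: "\<And>\<omega>. \<omega> \<in> space M \<Longrightarrow> Y \<omega> = X \<omega> + \<xi> \<omega>"
  shows "AE \<omega> in M. real_cond_exp M G (indicator (Y -` A \<inter> space M)) \<omega> =
    (LINT y:A|lborel. normal_density (X \<omega>) (sqrt v) y)"
proof -
  interpret S: sigma_finite_subalgebra M G by (rule sigma_finite_subalgebraI[OF G])
  let ?R = "restr_to_subalg M G" and ?N = "normal_law 0 v"
  define K where "K x = (LINT y:A|lborel. normal_density x (sqrt v) y)" for x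
  interpret R: prob_space ?R by (rule prob_space_restr_to_subalg[OF G]) unfold_locales
  interpret N: real_distribution ?N using v by (intro real_distribution_normal_law) simp
  have \<xi>M [measurable]: "\<xi> \<in> borel_measurable M" using \<xi> by (simp add: indep_of_def)
  have XM [measurable]: "X \<in> borel_measurable M" by (rule measurable_from_subalg[OF G X])
  have YM [measurable]: "Y \<in> borel_measurable M"
    using Y by (subst measurable_cong[of M Y "\<lambda>\<omega>. X \<omega> + \<xi> \<omega>"]) auto
  have XR [measurable]: "X \<in> borel_measurable ?R" by (rule measurable_in_subalg[OF G X])
  have idM [measurable]: "(\<lambda>\<omega>. \<omega>) \<in> measurable M ?R"
    using G sets_restr_to_subalg[OF G] by (auto simp: measurable_def subalgebra_def space_restr_to_subalg
      intro!: sets.Int)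
  have K_meas: "K \<in> borel_measurable borel"
  proof -
    have "(\<lambda>(x, y). indicator A y *\<^sub>R normal_density x (sqrt v) y) \<in> borel_measurable (borel \<Otimes>\<^sub>M lborel)"
      using A unfolding normal_density_def by measurable
    from lborel.borel_measurable_lebesgue_integral[OF this] show ?thesis
      by (simp add: K_def[abs_def] set_lebesgue_integral_def)
  qed
  have K0: "0 \<le> K x" for x
    unfolding K_def set_lebesgue_integral_def by (intro integral_nonneg_AE) auto
  have K1: "K x \<le> 1" for x
  proof -
    have "ennreal (K x) = (\<integral>\<^sup>+y. indicator A (x + y) \<partial>?N)" unfolding K_def normal_kernel_eq[OF v A] ..
    also have "\<dots> \<le> (\<integral>\<^sup>+y. 1 \<partial>?N)" by (intro nn_integral_mono) (auto simp: indicator_def)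
    also have "\<dots> = 1" using N.emeasure_space_1 by simp
    finally show ?thesis using K0 by (simp add: ennreal_le_1)
  qed
  \<comment> \<open>On rectangles this is precisely the independence of \<open>\<xi>\<close> from
    \<open>G\<close>; the first factor carries only the events of \<open>G\<close>.\<close>
  have joint: "?R \<Otimes>\<^sub>M ?N = distr M (?R \<Otimes>\<^sub>M borel) (\<lambda>\<omega>. (\<omega>, \<xi> \<omega>))"
  proof (rule pair_measure_eqI)
    show "sigma_finite_measure ?R" "sigma_finite_measure ?N" by unfold_locales
    show "sets (?R \<Otimes>\<^sub>M ?N) = sets (distr M (?R \<Otimes>\<^sub>M borel) (\<lambda>\<omega>. (\<omega>, \<xi> \<omega>)))"
      by (simp cong: sets_pair_measure_cong)
    fix F C assume F: "F \<in> sets ?R" and C: "C \<in> sets ?N"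
    have FG: "F \<in> sets G" using F by (simp add: sets_restr_to_subalg[OF G])
    have C': "C \<in> sets borel" using C by simp
    have "F \<subseteq> space M" using FG G sets.sets_into_space[of F G] by (auto simp: subalgebra_def)
    then have pre: "(\<lambda>\<omega>. (\<omega>, \<xi> \<omega>)) -` (F \<times> C) \<inter> space M = F \<inter> (\<xi> -` C \<inter> space M)" by auto
    have "emeasure ?N C = emeasure M (\<xi> -` C \<inter> space M)"
      using N C' unfolding has_normal_law_def by (metis \<xi>M emeasure_distr)
    then have "emeasure ?R F * emeasure ?N C = emeasure M F * emeasure M (\<xi> -` C \<inter> space M)"
      using emeasure_restr_to_subalg[OF G FG] by simp
    also have "\<dots> = emeasure M (F \<inter> (\<xi> -` C \<inter> space M))"
      using \<xi> FG C' by (simp add: emeasure_eq_measure indep_of_def ennreal_mult)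
    also have "\<dots> = emeasure (distr M (?R \<Otimes>\<^sub>M borel) (\<lambda>\<omega>. (\<omega>, \<xi> \<omega>))) (F \<times> C)"
      using F C' pre by (subst emeasure_distr) auto
    finally show "emeasure ?R F * emeasure ?N C = emeasure (distr M (?R \<Otimes>\<^sub>M borel) (\<lambda>\<omega>. (\<omega>, \<xi> \<omega>))) (F \<times> C)" .
  qed
  have rect: "(\<integral>\<omega>\<in>F. indicator (Y -` A \<inter> space M) \<omega> \<partial>M) = (\<integral>\<omega>\<in>F. K (X \<omega>) \<partial>M)" if F: "F \<in> sets G" for F
  proof -
    have FM [measurable]: "F \<in> events" using F G by (auto simp: subalgebra_def)
    have FR: "F \<in> sets ?R" using F by (simp add: sets_restr_to_subalg[OF G])
    have \<phi>: "(\<lambda>(\<omega>, y). indicator F \<omega> * indicator A (X \<omega> + y) :: ennreal) \<in> borel_measurable (?R \<Otimes>\<^sub>M borel)"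
      using FR A by measurable
    have \<phi>N: "(\<lambda>(\<omega>, y). indicator F \<omega> * indicator A (X \<omega> + y) :: ennreal) \<in> borel_measurable (?R \<Otimes>\<^sub>M ?N)"
      using \<phi> by (simp cong: measurable_cong_sets sets_pair_measure_cong)
    have "(\<integral>\<^sup>+\<omega>. indicator F \<omega> * indicator (Y -` A \<inter> space M) \<omega> \<partial>M) =
        (\<integral>\<^sup>+\<omega>. indicator F \<omega> * indicator A (X \<omega> + \<xi> \<omega>) \<partial>M)"
      using Y by (intro nn_integral_cong) (auto simp: indicator_def)
    also have "\<dots> = (\<integral>\<^sup>+p. (\<lambda>(\<omega>, y). indicator F \<omega> * indicator A (X \<omega> + y)) p \<partial>distr M (?R \<Otimes>\<^sub>M borel) (\<lambda>\<omega>. (\<omega>, \<xi> \<omega>)))"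
      using \<phi> by (subst nn_integral_distr) auto
    also have "\<dots> = (\<integral>\<^sup>+\<omega>. \<integral>\<^sup>+y. indicator F \<omega> * indicator A (X \<omega> + y) \<partial>?N \<partial>?R)"
      unfolding joint[symmetric] using N.nn_integral_fst[OF \<phi>N] by simp
    also have "\<dots> = (\<integral>\<^sup>+\<omega>. indicator F \<omega> * ennreal (K (X \<omega>)) \<partial>?R)"
      using A by (intro nn_integral_cong) (simp add: nn_integral_cmult normal_kernel_eq[OF v A] K_def)
    also have "\<dots> = (\<integral>\<^sup>+\<omega>. indicator F \<omega> * ennreal (K (X \<omega>)) \<partial>M)"
      using F X K_meas by (intro nn_integral_subalgebra2[OF G]) auto
    finally have eq: "(\<integral>\<^sup>+\<omega>. indicator F \<omega> * indicator (Y -` A \<inter> space M) \<omega> \<partial>M) =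
        (\<integral>\<^sup>+\<omega>. indicator F \<omega> * ennreal (K (X \<omega>)) \<partial>M)" .
    have KX [measurable]: "(\<lambda>\<omega>. K (X \<omega>)) \<in> borel_measurable M" using measurable_compose[OF XM K_meas] .
    have "(\<integral>\<omega>\<in>F. indicator (Y -` A \<inter> space M) \<omega> \<partial>M) =
        enn2real (\<integral>\<^sup>+\<omega>. ennreal (indicator F \<omega> *\<^sub>R indicator (Y -` A \<inter> space M) \<omega>) \<partial>M)"
      unfolding set_lebesgue_integral_def using A by (intro integral_eq_nn_integral) auto
    also have "\<dots> = enn2real (\<integral>\<^sup>+\<omega>. indicator F \<omega> * indicator (Y -` A \<inter> space M) \<omega> \<partial>M)"
      by (intro arg_cong[where f = enn2real] nn_integral_cong) (simp add: indicator_def)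
    also have "\<dots> = enn2real (\<integral>\<^sup>+\<omega>. ennreal (indicator F \<omega> *\<^sub>R K (X \<omega>)) \<partial>M)"
      unfolding eq by (intro arg_cong[where f = enn2real] nn_integral_cong) (simp add: indicator_def)
    also have "\<dots> = (\<integral>\<omega>\<in>F. K (X \<omega>) \<partial>M)"
      unfolding set_lebesgue_integral_def using K0 by (intro integral_eq_nn_integral[symmetric]) auto
    finally show ?thesis .
  qed
  have "AE \<omega> in M. real_cond_exp M G (indicator (Y -` A \<inter> space M)) \<omega> = K (X \<omega>)"
  proof (rule S.real_cond_exp_charact[OF rect])
    have YA: "Y -` A \<inter> space M \<in> events" using A by measurable
    show "integrable M (indicator (Y -` A \<inter> space M) :: _ \<Rightarrow> real)"
      using YA by (intro integrable_real_indicator) (auto simp: emeasure_eq_measure)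
    show "integrable M (\<lambda>\<omega>. K (X \<omega>))"
      using K0 K1 measurable_compose[OF XM K_meas] by (intro integrable_const_bound[of _ 1]) auto
    show "(\<lambda>\<omega>. K (X \<omega>)) \<in> borel_measurable G" by (rule measurable_compose[OF X K_meas])
  qed
  then show ?thesis by (simp add: K_def)
qed

end

section \<open>The strong law for the time-changed Brownian motion\<close>

lemma has_normal_law_cong_AE:
  assumes "has_normal_law M X \<mu> v" "Y \<in> borel_measurable M" "AE \<omega> in M. X \<omega> = Y \<omega>"
  shows "has_normal_law M Y \<mu> v"
proof -
  have "distr M borel X = distr M borel Y"
    using assms by (intro distr_cong_AE) (auto simp: has_normal_law_def)
  then show ?thesis using assms by (simp add: has_normal_law_def)
qed

text \<open>\<open>Z\<close> is a Brownian motion run at the clock \<open>1 / D t - 1 / D 0\<close>, which explodes at \<open>T\<close>.\<close>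

locale exploding_martingale = prob_space M for M :: "'w measure" +
  fixes Z :: "real \<Rightarrow> 'w \<Rightarrow> real" and D :: "real \<Rightarrow> real" and T :: real
  assumes T_pos: "0 < T"
    and Z_meas [measurable]: "\<And>t. t \<in> {0..<T} \<Longrightarrow> Z t \<in> borel_measurable M"
    and Z_0: "AE \<omega> in M. Z 0 \<omega> = 0"
    and Z_indep: "\<And>s t. 0 \<le> s \<Longrightarrow> s \<le> t \<Longrightarrow> t < T \<Longrightarrow>
      indep_of M (natural_filtration M {0..<T} Z s) (\<lambda>\<omega>. Z t \<omega> - Z s \<omega>)"
    and Z_normal_diff: "\<And>s t. 0 \<le> s \<Longrightarrow> s \<le> t \<Longrightarrow> t < T \<Longrightarrow>
      has_normal_law M (\<lambda>\<omega>. Z t \<omega> - Z s \<omega>) 0 (1 / D t - 1 / D s)"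
    and Z_cont: "AE \<omega> in M. continuous_on {0..<T} (\<lambda>t. Z t \<omega>)"
    and D_cont: "continuous_on {0..T} D"
    and D_T: "D T = 0"
    and D_strict: "\<And>s t. 0 \<le> s \<Longrightarrow> s < t \<Longrightarrow> t \<le> T \<Longrightarrow> D t < D s"
begin

section \<open>Gaussian structure and orthogonality of increments\<close>

abbreviation filt :: "real \<Rightarrow> 'w measure" where
  "filt \<equiv> natural_filtration M {0..<T} Z"

lemma D_pos: "0 \<le> t \<Longrightarrow> t < T \<Longrightarrow> 0 < D t"
  using D_strict[of t T] D_T by simp

lemma subalgebra_filt: "subalgebra M (filt s)"
  by (rule subalgebra_natural_filtration) simp

lemma Z_filt: "0 \<le> u \<Longrightarrow> u \<le> s \<Longrightarrow> u < T \<Longrightarrow> Z u \<in> borel_measurable (filt s)"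
  by (rule measurable_natural_filtration) simp_all

lemma Z_normal:
  assumes "0 \<le> t" "t < T"
  shows "has_normal_law M (Z t) 0 (1 / D t - 1 / D 0)"
proof (rule has_normal_law_cong_AE[OF Z_normal_diff[of 0 t]])
  show "AE \<omega> in M. Z t \<omega> - Z 0 \<omega> = Z t \<omega>" using Z_0 by eventually_elim simp
qed (use assms in auto)

text \<open>Induction on the largest time \<open>b\<close>: writing \<open>Z b\<close> as
  \<open>Z m\<close> plus an increment, with \<open>m\<close> the largest remaining time, moves the
  coefficient of \<open>b\<close> onto \<open>m\<close> and leaves a normal term independent of all
  the others.\<close>

lemma Z_linear_combination_normal:
  assumes "finite J" "J \<subseteq> {0..<T}"
  shows "\<exists>v. has_normal_law M (\<lambda>\<omega>. \<Sum>t\<in>J. c t * Z t \<omega>) 0 v"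
  using assms
proof (induction J arbitrary: c rule: finite_linorder_max_induct)
  case empty
  then show ?case using has_normal_law_const[of 0] by auto
next
  case (insert b A)
  show ?case
  proof (cases "A = {}")
    case True
    then show ?thesis
      using has_normal_law_affine[OF Z_normal[of b], of 0 "c b"] insert.prems by auto
  next
    case False
    define m where "m = Max A"
    have m: "m \<in> A" "m < b" using insert.hyps False by (auto simp: m_def)
    have mle: "t \<le> m" if "t \<in> A" for t using that insert.hyps(1) by (simp add: m_def)
    define c' where "c' = c(m := c m + c b)"
    obtain v where v: "has_normal_law M (\<lambda>\<omega>. \<Sum>t\<in>A. c' t * Z t \<omega>) 0 v"
      using insert.IH[of c'] insert.prems by auto
    have b: "0 \<le> m" "m \<le> b" "b < T" using m insert.prems by auto
    have w: "has_normal_law M (\<lambda>\<omega>. c b * (Z b \<omega> - Z m \<omega>)) 0 ((c b)\<^sup>2 * (1 / D b - 1 / D m))"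
      using has_normal_law_affine[OF Z_normal_diff[OF b], of 0 "c b"] by simp
    have "(\<lambda>\<omega>. \<Sum>t\<in>A. c' t * Z t \<omega>) \<in> borel_measurable (filt m)"
      using insert.prems mle b by (intro borel_measurable_sum borel_measurable_times borel_measurable_const Z_filt) auto
    from indep_var_of_indep_of[OF subalgebra_filt Z_indep[OF b] this]
    have "indep_var borel ((\<lambda>x. x) \<circ> (\<lambda>\<omega>. \<Sum>t\<in>A. c' t * Z t \<omega>)) borel ((\<lambda>x. c b * x) \<circ> (\<lambda>\<omega>. Z b \<omega> - Z m \<omega>))"
      by (rule indep_var_compose) auto
    then have "indep_var borel (\<lambda>\<omega>. \<Sum>t\<in>A. c' t * Z t \<omega>) borel (\<lambda>\<omega>. c b * (Z b \<omega> - Z m \<omega>))"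
      by (simp only: comp_def)
    from has_normal_law_add_indep[OF v w this]
    have "has_normal_law M (\<lambda>\<omega>. (\<Sum>t\<in>A. c' t * Z t \<omega>) + c b * (Z b \<omega> - Z m \<omega>)) 0 (v + (c b)\<^sup>2 * (1 / D b - 1 / D m))"
      by simp
    moreover have "(\<Sum>t\<in>A. c' t * Z t \<omega>) + c b * (Z b \<omega> - Z m \<omega>) = (\<Sum>t\<in>insert b A. c t * Z t \<omega>)" for \<omega>
    proof -
      have "(\<Sum>t\<in>A. c' t * Z t \<omega>) = (c m + c b) * Z m \<omega> + (\<Sum>t\<in>A - {m}. c t * Z t \<omega>)"
        using insert.hyps(1) m(1) by (subst sum.remove[of A m]) (auto simp: c'_def)
      moreover have "(\<Sum>t\<in>A. c t * Z t \<omega>) = c m * Z m \<omega> + (\<Sum>t\<in>A - {m}. c t * Z t \<omega>)"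
        using insert.hyps(1) m(1) by (rule sum.remove)
      moreover have "b \<notin> A" using insert.hyps(2) by auto
      ultimately show ?thesis using insert.hyps(1) by (simp add: algebra_simps)
    qed
    ultimately show ?thesis by auto
  qed
qed

section \<open>Maximal inequalities and growth of paths\<close>

lemma Z_second_moment:
  assumes "0 \<le> t" "t < T"
  shows "sq_integrable M (Z t)" "expectation (\<lambda>\<omega>. (Z t \<omega>)\<^sup>2) = 1 / D t - 1 / D 0"
  using has_normal_law_second_moment[OF Z_normal[OF assms]] assms by (auto simp: sq_integrable_def)

text \<open>Expanding the square of \<open>Z t\<close> around \<open>Z s\<close>, the mixed term has
  expectation zero, because the increment is centred and independent of
  \<open>indicator A * Z s\<close>; what remains is a nonnegative square.\<close>

lemma Z_submartingale:
  assumes st: "0 \<le> s" "s \<le> t" "t < T" and A: "A \<in> sets (filt s)"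
  shows "expectation (\<lambda>\<omega>. indicator A \<omega> * (Z s \<omega>)\<^sup>2) \<le> expectation (\<lambda>\<omega>. indicator A \<omega> * (Z t \<omega>)\<^sup>2)"
proof -
  have AM [measurable]: "A \<in> events" using A subalgebra_filt by (auto simp: subalgebra_def)
  have s: "s < T" and t: "0 \<le> t" using st by auto
  note sqs = Z_second_moment(1)[OF st(1) s] and sqt = Z_second_moment(1)[OF t st(3)]
  have ind_int: "integrable M (\<lambda>\<omega>. indicator A \<omega> * f \<omega>)" if "integrable M f" for f :: "'w \<Rightarrow> real"
    using integrable_mult_indicator[OF AM that] by simp
  have AZ: "(\<lambda>\<omega>. indicator A \<omega> * Z s \<omega>) \<in> borel_measurable (filt s)"
    using A Z_filt[OF st(1) order_refl s] by (intro borel_measurable_times) auto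
  have AZi: "integrable M (\<lambda>\<omega>. indicator A \<omega> * Z s \<omega>)"
    using has_normal_law_second_moment(1)[OF Z_normal[OF st(1) s]] by (rule ind_int)
  note dm = has_normal_law_second_moment[OF Z_normal_diff[OF st]]
  have ind: "indep_var borel (\<lambda>\<omega>. indicator A \<omega> * Z s \<omega>) borel (\<lambda>\<omega>. Z t \<omega> - Z s \<omega>)"
    by (rule indep_var_of_indep_of[OF subalgebra_filt Z_indep[OF st] AZ])
  have cross: "expectation (\<lambda>\<omega>. (indicator A \<omega> * Z s \<omega>) * (Z t \<omega> - Z s \<omega>)) = 0"
    using indep_var_lebesgue_integral[OF ind AZi dm(1)] dm(3) by simp
  have cross_int: "integrable M (\<lambda>\<omega>. (indicator A \<omega> * Z s \<omega>) * (Z t \<omega> - Z s \<omega>))"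
    by (rule indep_var_integrable[OF ind AZi dm(1)])
  have i1: "integrable M (\<lambda>\<omega>. indicator A \<omega> * (Z s \<omega>)\<^sup>2)" "integrable M (\<lambda>\<omega>. indicator A \<omega> * (Z t \<omega> - Z s \<omega>)\<^sup>2)"
    using sqs dm(2) by (auto simp: sq_integrable_def intro!: ind_int)
  have "expectation (\<lambda>\<omega>. indicator A \<omega> * (Z t \<omega>)\<^sup>2) =
    expectation (\<lambda>\<omega>. indicator A \<omega> * (Z s \<omega>)\<^sup>2 + indicator A \<omega> * (Z t \<omega> - Z s \<omega>)\<^sup>2 +
      2 * ((indicator A \<omega> * Z s \<omega>) * (Z t \<omega> - Z s \<omega>)))"
    by (intro Bochner_Integration.integral_cong refl) (simp add: power2_eq_square algebra_simps)
  also have "\<dots> = expectation (\<lambda>\<omega>. indicator A \<omega> * (Z s \<omega>)\<^sup>2) + expectation (\<lambda>\<omega>. indicator A \<omega> * (Z t \<omega> - Z s \<omega>)\<^sup>2)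
      + 2 * expectation (\<lambda>\<omega>. (indicator A \<omega> * Z s \<omega>) * (Z t \<omega> - Z s \<omega>))"
    using i1 cross_int by (simp only: Bochner_Integration.integral_add Bochner_Integration.integrable_add
      integrable_mult_right integral_mult_right_zero)
  also have "\<dots> \<ge> expectation (\<lambda>\<omega>. indicator A \<omega> * (Z s \<omega>)\<^sup>2)"
    unfolding cross by (simp add: integral_nonneg_AE)
  finally show ?thesis .
qed

text \<open>Kolmogorov's maximal inequality, by decomposing according to the first passage.\<close>

lemma maximal_inequality:
  fixes p :: "nat \<Rightarrow> real"
  assumes p: "\<And>i. i \<le> n \<Longrightarrow> 0 \<le> p i \<and> p i < T" "\<And>i j. i \<le> j \<Longrightarrow> j \<le> n \<Longrightarrow> p i \<le> p j"
    and l: "0 < l"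
  shows "prob {\<omega>\<in>space M. \<exists>i\<le>n. l < \<bar>Z (p i) \<omega>\<bar>} \<le> (1 / D (p n) - 1 / D 0) / l\<^sup>2"
proof -
  define A where "A k = {\<omega>\<in>space M. l < \<bar>Z (p k) \<omega>\<bar> \<and> (\<forall>i<k. \<bar>Z (p i) \<omega>\<bar> \<le> l)}" for k
  have A_filt: "A k \<in> sets (filt (p k))" if "k \<le> n" for k
  proof -
    have m: "Z (p i) \<in> borel_measurable (filt (p k))" if "i \<le> k" for i
      using p(1)[OF order_trans[OF that \<open>k \<le> n\<close>]] p(2)[OF that \<open>k \<le> n\<close>] by (intro Z_filt) auto
    have "{\<omega>\<in>space (filt (p k)). l < \<bar>Z (p k) \<omega>\<bar>} \<in> sets (filt (p k))"
      using m[of k] by measurable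
    moreover have "{\<omega>\<in>space (filt (p k)). \<forall>i\<in>{..<k}. \<bar>Z (p i) \<omega>\<bar> \<le> l} \<in> sets (filt (p k))"
    proof (rule sets.sets_Collect_finite_All)
      fix i assume "i \<in> {..<k}"
      then have "i \<le> k" by simp
      from m[OF this] show "{\<omega>\<in>space (filt (p k)). \<bar>Z (p i) \<omega>\<bar> \<le> l} \<in> sets (filt (p k))"
        by measurable
    qed simp
    ultimately have "{\<omega>\<in>space (filt (p k)). l < \<bar>Z (p k) \<omega>\<bar>} \<inter>
        {\<omega>\<in>space (filt (p k)). \<forall>i\<in>{..<k}. \<bar>Z (p i) \<omega>\<bar> \<le> l} \<in> sets (filt (p k))" by (rule sets.Int)
    also have "{\<omega>\<in>space (filt (p k)). l < \<bar>Z (p k) \<omega>\<bar>} \<inter>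
        {\<omega>\<in>space (filt (p k)). \<forall>i\<in>{..<k}. \<bar>Z (p i) \<omega>\<bar> \<le> l} = A k"
      by (auto simp: A_def)
    finally show ?thesis .
  qed
  have A_ev: "A k \<in> events" if "k \<le> n" for k
    using A_filt[OF that] subalgebra_filt by (auto simp: subalgebra_def)
  have disj: "disjoint_family_on A {..n}"
    unfolding disjoint_family_on_def A_def by (auto simp: neq_iff)
  have un: "{\<omega>\<in>space M. \<exists>i\<le>n. l < \<bar>Z (p i) \<omega>\<bar>} = (\<Union>k\<in>{..n}. A k)"
  proof safe
    fix \<omega> i assume \<omega>: "\<omega> \<in> space M" "i \<le> n" "l < \<bar>Z (p i) \<omega>\<bar>"
    define k where "k = (LEAST k. l < \<bar>Z (p k) \<omega>\<bar>)"
    have "l < \<bar>Z (p k) \<omega>\<bar>" unfolding k_def by (rule LeastI) (fact \<omega>(3))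
    moreover have "k \<le> i" unfolding k_def by (rule Least_le) (fact \<omega>(3))
    moreover have "\<bar>Z (p j) \<omega>\<bar> \<le> l" if "j < k" for j
      using not_less_Least[OF that[unfolded k_def]] by simp
    ultimately show "\<omega> \<in> (\<Union>k\<in>{..n}. A k)" using \<omega> by (auto simp: A_def)
  qed (auto simp: A_def)
  have n: "0 \<le> p n" "p n < T" using p(1)[of n] by auto
  have int_n: "integrable M (\<lambda>\<omega>. (Z (p n) \<omega>)\<^sup>2)" using Z_second_moment(1)[OF n] by (simp add: sq_integrable_def)
  \<comment> \<open>On \<open>A k\<close> the level is exceeded at \<open>p k\<close>. Since
    \<open>A k\<close> is known at that time, the submartingale inequality moves the second moment
    to the common final time \<open>p n\<close>.\<close>
  have part: "l\<^sup>2 * prob (A k) \<le> expectation (\<lambda>\<omega>. indicator (A k) \<omega> * (Z (p n) \<omega>)\<^sup>2)" if k: "k \<le> n" for k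
  proof -
    have pk: "0 \<le> p k" "p k < T" "p k \<le> p n" using p k by auto
    have "l\<^sup>2 * prob (A k) = expectation (\<lambda>\<omega>. l\<^sup>2 * indicator (A k) \<omega>)" using A_ev[OF k] by simp
    also have "\<dots> \<le> expectation (\<lambda>\<omega>. indicator (A k) \<omega> * (Z (p k) \<omega>)\<^sup>2)"
    proof (rule integral_mono)
      show "integrable M (\<lambda>\<omega>. l\<^sup>2 * indicator (A k) \<omega>)"
        using A_ev[OF k] by (intro integrable_mult_right integrable_real_indicator) (auto simp: emeasure_eq_measure)
      show "integrable M (\<lambda>\<omega>. indicator (A k) \<omega> * (Z (p k) \<omega>)\<^sup>2)"
        using integrable_mult_indicator[OF A_ev[OF k], of "\<lambda>\<omega>. (Z (p k) \<omega>)\<^sup>2"] Z_second_moment(1)[OF pk(1,2)]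
        by (simp add: sq_integrable_def)
      fix \<omega>
      have "l\<^sup>2 \<le> (Z (p k) \<omega>)\<^sup>2" if "\<omega> \<in> A k"
        using that l power_mono[of l "\<bar>Z (p k) \<omega>\<bar>" 2] by (simp add: A_def)
      then show "l\<^sup>2 * indicator (A k) \<omega> \<le> indicator (A k) \<omega> * (Z (p k) \<omega>)\<^sup>2"
        by (cases "\<omega> \<in> A k") auto
    qed
    also have "\<dots> \<le> expectation (\<lambda>\<omega>. indicator (A k) \<omega> * (Z (p n) \<omega>)\<^sup>2)"
      by (rule Z_submartingale[OF pk(1,3) n(2) A_filt[OF k]])
    finally show ?thesis .
  qed
  have intA: "integrable M (\<lambda>\<omega>. indicator (A k) \<omega> * (Z (p n) \<omega>)\<^sup>2)" if "k \<le> n" for k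
    using integrable_mult_indicator[OF A_ev[OF that] int_n] by simp
  have "l\<^sup>2 * prob (\<Union>k\<in>{..n}. A k) = (\<Sum>k\<le>n. l\<^sup>2 * prob (A k))"
    using A_ev disj by (subst finite_measure_finite_Union) (auto simp: sum_distrib_left)
  also have "\<dots> \<le> (\<Sum>k\<le>n. expectation (\<lambda>\<omega>. indicator (A k) \<omega> * (Z (p n) \<omega>)\<^sup>2))"
    by (intro sum_mono part) simp
  also have "\<dots> = expectation (\<lambda>\<omega>. \<Sum>k\<le>n. indicator (A k) \<omega> * (Z (p n) \<omega>)\<^sup>2)"
    using intA by (subst Bochner_Integration.integral_sum) auto
  also have "\<dots> \<le> expectation (\<lambda>\<omega>. (Z (p n) \<omega>)\<^sup>2)"
  proof (rule integral_mono[OF _ int_n])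
    show "integrable M (\<lambda>\<omega>. \<Sum>k\<le>n. indicator (A k) \<omega> * (Z (p n) \<omega>)\<^sup>2)"
      using intA by (intro Bochner_Integration.integrable_sum) auto
    fix \<omega>
    have "(\<Sum>k\<le>n. indicator (A k) \<omega>) = (indicator (\<Union>k\<in>{..n}. A k) \<omega> :: real)"
      using disj by (subst indicator_UN_disjoint) auto
    then show "(\<Sum>k\<le>n. indicator (A k) \<omega> * (Z (p n) \<omega>)\<^sup>2) \<le> (Z (p n) \<omega>)\<^sup>2"
      unfolding sum_distrib_right[symmetric] by (simp add: indicator_def)
  qed
  also have "\<dots> = 1 / D (p n) - 1 / D 0" by (rule Z_second_moment(2)[OF n])
  finally show ?thesis unfolding un using l by (simp add: field_simps)
qed

text \<open>The bound for finite grids does not depend on the grid. Dyadic grids are nested, so it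
  survives their union, and path continuity extends the estimate from dyadic points to the whole
  interval. An event \<open>E\<close> is supplied instead of the set where the supremum is large, as
  continuity holds only almost surely.\<close>

lemma path_maximal_inequality:
  assumes pq: "0 \<le> p" "p < q" "q < T" and l: "0 < l"
  obtains E where "E \<in> events" "prob E \<le> (1 / D q - 1 / D 0) / l\<^sup>2"
    "AE \<omega> in M. \<omega> \<notin> E \<longrightarrow> (\<forall>t\<in>{p..q}. \<bar>Z t \<omega>\<bar> \<le> l)"
proof -
  define \<tau> where "\<tau> m i = p + (q - p) * (real i / 2 ^ m)" for m i :: nat
  define E where "E m = {\<omega>\<in>space M. \<exists>i\<le>2 ^ m. l < \<bar>Z (\<tau> m i) \<omega>\<bar>}" for m :: nat
  have \<tau>: "p \<le> \<tau> m i" "\<tau> m i \<le> q" if "i \<le> 2 ^ m" for m i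
  proof -
    have "real i \<le> 2 ^ m" using that by (metis of_nat_le_iff of_nat_numeral of_nat_power)
    then have "real i / 2 ^ m \<le> 1" by (simp add: field_simps)
    then have "(q - p) * (real i / 2 ^ m) \<le> (q - p) * 1" using pq by (intro mult_left_mono) auto
    then show "p \<le> \<tau> m i" "\<tau> m i \<le> q" using pq by (auto simp: \<tau>_def)
  qed
  have \<tau>_mono: "\<tau> m i \<le> \<tau> m j" if "i \<le> j" for m i j
    using that pq by (auto simp: \<tau>_def intro!: mult_left_mono divide_right_mono)
  have E_ev: "E m \<in> events" for m
  proof -
    have "{\<omega>\<in>space M. \<exists>i\<in>{..2 ^ m}. l < \<bar>Z (\<tau> m i) \<omega>\<bar>} \<in> events"
    proof (rule sets.sets_Collect_finite_Ex)
      fix i :: nat assume "i \<in> {..2 ^ m}"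
      then have "Z (\<tau> m i) \<in> borel_measurable M" using \<tau>[of i m] pq by (intro Z_meas) auto
      then show "{\<omega>\<in>space M. l < \<bar>Z (\<tau> m i) \<omega>\<bar>} \<in> events" by measurable
    qed simp
    also have "{\<omega>\<in>space M. \<exists>i\<in>{..2 ^ m}. l < \<bar>Z (\<tau> m i) \<omega>\<bar>} = E m" by (auto simp: E_def)
    finally show ?thesis .
  qed
  have E_prob: "prob (E m) \<le> (1 / D q - 1 / D 0) / l\<^sup>2" for m
  proof -
    have "prob (E m) \<le> (1 / D (\<tau> m (2 ^ m)) - 1 / D 0) / l\<^sup>2"
      unfolding E_def
    proof (rule maximal_inequality[OF _ _ l])
      show "0 \<le> \<tau> m i \<and> \<tau> m i < T" if "i \<le> 2 ^ m" for i
        using \<tau>[OF that] pq by auto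
      show "\<tau> m i \<le> \<tau> m j" if "i \<le> j" for i j using that by (rule \<tau>_mono)
    qed
    then show ?thesis by (simp add: \<tau>_def)
  qed
  have "incseq E"
  proof (rule incseq_SucI)
    fix m
    show "E m \<subseteq> E (Suc m)"
    proof
      fix \<omega> assume "\<omega> \<in> E m"
      then obtain i where i: "\<omega> \<in> space M" "i \<le> 2 ^ m" "l < \<bar>Z (\<tau> m i) \<omega>\<bar>" by (auto simp: E_def)
      \<comment> \<open>Every grid point reappears in the next grid under the doubled index.\<close>
      have "\<tau> (Suc m) (2 * i) = \<tau> m i" by (simp add: \<tau>_def)
      then show "\<omega> \<in> E (Suc m)" using i by (auto simp: E_def intro!: exI[of _ "2 * i"])
    qed
  qed
  then have "(\<lambda>m. prob (E m)) \<longlonglongrightarrow> prob (\<Union>m. E m)"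
    using E_ev by (intro finite_Lim_measure_incseq) auto
  then have "prob (\<Union>m. E m) \<le> (1 / D q - 1 / D 0) / l\<^sup>2"
    by (rule LIMSEQ_le_const2) (auto intro: E_prob)
  moreover have "(\<Union>m. E m) \<in> events" using E_ev by auto
  moreover have "AE \<omega> in M. \<omega> \<notin> (\<Union>m. E m) \<longrightarrow> (\<forall>t\<in>{p..q}. \<bar>Z t \<omega>\<bar> \<le> l)"
    using Z_cont AE_space
  proof eventually_elim
    case (elim \<omega>)
    show ?case
    proof (intro impI ballI)
      fix t assume nE: "\<omega> \<notin> (\<Union>m. E m)" and t: "t \<in> {p..q}"
      define x where "x = (t - p) / (q - p)"
      have x: "0 \<le> x" "x \<le> 1" "t = p + (q - p) * x" using t pq by (auto simp: x_def)
      \<comment> \<open>Dyadic approximation of \<open>x\<close> from below with error less than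
        \<open>1 / 2 ^ m\<close>; for \<open>x = 1\<close> it uses the last grid index
        \<open>2 ^ m\<close>.\<close>
      define k where "k m = nat \<lfloor>2 ^ m * x\<rfloor>" for m :: nat
      have k: "real (k m) \<le> 2 ^ m * x" "2 ^ m * x < real (k m) + 1" for m
        using x(1) by (auto simp: k_def)
      have k2: "k m \<le> 2 ^ m" for m
      proof -
        have "2 ^ m * x \<le> 2 ^ m" using x by (simp add: mult_left_le)
        with k(1)[of m] have "real (k m) \<le> 2 ^ m" by linarith
        then show ?thesis by (metis of_nat_le_iff of_nat_numeral of_nat_power)
      qed
      have "(\<lambda>m. real (k m) / 2 ^ m) \<longlonglongrightarrow> x"
      proof (rule tendsto_sandwich[of "\<lambda>m. x - (1 / 2) ^ m" _ _ "\<lambda>_. x"])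
        show "\<forall>\<^sub>F m in sequentially. x - (1 / 2) ^ m \<le> real (k m) / 2 ^ m"
        proof (intro always_eventually allI)
          fix m
          have "x - (1 / 2) ^ m = (2 ^ m * x - 1) / 2 ^ m" by (simp add: power_divide diff_divide_distrib)
          also have "\<dots> \<le> real (k m) / 2 ^ m" using k(2)[of m] by (intro divide_right_mono) auto
          finally show "x - (1 / 2) ^ m \<le> real (k m) / 2 ^ m" .
        qed
        show "\<forall>\<^sub>F m in sequentially. real (k m) / 2 ^ m \<le> x"
          using k(1) by (intro always_eventually allI) (simp add: field_simps)
        have "(\<lambda>m. x - (1 / 2) ^ m) \<longlonglongrightarrow> x - 0"
          by (intro tendsto_diff tendsto_const LIMSEQ_power_zero) simp
        then show "(\<lambda>m. x - (1 / 2) ^ m) \<longlonglongrightarrow> x" by simp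
      qed simp
      then have "(\<lambda>m. \<tau> m (k m)) \<longlonglongrightarrow> t" unfolding \<tau>_def x(3) by (intro tendsto_intros)
      moreover have "\<tau> m (k m) \<in> {0..<T}" for m using \<tau>[OF k2, of m] pq by auto
      moreover have "t \<in> {0..<T}" using t pq by auto
      ultimately have "(\<lambda>m. Z (\<tau> m (k m)) \<omega>) \<longlonglongrightarrow> Z t \<omega>"
        using elim(1) by (intro continuous_on_tendsto_compose[of "{0..<T}" "\<lambda>t. Z t \<omega>"]) auto
      then have "(\<lambda>m. \<bar>Z (\<tau> m (k m)) \<omega>\<bar>) \<longlonglongrightarrow> \<bar>Z t \<omega>\<bar>" by (rule tendsto_rabs)
      moreover have "\<bar>Z (\<tau> m (k m)) \<omega>\<bar> \<le> l" for m
        using nE k2[of m] elim(2) by (force simp: E_def)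
      ultimately show "\<bar>Z t \<omega>\<bar> \<le> l" by (intro LIMSEQ_le_const2) auto
    qed
  qed
  ultimately show thesis by (intro that) auto
qed

lemma D_Z_tendsto_0: "AE \<omega> in M. ((\<lambda>t. D t * Z t \<omega>) \<longlongrightarrow> 0) (at_left T)"
proof -
  have D0: "0 < D 0" using D_pos[of 0] T_pos by simp
  have "\<exists>t. t \<in> {0..<T} \<and> D t = D 0 / 2 ^ k" for k :: nat
  proof -
    have "D 0 / 2 ^ k \<le> D 0 / 1" using D0 by (intro divide_left_mono) auto
    then obtain t where t: "0 \<le> t" "t \<le> T" "D t = D 0 / 2 ^ k"
      using IVT2'[of D T "D 0 / 2 ^ k" 0] D_T D0 T_pos D_cont by auto
    then have "t \<noteq> T" using D_T D0 by auto
    with t show ?thesis by (intro exI[of _ t]) auto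
  qed
  then obtain \<tau> :: "nat \<Rightarrow> real" where \<tau>: "\<And>k. \<tau> k \<in> {0..<T}" "\<And>k. D (\<tau> k) = D 0 / 2 ^ k"
    by metis
  have D_le: "t \<le> s" if "0 \<le> s" "s < T" "0 \<le> t" "t < T" "D s \<le> D t" for s t
    using D_strict[of s t] that by force
  have \<tau>_less: "\<tau> k < \<tau> (Suc k)" for k
  proof (rule ccontr)
    assume "\<not> \<tau> k < \<tau> (Suc k)"
    then have "D (\<tau> k) \<le> D (\<tau> (Suc k))"
      using D_strict[of "\<tau> (Suc k)" "\<tau> k"] \<tau>(1)[of k] \<tau>(1)[of "Suc k"] by (cases "\<tau> k = \<tau> (Suc k)") auto
    then show False using D0 by (simp add: \<tau>(2) field_simps)
  qed
  \<comment> \<open>The variance at \<open>\<tau> (Suc k)\<close> is at most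
    \<open>2 ^ Suc k / D 0\<close>, and on the block \<open>D\<close> is at most
    \<open>D 0 / 2 ^ k\<close>. The squared level must grow faster than \<open>2 ^ k\<close> for
    summability and slower than \<open>4 ^ k\<close> for the product with \<open>D\<close> to
    vanish; \<open>3 ^ k\<close> lies between.\<close>
  define l where "l k = sqrt 3 ^ k" for k :: nat
  have l: "0 < l k" "(l k)\<^sup>2 = 3 ^ k" for k
    by (auto simp: l_def power_mult[symmetric] mult.commute[of k]) (simp add: power_mult)
  have "\<exists>E. E \<in> events \<and> prob E \<le> (1 / D (\<tau> (Suc k)) - 1 / D 0) / (l k)\<^sup>2 \<and>
      (AE \<omega> in M. \<omega> \<notin> E \<longrightarrow> (\<forall>t\<in>{\<tau> k..\<tau> (Suc k)}. \<bar>Z t \<omega>\<bar> \<le> l k))" for k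
  proof -
    have "0 \<le> \<tau> k" "\<tau> (Suc k) < T" using \<tau>(1)[of k] \<tau>(1)[of "Suc k"] by auto
    from path_maximal_inequality[OF this(1) \<tau>_less this(2) l(1)[of k]] show ?thesis by blast
  qed
  then have "\<exists>E. \<forall>k. E k \<in> events \<and> prob (E k) \<le> (1 / D (\<tau> (Suc k)) - 1 / D 0) / (l k)\<^sup>2 \<and>
      (AE \<omega> in M. \<omega> \<notin> E k \<longrightarrow> (\<forall>t\<in>{\<tau> k..\<tau> (Suc k)}. \<bar>Z t \<omega>\<bar> \<le> l k))"
    by (intro choice allI)
  then obtain E where "\<forall>k. E k \<in> events \<and> prob (E k) \<le> (1 / D (\<tau> (Suc k)) - 1 / D 0) / (l k)\<^sup>2 \<and>
      (AE \<omega> in M. \<omega> \<notin> E k \<longrightarrow> (\<forall>t\<in>{\<tau> k..\<tau> (Suc k)}. \<bar>Z t \<omega>\<bar> \<le> l k))"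
    by (rule exE)
  then have E: "\<And>k. E k \<in> events" "\<And>k. prob (E k) \<le> (1 / D (\<tau> (Suc k)) - 1 / D 0) / (l k)\<^sup>2"
      "\<And>k. AE \<omega> in M. \<omega> \<notin> E k \<longrightarrow> (\<forall>t\<in>{\<tau> k..\<tau> (Suc k)}. \<bar>Z t \<omega>\<bar> \<le> l k)"
    by blast+
  have "summable (\<lambda>k. prob (E k))"
  proof (rule summable_comparison_test')
    show "summable (\<lambda>k. 2 / D 0 * (2 / 3 :: real) ^ k)" by (intro summable_mult summable_geometric) simp
    fix k
    have "prob (E k) \<le> (1 / D (\<tau> (Suc k)) - 1 / D 0) / (l k)\<^sup>2" by (rule E(2))
    also have "\<dots> \<le> (1 / D (\<tau> (Suc k))) / (l k)\<^sup>2" using D0 by (intro divide_right_mono) auto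
    also have "\<dots> = 2 / D 0 * (2 / 3) ^ k" using D0 by (simp add: \<tau>(2) l(2) power_divide)
    finally show "norm (prob (E k)) \<le> 2 / D 0 * (2 / 3) ^ k" by simp
  qed
  then have "AE \<omega> in M. eventually (\<lambda>k. \<omega> \<in> space M - E k) sequentially"
    using E(1) by (intro borel_cantelli_AE1) (auto simp: emeasure_eq_measure)
  moreover have "AE \<omega> in M. \<forall>k. \<omega> \<notin> E k \<longrightarrow> (\<forall>t\<in>{\<tau> k..\<tau> (Suc k)}. \<bar>Z t \<omega>\<bar> \<le> l k)"
    using E(3) by (simp add: AE_all_countable)
  ultimately show ?thesis
  proof eventually_elim
    case (elim \<omega>)
    show ?case
    proof (rule tendstoI)
      fix \<epsilon> :: real assume \<epsilon>: "0 < \<epsilon>"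
      have "(\<lambda>k. D 0 * (sqrt 3 / 2) ^ k) \<longlonglongrightarrow> D 0 * 0"
        by (intro tendsto_mult tendsto_const LIMSEQ_power_zero) (simp add: real_less_lsqrt)
      then have "eventually (\<lambda>k. D 0 * (sqrt 3 / 2) ^ k < \<epsilon>) sequentially"
        using \<epsilon> by (intro order_tendstoD(2)) auto
      with elim(1) have "eventually (\<lambda>k. \<omega> \<in> space M - E k \<and> D 0 * (sqrt 3 / 2) ^ k < \<epsilon>) sequentially"
        by (rule eventually_conj)
      then obtain K where K: "\<And>k. K \<le> k \<Longrightarrow> \<omega> \<notin> E k \<and> D 0 * (sqrt 3 / 2) ^ k < \<epsilon>"
        by (auto simp: eventually_sequentially)
      have bound: "\<bar>D t * Z t \<omega>\<bar> < \<epsilon>" if t: "\<tau> K \<le> t" "t < T" for t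
      proof -
        have t0: "0 \<le> t" "0 < D t" using t \<tau>(1)[of K] D_pos[of t] by auto
        have "(\<lambda>k. D 0 * (1 / 2) ^ k) \<longlonglongrightarrow> D 0 * 0"
          by (intro tendsto_mult tendsto_const LIMSEQ_power_zero) simp
        then have "eventually (\<lambda>k. D 0 * (1 / 2) ^ k < D t) sequentially"
          using t0 by (intro order_tendstoD(2)) auto
        then obtain N where "\<forall>n\<ge>N. D 0 * (1 / 2) ^ n < D t" by (auto simp: eventually_sequentially)
        then obtain k0 where "D 0 * (1 / 2) ^ (Suc k0) < D t"
          by (metis le_Suc_eq order_refl)
        then have k0: "D 0 / 2 ^ Suc k0 < D t" by (simp add: power_divide)
        \<comment> \<open>Minimality locates \<open>t\<close> in the block between
          \<open>\<tau> k\<close> and \<open>\<tau> (Suc k)\<close>; for \<open>k = 0\<close> the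
          bound \<open>D t \<le> D 0\<close> comes from monotonicity instead.\<close>
        define k where "k = (LEAST k. D 0 / 2 ^ Suc k < D t)"
        have k: "D 0 / 2 ^ Suc k < D t" unfolding k_def by (rule LeastI) (rule k0)
        have "t \<le> \<tau> (Suc k)"
          using k t t0 \<tau>(1)[of "Suc k"] by - (rule D_le, auto simp: \<tau>(2))
        moreover have tk: "D t \<le> D 0 / 2 ^ k \<and> \<tau> k \<le> t \<and> K \<le> k"
        proof -
          have K': "D t \<le> D 0 / 2 ^ K"
            unfolding \<tau>(2)[symmetric] using D_strict[of "\<tau> K" t] t \<tau>(1)[of K] by (cases "\<tau> K = t") auto
          have "K \<le> k"
          proof (rule ccontr)
            assume "\<not> K \<le> k"
            then have "(2::real) ^ Suc k \<le> 2 ^ K" by (intro power_increasing) auto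
            then have "D 0 / 2 ^ K \<le> D 0 / 2 ^ Suc k" using D0 by (intro divide_left_mono) auto
            with K' k show False by simp
          qed
          moreover have "D t \<le> D 0 / 2 ^ k"
          proof (cases k)
            case 0
            then show ?thesis using D_strict[of 0 t] t t0 by (cases "t = 0") auto
          next
            case (Suc j)
            then have "j < k" by simp
            from not_less_Least[OF this[unfolded k_def]] show ?thesis using Suc by simp
          qed
          moreover from this have "\<tau> k \<le> t"
            using t t0 \<tau>(1)[of k] by - (rule D_le, auto simp: \<tau>(2))
          ultimately show ?thesis by simp
        qed
        ultimately have "\<bar>Z t \<omega>\<bar> \<le> l k" using elim(2) K by auto
        then have "\<bar>D t * Z t \<omega>\<bar> \<le> D 0 / 2 ^ k * l k"
          using tk t0 D0 unfolding abs_mult by (intro mult_mono) auto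
        also have "\<dots> = D 0 * (sqrt 3 / 2) ^ k" by (simp add: l_def power_divide)
        also have "\<dots> < \<epsilon>" using K tk by auto
        finally show ?thesis .
      qed
      have "\<tau> K < T" using \<tau>(1)[of K] by simp
      then have "eventually (\<lambda>t. t \<in> {\<tau> K<..<T}) (at_left T)" by (rule eventually_at_left_real)
      then show "\<forall>\<^sub>F t in at_left T. dist (D t * Z t \<omega>) 0 < \<epsilon>"
        by eventually_elim (use bound in \<open>auto simp: dist_real_def\<close>)
    qed
  qed
qed

end

section \<open>The bridge\<close>

lemma tendsto_L2I:
  assumes X: "\<forall>\<^sub>F i in F. sq_integrable M (X i)" and Y: "sq_integrable M Y"
    and b: "\<forall>\<^sub>F i in F. (\<integral>x. (X i x - Y x)\<^sup>2 \<partial>M) \<le> b i" "(b \<longlongrightarrow> 0) F"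
  shows "tendsto_L2 M X Y F"
proof -
  have lim: "((\<lambda>i. ennreal (b i)) \<longlongrightarrow> 0) F" using tendsto_ennrealI[OF b(2)] by simp
  have "((\<lambda>i. \<integral>\<^sup>+x. ennreal ((X i x - Y x)\<^sup>2) \<partial>M) \<longlongrightarrow> 0) F"
  proof (rule tendsto_sandwich[OF _ _ tendsto_const lim])
    show "\<forall>\<^sub>F i in F. (\<integral>\<^sup>+x. ennreal ((X i x - Y x)\<^sup>2) \<partial>M) \<le> ennreal (b i)"
      using X b(1)
    proof eventually_elim
      case (elim i)
      then show ?case using nn_integral_sq[OF sq_integrable_diff[OF elim(1) Y]] by (simp add: ennreal_leI)
    qed
  qed simp
  then show ?thesis using X Y by (simp add: tendsto_L2_def)
qed

text \<open>Handles the degenerate cases of the Markov property, in which the future event is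
  already decided at the present time.\<close>

lemma (in prob_space) real_cond_exp_indicator:
  assumes "subalgebra M G" "A \<in> sets G"
  shows "AE \<omega> in M. real_cond_exp M G (indicator A) \<omega> = indicator A \<omega>"
proof -
  interpret sigma_finite_subalgebra M G by (rule sigma_finite_subalgebraI[OF assms(1)])
  have "A \<in> events" using assms by (auto simp: subalgebra_def)
  then show ?thesis using assms(2)
    by (intro real_cond_exp_F_meas integrable_real_indicator) (auto simp: emeasure_eq_measure)
qed

text \<open>Everything about the extended process that does not depend on the formulas in
  \<open>q\<close>, \<open>\<sigma>\<close> and \<open>r\<close>: a deterministic affine image of
  \<open>Z\<close> whose mean \<open>\<mu>\<close> and factor \<open>e\<close> remain continuous up
  to \<open>T\<close>.\<close>

locale gaussian_bridge = exploding_martingale M Z D T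
  for M :: "'w measure" and Z D T +
  fixes e \<mu> :: "real \<Rightarrow> real" and V :: "real \<Rightarrow> 'w \<Rightarrow> real"
  assumes e_cont: "continuous_on {0..T} e" and e_pos: "\<And>t. t \<in> {0..T} \<Longrightarrow> 0 < e t"
    and \<mu>_cont: "continuous_on {0..T} \<mu>"
    and V_eq: "\<And>t \<omega>. t \<in> {0..<T} \<Longrightarrow> \<omega> \<in> space M \<Longrightarrow> V t \<omega> = \<mu> t + e t * D t * Z t \<omega>"
    and V_T: "\<And>\<omega>. \<omega> \<in> space M \<Longrightarrow> V T \<omega> = \<mu> T"
begin

section \<open>Marginal laws and continuity\<close>

definition g :: "real \<Rightarrow> real" where "g t = e t * D t"

lemma g_cont: "continuous_on {0..T} g"
  unfolding g_def[abs_def] by (intro continuous_on_mult e_cont D_cont)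

lemma g_pos: "t \<in> {0..<T} \<Longrightarrow> 0 < g t"
  using e_pos[of t] D_pos[of t] by (simp add: g_def)

lemma V_g: "t \<in> {0..<T} \<Longrightarrow> \<omega> \<in> space M \<Longrightarrow> V t \<omega> = \<mu> t + g t * Z t \<omega>"
  by (simp add: V_eq g_def)

lemma V_meas: "t \<in> {0..T} \<Longrightarrow> V t \<in> borel_measurable M"
proof (cases "t = T")
  case True
  then show ?thesis using V_T by (subst measurable_cong[of M "V t" "\<lambda>_. \<mu> T"]) auto
next
  case False
  assume "t \<in> {0..T}"
  with False have t: "t \<in> {0..<T}" by auto
  then show ?thesis using V_g by (subst measurable_cong[of M "V t" "\<lambda>\<omega>. \<mu> t + g t * Z t \<omega>"]) auto
qed

lemma V_normal:
  assumes "t \<in> {0..<T}"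
  shows "has_normal_law M (V t) (\<mu> t) ((g t)\<^sup>2 * (1 / D t - 1 / D 0))"
proof (rule has_normal_law_cong_AE)
  show "has_normal_law M (\<lambda>\<omega>. \<mu> t + g t * Z t \<omega>) (\<mu> t) ((g t)\<^sup>2 * (1 / D t - 1 / D 0))"
    using has_normal_law_affine[OF Z_normal[of t], of "\<mu> t" "g t"] assms by simp
  show "AE \<omega> in M. \<mu> t + g t * Z t \<omega> = V t \<omega>" using V_g[OF assms] by (auto intro: AE_I2)
qed (use assms V_meas in auto)

lemma V_sq_integrable: "t \<in> {0..T} \<Longrightarrow> sq_integrable M (V t)"
proof (cases "t = T")
  case True
  have "integrable M (\<lambda>\<omega>. (V t \<omega>)\<^sup>2) \<longleftrightarrow> integrable M (\<lambda>\<omega>. (\<mu> T)\<^sup>2)"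
    using V_T True by (intro Bochner_Integration.integrable_cong) auto
  then show ?thesis using V_meas[of t] True T_pos by (simp add: sq_integrable_def)
next
  case False
  assume "t \<in> {0..T}"
  with False have t: "0 \<le> t" "t < T" by auto
  have "sq_integrable M (\<lambda>_. \<mu> t)" by (simp add: sq_integrable_def)
  from sq_integrable_add[OF this sq_integrable_cmult[OF Z_second_moment(1)[OF t], of "g t"]]
  have s: "sq_integrable M (\<lambda>\<omega>. \<mu> t + g t * Z t \<omega>)" .
  have "integrable M (\<lambda>\<omega>. (V t \<omega>)\<^sup>2) \<longleftrightarrow> integrable M (\<lambda>\<omega>. (\<mu> t + g t * Z t \<omega>)\<^sup>2)"
    using V_g t by (intro Bochner_Integration.integrable_cong) auto
  with s V_meas[of t] t show ?thesis by (simp add: sq_integrable_def)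
qed

text \<open>Before \<open>T\<close> continuity is inherited from \<open>Z\<close>. At
  \<open>T\<close> the random part is the bounded factor \<open>e\<close> times
  \<open>D t * Z t\<close>, which tends to zero.\<close>

lemma V_continuous: "AE \<omega> in M. continuous_on {0..T} (\<lambda>t. V t \<omega>)"
  using Z_cont D_Z_tendsto_0 AE_space
proof eventually_elim
  case (elim \<omega>)
  show ?case
    unfolding continuous_on_def
  proof
    fix t assume t: "t \<in> {0..T}"
    have lim: "(\<mu> \<longlongrightarrow> \<mu> t) (at t within {0..T})" "(g \<longlongrightarrow> g t) (at t within {0..T})" "(e \<longlongrightarrow> e t) (at t within {0..T})"
      using \<mu>_cont g_cont e_cont t by (auto simp: continuous_on_def)
    show "((\<lambda>t. V t \<omega>) \<longlongrightarrow> V t \<omega>) (at t within {0..T})"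
    proof (cases "t = T")
      case True
      have F: "at t within {0..T} = at_left T" using True T_pos by (simp add: at_within_Icc_at_left)
      have "((\<lambda>t. \<mu> t + e t * (D t * Z t \<omega>)) \<longlongrightarrow> \<mu> T + e T * 0) (at_left T)"
        using lim(1,3)[unfolded F] elim(2) unfolding True by (intro tendsto_intros)
      moreover have "eventually (\<lambda>u. u \<in> {0<..<T}) (at_left T)" using T_pos by (rule eventually_at_left_real)
      then have "eventually (\<lambda>u. \<mu> u + e u * (D u * Z u \<omega>) = V u \<omega>) (at_left T)"
        by eventually_elim (use V_eq elim(3) in auto)
      ultimately have "((\<lambda>t. V t \<omega>) \<longlongrightarrow> \<mu> T + e T * 0) (at_left T)"
        by (rule Lim_transform_eventually)
      then show ?thesis unfolding F using True V_T[OF elim(3)] by simp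
    next
      case False
      then have t': "t \<in> {0..<T}" using t by auto
      have F: "at t within {0..T} = at t within {0..<T}"
        using t' by (intro at_within_nhd[of _ "{..<T}"]) auto
      have "((\<lambda>u. \<mu> u + g u * Z u \<omega>) \<longlongrightarrow> \<mu> t + g t * Z t \<omega>) (at t within {0..T})"
        using lim elim(1) t' unfolding F continuous_on_def by (intro tendsto_intros) auto
      moreover have "eventually (\<lambda>u. \<mu> u + g u * Z u \<omega> = V u \<omega>) (at t within {0..T})"
        unfolding F using V_g[OF _ elim(3)] by (auto simp: eventually_at_filter)
      ultimately show ?thesis unfolding V_g[OF t' elim(3)] by (rule Lim_transform_eventually)
    qed
  qed
qed

text \<open>The mean square distance is dominated by an explicit deterministic function that is
  continuous and vanishes at \<open>t\<close>. At \<open>T\<close> there is no \<open>Z T\<close> to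
  compare with, so this case has its own bound.\<close>

lemma V_L2_continuous:
  assumes t: "t \<in> {0..T}"
  shows "tendsto_L2 M V (V t) (at t within {0..T})"
proof -
  let ?F = "at t within {0..T}"
  have lim: "(\<mu> \<longlongrightarrow> \<mu> t) ?F" "(g \<longlongrightarrow> g t) ?F" "(e \<longlongrightarrow> e t) ?F" "(D \<longlongrightarrow> D t) ?F"
    using \<mu>_cont g_cont e_cont D_cont t by (auto simp: continuous_on_def)
  have in_I: "\<forall>\<^sub>F u in ?F. u \<in> {0..T}" by (auto simp: eventually_at_filter)
  then have sq: "\<forall>\<^sub>F u in ?F. sq_integrable M (V u)" by eventually_elim (rule V_sq_integrable)
  show ?thesis
  proof (cases "t = T")
    case True
    \<comment> \<open>The random part has second moment
      \<open>(g u)\<^sup>2 * (1 / D u - 1 / D 0)\<close>; here the singular factor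
      \<open>1 / D u\<close> is cancelled against \<open>g u = e u * D u\<close>.\<close>
    define bd where "bd u = 2 * (\<mu> u - \<mu> T)\<^sup>2 + 2 * ((e u)\<^sup>2 * D u * (1 - D u / D 0))" for u
    have "eventually (\<lambda>u. u \<in> {0<..<T}) ?F"
      using eventually_at_left_real[OF T_pos] unfolding True by (simp only: at_within_Icc_at_left[OF T_pos])
    then have bound: "\<forall>\<^sub>F u in ?F. expectation (\<lambda>\<omega>. (V u \<omega> - V t \<omega>)\<^sup>2) \<le> bd u"
    proof eventually_elim
      case (elim u)
      then have u: "0 \<le> u" "u < T" by auto
      have i: "integrable M (\<lambda>\<omega>. (Z u \<omega>)\<^sup>2)" using Z_second_moment(1)[OF u] by (simp add: sq_integrable_def)
      have "expectation (\<lambda>\<omega>. (V u \<omega> - V t \<omega>)\<^sup>2) \<le> expectation (\<lambda>\<omega>. 2 * (\<mu> u - \<mu> T)\<^sup>2 + 2 * (g u)\<^sup>2 * (Z u \<omega>)\<^sup>2)"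
      proof (rule integral_mono)
        show "integrable M (\<lambda>\<omega>. (V u \<omega> - V t \<omega>)\<^sup>2)"
          using sq_integrable_diff[OF V_sq_integrable[of u] V_sq_integrable[OF t]] u by (simp add: sq_integrable_def)
        show "integrable M (\<lambda>\<omega>. 2 * (\<mu> u - \<mu> T)\<^sup>2 + 2 * (g u)\<^sup>2 * (Z u \<omega>)\<^sup>2)" using i by simp
        fix \<omega> assume \<omega>: "\<omega> \<in> space M"
        have "(V u \<omega> - V t \<omega>)\<^sup>2 = ((\<mu> u - \<mu> T) + g u * Z u \<omega>)\<^sup>2"
          using V_g[of u \<omega>] V_T[OF \<omega>] u \<omega> True by (simp add: algebra_simps)
        also have "\<dots> \<le> 2 * (\<mu> u - \<mu> T)\<^sup>2 + 2 * (g u * Z u \<omega>)\<^sup>2"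
          using sum_squares_bound[of "\<mu> u - \<mu> T" "g u * Z u \<omega>"] by (simp add: power2_sum)
        finally show "(V u \<omega> - V t \<omega>)\<^sup>2 \<le> 2 * (\<mu> u - \<mu> T)\<^sup>2 + 2 * (g u)\<^sup>2 * (Z u \<omega>)\<^sup>2"
          by (simp add: power_mult_distrib)
      qed
      also have "\<dots> = 2 * (\<mu> u - \<mu> T)\<^sup>2 + 2 * (g u)\<^sup>2 * (1 / D u - 1 / D 0)"
        using i Z_second_moment(2)[OF u] by (simp add: prob_space)
      also have "\<dots> = bd u"
        using D_pos[OF u] by (simp add: bd_def g_def power2_eq_square field_simps)
      finally show ?case .
    qed
    have "(bd \<longlongrightarrow> 2 * (\<mu> T - \<mu> T)\<^sup>2 + 2 * ((e T)\<^sup>2 * D T * (1 - D T / D 0))) ?F"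
      unfolding bd_def using lim D_pos[of 0] T_pos unfolding True by (intro tendsto_intros) auto
    then have "(bd \<longlongrightarrow> 0) ?F" by (simp add: D_T)
    from tendsto_L2I[OF sq V_sq_integrable[OF t] bound this] show ?thesis .
  next
    case False
    then have t': "0 \<le> t" "t < T" using t by auto
    \<comment> \<open>The three terms stem from the change of the mean, of the factor
      \<open>g\<close> and of \<open>Z\<close>, with 3 from the bound for the square of a sum of
      three terms. The absolute value allows \<open>u\<close> on either side of
      \<open>t\<close>.\<close>
    define bd where "bd u = 3 * (\<mu> u - \<mu> t)\<^sup>2 + 3 * (g u - g t)\<^sup>2 * (1 / D t - 1 / D 0) + 3 * (g u)\<^sup>2 * \<bar>1 / D u - 1 / D t\<bar>" for u
    have "eventually (\<lambda>u. u \<in> {..<T}) ?F"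
      using t' by (intro eventually_at_topological[THEN iffD2] exI[of _ "{..<T}"]) auto
    with in_I have bound: "\<forall>\<^sub>F u in ?F. expectation (\<lambda>\<omega>. (V u \<omega> - V t \<omega>)\<^sup>2) \<le> bd u"
    proof eventually_elim
      case (elim u)
      then have u: "0 \<le> u" "u < T" by auto
      have i: "integrable M (\<lambda>\<omega>. (Z t \<omega>)\<^sup>2)" using Z_second_moment(1)[OF t'] by (simp add: sq_integrable_def)
      have d: "integrable M (\<lambda>\<omega>. (Z u \<omega> - Z t \<omega>)\<^sup>2) \<and> expectation (\<lambda>\<omega>. (Z u \<omega> - Z t \<omega>)\<^sup>2) \<le> \<bar>1 / D u - 1 / D t\<bar>"
      proof (cases "t \<le> u")
        case True
        then show ?thesis using has_normal_law_second_moment[OF Z_normal_diff[OF t'(1) True u(2)]] by simp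
      next
        case False
        then have "u \<le> t" by simp
        from has_normal_law_second_moment[OF Z_normal_diff[OF u(1) this t'(2)]]
        show ?thesis by (simp add: power2_commute[of "Z u _"])
      qed
      have "expectation (\<lambda>\<omega>. (V u \<omega> - V t \<omega>)\<^sup>2) \<le>
        expectation (\<lambda>\<omega>. 3 * (\<mu> u - \<mu> t)\<^sup>2 + 3 * (g u - g t)\<^sup>2 * (Z t \<omega>)\<^sup>2 + 3 * (g u)\<^sup>2 * (Z u \<omega> - Z t \<omega>)\<^sup>2)"
      proof (rule integral_mono)
        show "integrable M (\<lambda>\<omega>. (V u \<omega> - V t \<omega>)\<^sup>2)"
          using sq_integrable_diff[OF V_sq_integrable[of u] V_sq_integrable[OF t]] u by (simp add: sq_integrable_def)
        show "integrable M (\<lambda>\<omega>. 3 * (\<mu> u - \<mu> t)\<^sup>2 + 3 * (g u - g t)\<^sup>2 * (Z t \<omega>)\<^sup>2 + 3 * (g u)\<^sup>2 * (Z u \<omega> - Z t \<omega>)\<^sup>2)"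
          using i d by simp
        fix \<omega> assume \<omega>: "\<omega> \<in> space M"
        have le: "(x + y + z)\<^sup>2 \<le> 3 * x\<^sup>2 + 3 * y\<^sup>2 + 3 * z\<^sup>2" for x y z :: real
          using sum_squares_bound[of x y] sum_squares_bound[of y z] sum_squares_bound[of x z]
          by (simp add: power2_eq_square algebra_simps)
        have "V u \<omega> - V t \<omega> = (\<mu> u - \<mu> t) + (g u - g t) * Z t \<omega> + g u * (Z u \<omega> - Z t \<omega>)"
          using V_g[of u \<omega>] V_g[of t \<omega>] u t' \<omega> by (simp add: algebra_simps)
        then show "(V u \<omega> - V t \<omega>)\<^sup>2 \<le> 3 * (\<mu> u - \<mu> t)\<^sup>2 + 3 * (g u - g t)\<^sup>2 * (Z t \<omega>)\<^sup>2 + 3 * (g u)\<^sup>2 * (Z u \<omega> - Z t \<omega>)\<^sup>2"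
          using le[of "\<mu> u - \<mu> t" "(g u - g t) * Z t \<omega>" "g u * (Z u \<omega> - Z t \<omega>)"] by (simp add: power_mult_distrib)
      qed
      also have "\<dots> = 3 * (\<mu> u - \<mu> t)\<^sup>2 + 3 * (g u - g t)\<^sup>2 * (1 / D t - 1 / D 0) + 3 * (g u)\<^sup>2 * expectation (\<lambda>\<omega>. (Z u \<omega> - Z t \<omega>)\<^sup>2)"
        using i d Z_second_moment(2)[OF t'] by (simp add: prob_space)
      also have "\<dots> \<le> bd u"
        unfolding bd_def using d by (intro add_left_mono mult_left_mono) auto
      finally show ?case .
    qed
    have "(bd \<longlongrightarrow> 3 * (\<mu> t - \<mu> t)\<^sup>2 + 3 * (g t - g t)\<^sup>2 * (1 / D t - 1 / D 0) + 3 * (g t)\<^sup>2 * \<bar>1 / D t - 1 / D t\<bar>) ?F"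
      unfolding bd_def using lim D_pos[OF t'] by (intro tendsto_intros) auto
    then have "(bd \<longlongrightarrow> 0) ?F" by simp
    from tendsto_L2I[OF sq V_sq_integrable[OF t] bound this] show ?thesis .
  qed
qed

section \<open>Gauss and Markov properties\<close>

lemma V_gauss: "gauss_process M {0..T} V"
  unfolding gauss_process_def
proof (intro allI impI)
  fix J c assume J: "finite J \<and> J \<subseteq> {0..T}"
  \<comment> \<open>Time \<open>T\<close> contributes only the constant
    \<open>c T * \<mu> T\<close>, so the random part is a linear combination of \<open>Z\<close> at
    earlier times.\<close>
  define J' where "J' = J - {T}"
  have J': "finite J'" "J' \<subseteq> {0..<T}" using J by (auto simp: J'_def)
  obtain v where v: "has_normal_law M (\<lambda>\<omega>. \<Sum>t\<in>J'. (c t * g t) * Z t \<omega>) 0 v"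
    using Z_linear_combination_normal[OF J', of "\<lambda>t. c t * g t"] by blast
  have "has_normal_law M (\<lambda>\<omega>. \<Sum>t\<in>J. c t * V t \<omega>) (\<Sum>t\<in>J. c t * \<mu> t) v"
  proof (rule has_normal_law_cong_AE)
    show "has_normal_law M (\<lambda>\<omega>. (\<Sum>t\<in>J. c t * \<mu> t) + 1 * (\<Sum>t\<in>J'. (c t * g t) * Z t \<omega>)) (\<Sum>t\<in>J. c t * \<mu> t) v"
      using has_normal_law_affine[OF v, of "\<Sum>t\<in>J. c t * \<mu> t" 1] by simp
    show "(\<lambda>\<omega>. \<Sum>t\<in>J. c t * V t \<omega>) \<in> borel_measurable M"
      using J V_meas by (intro borel_measurable_sum borel_measurable_times) auto
    show "AE \<omega> in M. (\<Sum>t\<in>J. c t * \<mu> t) + 1 * (\<Sum>t\<in>J'. (c t * g t) * Z t \<omega>) = (\<Sum>t\<in>J. c t * V t \<omega>)"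
    proof (rule AE_I2)
      fix \<omega> assume \<omega>: "\<omega> \<in> space M"
      have "(\<Sum>t\<in>J'. (c t * g t) * Z t \<omega>) = (\<Sum>t\<in>J. c t * (V t \<omega> - \<mu> t))"
      proof (rule sum.mono_neutral_cong_left)
        show "\<forall>i\<in>J - J'. c i * (V i \<omega> - \<mu> i) = 0" using V_T[OF \<omega>] by (auto simp: J'_def)
        show "(c t * g t) * Z t \<omega> = c t * (V t \<omega> - \<mu> t)" if "t \<in> J'" for t
          using V_g[of t \<omega>] J' that \<omega> by auto
      qed (use J in \<open>auto simp: J'_def\<close>)
      then show "(\<Sum>t\<in>J. c t * \<mu> t) + 1 * (\<Sum>t\<in>J'. (c t * g t) * Z t \<omega>) = (\<Sum>t\<in>J. c t * V t \<omega>)"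
        by (simp add: right_diff_distrib sum_subtractf)
    qed
  qed
  then show "\<exists>\<mu> v. has_normal_law M (\<lambda>\<omega>. \<Sum>t\<in>J. c t * V t \<omega>) \<mu> v" by blast
qed

text \<open>\<open>V t\<close> is an affine function of \<open>V s\<close> plus the independent
  noise \<open>g t * (Z t - Z s)\<close>. The sigma-algebra \<open>G\<close> is left open so that
  the same kernel is obtained for the full past of \<open>V\<close> and for \<open>V s\<close>
  alone.\<close>

lemma V_cond_prob:
  assumes st: "0 \<le> s" "s < t" "t < T" and G: "subalgebra M G" "sets G \<subseteq> sets (filt s)"
    and Vs: "V s \<in> borel_measurable G" and A: "A \<in> sets borel"
  shows "AE \<omega> in M. real_cond_exp M G (indicator (V t -` A \<inter> space M)) \<omega> =
    (LINT y:A|lborel. normal_density (\<mu> t + g t / g s * (V s \<omega> - \<mu> s)) (sqrt ((g t)\<^sup>2 * (1 / D t - 1 / D s))) y)"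
proof (rule cond_prob_indep_normal[OF G(1) _ _ _ _ A])
  show "(\<lambda>\<omega>. \<mu> t + g t / g s * (V s \<omega> - \<mu> s)) \<in> borel_measurable G"
    using Vs by measurable
  have le: "s \<le> t" using st by simp
  have "(\<lambda>\<omega>. g t * (Z t \<omega> - Z s \<omega>)) -` C \<inter> space M = (\<lambda>\<omega>. Z t \<omega> - Z s \<omega>) -` ((\<lambda>x. g t * x) -` C) \<inter> space M" for C
    by auto
  moreover have "(\<lambda>x. g t * x) -` C \<in> sets borel" if "C \<in> sets borel" for C
    using measurable_sets[of "\<lambda>x. g t * x" borel borel C] that by simp
  ultimately show "indep_of M G (\<lambda>\<omega>. g t * (Z t \<omega> - Z s \<omega>))"
    using Z_indep[OF st(1) le st(3)] G(2) unfolding indep_of_def by auto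
  show "has_normal_law M (\<lambda>\<omega>. g t * (Z t \<omega> - Z s \<omega>)) 0 ((g t)\<^sup>2 * (1 / D t - 1 / D s))"
    using has_normal_law_affine[OF Z_normal_diff[OF st(1) le st(3)], of 0 "g t"] by simp
  have "1 / D s < 1 / D t"
    using D_strict[of s t] D_pos[of t] st by (intro divide_strict_left_mono) auto
  then show "0 < (g t)\<^sup>2 * (1 / D t - 1 / D s)" using g_pos[of t] st by simp
  show "V t \<omega> = \<mu> t + g t / g s * (V s \<omega> - \<mu> s) + g t * (Z t \<omega> - Z s \<omega>)" if "\<omega> \<in> space M" for \<omega>
    using V_g[of t \<omega>] V_g[of s \<omega>] g_pos[of s] st that by (simp add: algebra_simps)
qed

lemma V_filt:
  assumes "u \<in> {0..<T}" "u \<le> s"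
  shows "V u \<in> borel_measurable (filt s)"
proof -
  have "(\<lambda>\<omega>. \<mu> u + g u * Z u \<omega>) \<in> borel_measurable (filt s)"
    using Z_filt[of u s] assms by simp
  then show ?thesis using V_g[OF assms(1)] by (subst measurable_cong) auto
qed

lemma natural_filtration_V_subset:
  assumes "s < T" "I \<subseteq> {0..T}"
  shows "sets (natural_filtration M I V s) \<subseteq> sets (filt s)"
proof (subst sets_natural_filtration)
  show "sigma_sets (space M) {V u -` A \<inter> space M |u A. u \<in> I \<and> u \<le> s \<and> A \<in> sets borel} \<subseteq> sets (filt s)"
  proof -
    have "V u -` A \<inter> space M \<in> sets (filt s)" if "u \<in> I" "u \<le> s" "A \<in> sets borel" for u A
    proof -
      have "u \<in> {0..<T}" using that assms by force
      from measurable_sets[OF V_filt[OF this that(2)] that(3)] show ?thesis by simp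
    qed
    then have "{V u -` A \<inter> space M |u A. u \<in> I \<and> u \<le> s \<and> A \<in> sets borel} \<subseteq> sets (filt s)"
      by blast
    from sets.sigma_sets_subset[OF this] show ?thesis by simp
  qed
qed (use V_meas assms in auto)

text \<open>For \<open>s < t < T\<close> both conditional probabilities equal the same function of
  \<open>V s\<close>.\<close>

lemma V_markov: "markov_process M {0..T} V"
  unfolding markov_process_def
proof (intro conjI ballI impI)
  fix s t and A :: "real set" assume s: "s \<in> {0..T}" and t: "t \<in> {0..T}" and st: "s \<le> t" and A: "A \<in> sets borel"
  let ?G = "natural_filtration M {0..T} V s" and ?H = "vimage_algebra (space M) (V s) borel"
  let ?B = "V t -` A \<inter> space M"
  have G: "subalgebra M ?G" by (rule subalgebra_natural_filtration) (rule V_meas)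
  have VG: "V s \<in> borel_measurable ?G" by (rule measurable_natural_filtration) (use s V_meas in auto)
  have VH: "V s \<in> borel_measurable ?H" by (rule measurable_vimage_algebra1) simp
  have HG: "sets ?H \<subseteq> sets ?G"
  proof
    fix B assume "B \<in> sets ?H"
    then obtain C where "C \<in> sets borel" "B = V s -` C \<inter> space M" by (auto simp: sets_vimage_algebra2)
    then show "B \<in> sets ?G" using measurable_sets[OF VG, of C] by simp
  qed
  then have H: "subalgebra M ?H" using G by (auto simp: subalgebra_def)
  show "AE \<omega> in M. real_cond_exp M ?G (indicator ?B) \<omega> = real_cond_exp M ?H (indicator ?B) \<omega>"
  proof (cases "s < t \<and> t < T")
    case True
    then have st': "0 \<le> s" "s < t" "t < T" using s by auto
    have GF: "sets ?G \<subseteq> sets (filt s)" using True by (intro natural_filtration_V_subset) auto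
    from V_cond_prob[OF st' G GF VG A] V_cond_prob[OF st' H order_trans[OF HG GF] VH A]
    show ?thesis by eventually_elim simp
  next
    case False
    \<comment> \<open>If \<open>t = T\<close> the value is deterministic, and if
      \<open>t = s\<close> the event is determined by \<open>V s\<close>; either way conditioning
      returns the indicator itself.\<close>
    have "?B \<in> sets ?H"
    proof (cases "t = T")
      case True
      then have "?B = (if \<mu> T \<in> A then space M else {})" using V_T by auto
      moreover have "space M \<in> sets ?H" using sets.top[of ?H] by simp
      ultimately show ?thesis by simp
    next
      case False
      with \<open>\<not> (s < t \<and> t < T)\<close> st t have "s = t" by auto
      then show ?thesis using measurable_sets[OF VH A] by simp
    qed
    with HG have "?B \<in> sets ?H" "?B \<in> sets ?G" by auto
    from real_cond_exp_indicator[OF H this(1)] real_cond_exp_indicator[OF G this(2)]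
    show ?thesis by eventually_elim simp
  qed
qed (rule V_meas)

end

lemma has_transition_density_cong:
  assumes "has_transition_density M I X p"
    and "\<And>s t x y. s \<in> I \<Longrightarrow> t \<in> I \<Longrightarrow> s < t \<Longrightarrow> p s t x y = p' s t x y"
  shows "has_transition_density M I X p'"
proof -
  have eq: "p s t = p' s t" if "s \<in> I" "t \<in> I" "s < t" for s t
    using assms(2)[OF that] by (intro ext)
  show ?thesis
    using assms(1) unfolding has_transition_density_def by (simp add: eq)
qed

section \<open>Transition densities\<close>

context gaussian_bridge
begin

text \<open>Restricted to times before \<open>T\<close>, since \<open>V T\<close> is constant and
  its law has no density. Before \<open>T\<close> strict monotonicity of \<open>D\<close> makes all
  transition variances positive.\<close>

lemma V_transition_density:
  "has_transition_density M {0..<T} V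
     (\<lambda>s t x y. normal_density (\<mu> t + g t / g s * (x - \<mu> s)) (sqrt ((g t)\<^sup>2 * (1 / D t - 1 / D s))) y)"
  unfolding has_transition_density_def
proof (intro conjI ballI impI allI)
  show "V t \<in> borel_measurable M" if "t \<in> {0..<T}" for t using that by (intro V_meas) auto
  have v_pos: "0 < (g t)\<^sup>2 * (1 / D t - 1 / D s)" if "s \<in> {0..<T}" "t \<in> {0..<T}" "s < t" for s t
  proof -
    have "1 / D s < 1 / D t"
      using D_strict[of s t] D_pos[of t] that by (intro divide_strict_left_mono) auto
    then show ?thesis using g_pos[of t] that by simp
  qed
  {
    fix s t assume s: "s \<in> {0..<T}" and t: "t \<in> {0..<T}" and st: "s < t"
    note v = v_pos[OF s t st]
    show "(\<lambda>(x, y). normal_density (\<mu> t + g t / g s * (x - \<mu> s)) (sqrt ((g t)\<^sup>2 * (1 / D t - 1 / D s))) y)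
      \<in> borel_measurable (borel \<Otimes>\<^sub>M borel)"
      unfolding normal_density_def by measurable
    show "0 \<le> normal_density (\<mu> t + g t / g s * (x - \<mu> s)) (sqrt ((g t)\<^sup>2 * (1 / D t - 1 / D s))) y" for x y
      by simp
    show "(\<integral>\<^sup>+y. ennreal (normal_density (\<mu> t + g t / g s * (x - \<mu> s)) (sqrt ((g t)\<^sup>2 * (1 / D t - 1 / D s))) y) \<partial>lborel) = 1" for x
      using v by (subst nn_integral_eq_integral) auto
    fix A :: "real set" assume A: "A \<in> sets borel"
    have G: "subalgebra M (natural_filtration M {0..<T} V s)"
      by (rule subalgebra_natural_filtration) (auto intro: V_meas)
    have VG: "V s \<in> borel_measurable (natural_filtration M {0..<T} V s)"
      by (rule measurable_natural_filtration) (use s V_meas in auto)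
    have GF: "sets (natural_filtration M {0..<T} V s) \<subseteq> sets (filt s)"
      using s by (intro natural_filtration_V_subset) auto
    show "AE \<omega> in M. real_cond_exp M (natural_filtration M {0..<T} V s) (indicator (V t -` A \<inter> space M)) \<omega> =
        (LINT y:A|lborel. normal_density (\<mu> t + g t / g s * (V s \<omega> - \<mu> s)) (sqrt ((g t)\<^sup>2 * (1 / D t - 1 / D s))) y)"
      using s t st by (intro V_cond_prob G GF VG A) auto
  }
  fix s u t x assume s: "s \<in> {0..<T}" and u: "u \<in> {0..<T}" and t: "t \<in> {0..<T}" and "s < u \<and> u < t"
  then have su: "s < u" and ut: "u < t" by auto
  have gp: "0 < g s" "0 < g u" "0 < g t" using s u t by (auto intro: g_pos)
  let ?m = "\<mu> u + g u / g s * (x - \<mu> s)" and ?v = "(g u)\<^sup>2 * (1 / D u - 1 / D s)" and ?w = "(g t)\<^sup>2 * (1 / D t - 1 / D u)"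
  show "AE y in lborel. ennreal (normal_density (\<mu> t + g t / g s * (x - \<mu> s)) (sqrt ((g t)\<^sup>2 * (1 / D t - 1 / D s))) y) =
    (\<integral>\<^sup>+z. ennreal (normal_density ?m (sqrt ?v) z * normal_density (\<mu> t + g t / g u * (z - \<mu> u)) (sqrt ?w) y) \<partial>lborel)"
  proof (rule AE_I2)
    fix y
    have lin: "\<mu> t + g t / g u * (z - \<mu> u) = (\<mu> t - g t / g u * \<mu> u) + g t / g u * z" for z
      by (simp add: right_diff_distrib)
    have "(\<integral>\<^sup>+z. ennreal (normal_density ?m (sqrt ?v) z * normal_density (\<mu> t + g t / g u * (z - \<mu> u)) (sqrt ?w) y) \<partial>lborel) =
      (\<integral>\<^sup>+z. ennreal (normal_density ?m (sqrt ?v) z * normal_density ((\<mu> t - g t / g u * \<mu> u) + g t / g u * z) (sqrt ?w) y) \<partial>lborel)"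
      unfolding lin ..
    also have "\<dots> = ennreal (normal_density ((\<mu> t - g t / g u * \<mu> u) + g t / g u * ?m) (sqrt ((g t / g u)\<^sup>2 * ?v + ?w)) y)"
      using gp v_pos[OF s u su] v_pos[OF u t ut] by (intro normal_kernel_convolution) auto
    \<comment> \<open>The slopes multiply to \<open>g t / g s\<close>, and the rescaled variances
      add up because they are increments of the clock \<open>1 / D\<close>.\<close>
    also have "(\<mu> t - g t / g u * \<mu> u) + g t / g u * ?m = \<mu> t + g t / g s * (x - \<mu> s)"
      using gp by (simp add: field_simps)
    also have "(g t / g u)\<^sup>2 * ?v + ?w = (g t)\<^sup>2 * (1 / D t - 1 / D s)"
      using gp by (simp add: power_divide algebra_simps)
    finally show "ennreal (normal_density (\<mu> t + g t / g s * (x - \<mu> s)) (sqrt ((g t)\<^sup>2 * (1 / D t - 1 / D s))) y) =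
      (\<integral>\<^sup>+z. ennreal (normal_density ?m (sqrt ?v) z * normal_density (\<mu> t + g t / g u * (z - \<mu> u)) (sqrt ?w) y) \<partial>lborel)" ..
  qed
qed

end

section \<open>The coefficients\<close>

locale bridge_coeffs =
  fixes q \<sigma> r :: "real \<Rightarrow> real" and T :: real
  assumes q_cont: "continuous_on {0..} q" and \<sigma>_cont: "continuous_on {0..} \<sigma>"
    and r_cont: "continuous_on {0..} r"
    and \<sigma>_nz: "\<And>t. 0 \<le> t \<Longrightarrow> \<sigma> t \<noteq> 0" and T_pos: "0 < T"
begin

definition E :: "real \<Rightarrow> real" where "E t = exp (qbar q t)"
definition \<psi> :: "real \<Rightarrow> real" where "\<psi> t = integral {0..t} (\<lambda>u. (\<sigma> u)\<^sup>2 / (E u)\<^sup>2)"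
definition D :: "real \<Rightarrow> real" where "D t = \<psi> T - \<psi> t"
text \<open>The drift discounted by \<open>E\<close>; both drift integrals in the bridge mean become
  \<open>E\<close> times an increment of \<open>R\<close>.\<close>

definition R :: "real \<Rightarrow> real" where "R t = integral {0..t} (\<lambda>u. r u / E u)"
definition h :: "real \<Rightarrow> real" where "h u = \<sigma> u / (E u * D u)"

section \<open>Regularity and monotonicity of the coefficient functions\<close>

lemma E_pos [simp]: "0 < E t" "E t \<noteq> 0" by (simp_all add: E_def)

lemma E_0: "E 0 = 1" by (simp add: E_def qbar_def)

lemma E_cont: "continuous_on {0..T} E"
proof -
  have "continuous_on {0..T} q" using q_cont by (rule continuous_on_subset) auto
  then have "continuous_on {0..T} (qbar q)"
    unfolding qbar_def[abs_def] by (intro indefinite_integral_continuous_1 integrable_continuous_interval)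
  then show ?thesis unfolding E_def[abs_def] by (intro continuous_intros)
qed

lemma psi'_cont: "continuous_on {0..T} (\<lambda>u. (\<sigma> u)\<^sup>2 / (E u)\<^sup>2)"
  by (intro continuous_intros E_cont continuous_on_subset[OF \<sigma>_cont]) auto

lemma R'_cont: "continuous_on {0..T} (\<lambda>u. r u / E u)"
  by (intro continuous_intros E_cont continuous_on_subset[OF r_cont]) auto

lemma D_cont: "continuous_on {0..T} D"
  unfolding D_def[abs_def] \<psi>_def[abs_def]
  by (intro continuous_intros indefinite_integral_continuous_1 integrable_continuous_interval psi'_cont)

lemma R_cont: "continuous_on {0..T} R"
  unfolding R_def[abs_def]
  by (intro indefinite_integral_continuous_1 integrable_continuous_interval R'_cont)

lemma D_deriv:
  assumes "t \<in> {0..T}"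
  shows "(D has_real_derivative - ((\<sigma> t)\<^sup>2 / (E t)\<^sup>2)) (at t within {0..T})"
proof -
  have "(\<psi> has_real_derivative (\<sigma> t)\<^sup>2 / (E t)\<^sup>2) (at t within {0..T})"
    unfolding \<psi>_def[abs_def] using integral_has_real_derivative[OF psi'_cont assms] .
  then show ?thesis unfolding D_def[abs_def] by (auto intro!: derivative_eq_intros)
qed

lemma D_T: "D T = 0" by (simp add: D_def)

text \<open>The derivative of \<open>D\<close> is \<open>- \<sigma>\<^sup>2 / E\<^sup>2\<close>,
  strictly negative because \<open>\<sigma>\<close> has no zero.\<close>

lemma D_strict:
  assumes "0 \<le> s" "s < t" "t \<le> T"
  shows "D t < D s"
proof -
  have "- D s < - D t"
  proof (rule DERIV_pos_imp_increasing_open[OF assms(2)])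
    fix x assume x: "s < x" "x < t"
    then have "(D has_real_derivative - ((\<sigma> x)\<^sup>2 / (E x)\<^sup>2)) (at x)"
      using D_deriv[of x] assms by (simp add: at_within_Icc_at)
    then have "((\<lambda>x. - D x) has_real_derivative (\<sigma> x)\<^sup>2 / (E x)\<^sup>2) (at x)"
      by (auto intro!: derivative_eq_intros)
    moreover have "0 < (\<sigma> x)\<^sup>2 / (E x)\<^sup>2" using \<sigma>_nz[of x] x assms by simp
    ultimately show "\<exists>y. ((\<lambda>x. - D x) has_real_derivative y) (at x) \<and> 0 < y" by blast
  next
    show "continuous_on {s..t} (\<lambda>x. - D x)"
      using D_cont assms by (intro continuous_on_minus continuous_on_subset[OF D_cont]) auto
  qed
  then show ?thesis by simp
qed

lemma D_pos: "0 \<le> t \<Longrightarrow> t < T \<Longrightarrow> 0 < D t"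
  using D_strict[of t T] D_T by simp

section \<open>Closed forms of the bridge coefficients\<close>

lemma gam_eq:
  assumes "0 \<le> s" "s \<le> t" "t \<le> T"
  shows "gam q \<sigma> s t = (E t)\<^sup>2 * (D s - D t)"
proof -
  have "(\<lambda>u. (\<sigma> u)\<^sup>2 / (E u)\<^sup>2) integrable_on {0..t}"
    using assms by (intro integrable_continuous_interval continuous_on_subset[OF psi'_cont]) auto
  from Henstock_Kurzweil_Integration.integral_combine[OF assms(1,2) this]
  have "integral {s..t} (\<lambda>u. (\<sigma> u)\<^sup>2 / (E u)\<^sup>2) = D s - D t" by (simp add: D_def \<psi>_def)
  moreover have "exp (2 * (qbar q t - qbar q u)) * (\<sigma> u)\<^sup>2 = (E t)\<^sup>2 * ((\<sigma> u)\<^sup>2 / (E u)\<^sup>2)" for u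
    by (simp add: E_def exp_double exp_diff power_divide)
  ultimately show ?thesis by (simp only: gam_def integral_mult_right)
qed

lemma drift_integral:
  assumes "0 \<le> s" "s \<le> t" "t \<le> T"
  shows "integral {s..t} (\<lambda>u. exp (qbar q t - qbar q u) * r u) = E t * (R t - R s)"
proof -
  have "(\<lambda>u. r u / E u) integrable_on {0..t}"
    using assms by (intro integrable_continuous_interval continuous_on_subset[OF R'_cont]) auto
  from Henstock_Kurzweil_Integration.integral_combine[OF assms(1,2) this]
  have "integral {s..t} (\<lambda>u. r u / E u) = R t - R s" by (simp add: R_def)
  moreover have "exp (qbar q t - qbar q u) * r u = E t * (r u / E u)" for u
    by (simp add: E_def exp_diff)
  ultimately show ?thesis by (simp only: integral_mult_right)
qed

text \<open>After division by \<open>E t\<close> and subtraction of \<open>R t\<close> the mean is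
  affine in \<open>D t\<close>: it equals \<open>x / E s - R s\<close> at time \<open>s\<close> and
  \<open>b / E T - R T\<close> at time \<open>T\<close>, where \<open>D\<close> vanishes.\<close>

lemma bridge_mean_eq:
  assumes "0 \<le> s" "s \<le> t" "t \<le> T" "s < T"
  shows "bridge_mean q \<sigma> r T x b s t =
    E t * (R t + (b / E T - R T) + D t / D s * (x / E s - R s - (b / E T - R T)))"
proof -
  have Ds: "D s \<noteq> 0" using D_pos[of s] assms by simp
  have g: "gam q \<sigma> s t = (E t)\<^sup>2 * (D s - D t)" "gam q \<sigma> s T = (E T)\<^sup>2 * D s" "gam q \<sigma> t T = (E T)\<^sup>2 * D t"
    using assms by (simp_all add: gam_eq D_T)
  have i: "integral {t..T} (\<lambda>u. exp (qbar q T - qbar q u) * r u) = E T * (R T - R t)"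
    "integral {s..t} (\<lambda>u. exp (qbar q t - qbar q u) * r u) = E t * (R t - R s)"
    using assms by (simp_all add: drift_integral)
  have x: "exp (qbar q T - qbar q t) = E T / E t" "exp (qbar q t - qbar q s) = E t / E s"
    by (simp_all add: E_def exp_diff)
  have "bridge_mean q \<sigma> r T x b s t =
    (E t)\<^sup>2 * (D s - D t) / ((E T)\<^sup>2 * D s) * (E T / E t) * (b - E T * (R T - R t)) +
    (E T)\<^sup>2 * D t / ((E T)\<^sup>2 * D s) * (E t / E s * x + E t * (R t - R s))"
    unfolding bridge_mean_def mean_fn_def g i x ..
  also have "\<dots> = E t * ((1 - D t / D s) * (b / E T - R T + R t)) + E t * (D t / D s * (x / E s + R t - R s))"
    using Ds by (simp add: power2_eq_square field_simps)
  also have "\<dots> = E t * (R t + (b / E T - R T) + D t / D s * (x / E s - R s - (b / E T - R T)))"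
  proof -
    \<comment> \<open>Stated for fresh variables, so that the quotients are treated as
      atoms.\<close>
    have "e * ((1 - k) * (\<beta> + p)) + e * (k * (y + p - z)) = e * (p + \<beta> + k * (y - z - \<beta>))"
      for e k \<beta> p y z :: real by (simp add: algebra_simps)
    then show ?thesis .
  qed
  finally show ?thesis .
qed

text \<open>The right side is the variance of \<open>E t * D t\<close> times the increment of
  \<open>Z\<close> from \<open>s\<close> to \<open>t\<close>, the form in which the variance appears
  in the abstract bridge.\<close>

lemma bridge_var_eq:
  assumes "0 \<le> s" "s \<le> t" "t < T"
  shows "bridge_var q \<sigma> T s t = (E t * D t)\<^sup>2 * (1 / D t - 1 / D s)"
proof -
  have nz: "D s \<noteq> 0" "D t \<noteq> 0" using D_pos[of s] D_pos[of t] assms by simp_all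
  have "bridge_var q \<sigma> T s t = ((E t)\<^sup>2 * (D s - D t)) * ((E T)\<^sup>2 * D t) / ((E T)\<^sup>2 * D s)"
    using assms by (simp add: bridge_var_def gam_eq D_T)
  also have "\<dots> = (E t * D t)\<^sup>2 * (1 / D t - 1 / D s)"
    using nz by (simp add: power2_eq_square field_simps)
  finally show ?thesis .
qed

lemma integrand_eq:
  assumes "0 \<le> s" "s \<le> t" "t < T"
  shows "gam q \<sigma> t T / gam q \<sigma> s T * exp (qbar q t - qbar q s) * \<sigma> s = (E t * D t) * h s"
proof -
  have "exp (qbar q t - qbar q s) = E t / E s" by (simp add: E_def exp_diff)
  then show ?thesis using assms D_pos[of s] by (simp add: gam_eq D_T h_def mult_ac)
qed

text \<open>\<open>1 / D\<close> is an antiderivative of \<open>h\<^sup>2\<close>, because \<open>D' = - \<sigma>\<^sup>2 / E\<^sup>2\<close>.\<close>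

lemma integral_h_sq:
  assumes "0 \<le> s" "s \<le> t" "t < T"
  shows "(\<integral>x. (h x)\<^sup>2 \<partial>restrict_space lborel {s<..t}) = 1 / D t - 1 / D s"
proof -
  have sub: "{s..t} \<subseteq> {0..T}" using assms by auto
  have Dnz: "D x \<noteq> 0" if "x \<in> {s..t}" for x using D_pos[of x] that assms by auto
  have "has_bochner_integral lborel (\<lambda>x. indicator {s..t} x *\<^sub>R (h x)\<^sup>2) (1 / D t - 1 / D s)"
  proof (rule has_bochner_integral_FTC_Icc[OF assms(2)])
    fix x assume x: "s \<le> x" "x \<le> t"
    then have "(D has_real_derivative - ((\<sigma> x)\<^sup>2 / (E x)\<^sup>2)) (at x within {s..t})"
      using D_deriv[of x] sub by (intro DERIV_subset[OF _ sub]) auto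
    then have "((\<lambda>x. 1 / D x) has_real_derivative (h x)\<^sup>2) (at x within {s..t})"
      using Dnz[of x] x by (auto intro!: derivative_eq_intros simp: h_def power_mult_distrib power_divide field_simps power2_eq_square)
    then show "((\<lambda>x. 1 / D x) has_vector_derivative (h x)\<^sup>2) (at x within {s..t})"
      by (simp add: has_real_derivative_iff_has_vector_derivative)
  next
    have "continuous_on {s..t} h"
      unfolding h_def[abs_def] using Dnz assms
      by (intro continuous_intros continuous_on_subset[OF \<sigma>_cont] continuous_on_subset[OF E_cont sub]
          continuous_on_subset[OF D_cont sub]) auto
    then show "continuous_on {s..t} (\<lambda>x. (h x)\<^sup>2)" by (intro continuous_intros)
  qed
  then have I: "(\<lambda>x. indicator {s..t} x *\<^sub>R (h x)\<^sup>2) \<in> borel_measurable lborel"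
    "(\<integral>x. indicator {s..t} x *\<^sub>R (h x)\<^sup>2 \<partial>lborel) = 1 / D t - 1 / D s"
    by (auto simp: has_bochner_integral_iff)
  \<comment> \<open>The fundamental theorem of calculus is applied on the closed interval; the
    endpoint \<open>s\<close> is a null set.\<close>
  have ae: "AE x in lborel. indicator {s<..t} x *\<^sub>R (h x)\<^sup>2 = indicator {s..t} x *\<^sub>R (h x)\<^sup>2"
    using AE_lborel_singleton[of s] by eventually_elim (auto simp: indicator_def)
  have "(\<lambda>x. indicator {s<..t} x *\<^sub>R (indicator {s..t} x *\<^sub>R (h x)\<^sup>2)) \<in> borel_measurable lborel"
    by (intro borel_measurable_scaleR I(1)) auto
  also have "(\<lambda>x. indicator {s<..t} x *\<^sub>R (indicator {s..t} x *\<^sub>R (h x)\<^sup>2)) = (\<lambda>x. indicator {s<..t} x *\<^sub>R (h x)\<^sup>2)"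
    by (auto simp: fun_eq_iff indicator_def)
  finally have "(\<integral>x. indicator {s<..t} x *\<^sub>R (h x)\<^sup>2 \<partial>lborel) = 1 / D t - 1 / D s"
    using integral_cong_AE[OF _ I(1) ae] I(2) by simp
  then show ?thesis by (subst integral_restrict_space) auto
qed

end

text \<open>The integral property fixes each \<open>J t\<close> only up to a null set;
  \<open>J_continuous\<close> says that the versions have been chosen with continuous paths, as the
  path statements demand.\<close>

theorem theorem3p1:
  fixes M :: "'w measure"
    and B J U :: "real \<Rightarrow> 'w \<Rightarrow> real"
    and q \<sigma> r :: "real \<Rightarrow> real"
    and a b T :: real
  assumes "continuous_on {0..} q" and "continuous_on {0..} \<sigma>" and "continuous_on {0..} r"
    and "wiener_process M B"
    and "\<And>t. 0 \<le> t \<Longrightarrow> \<sigma> t \<noteq> 0"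
    and "0 < T"
    and J_integral: "\<And>t. t \<in> {0..<T} \<Longrightarrow>
      has_wiener_integral M B 0 t
        (\<lambda>s. gam q \<sigma> t T / gam q \<sigma> s T * exp (qbar q t - qbar q s) * \<sigma> s) (J t)"
    and J_continuous: "AE \<omega> in M. continuous_on {0..<T} (\<lambda>t. J t \<omega>)"
    and U: "\<And>t \<omega>. t \<in> {0..<T} \<Longrightarrow> \<omega> \<in> space M \<Longrightarrow>
      U t \<omega> = bridge_mean q \<sigma> r T a b 0 t + J t \<omega>"
  shows "(\<forall>t\<in>{0..<T}. has_normal_law M (U t) (bridge_mean q \<sigma> r T a b 0 t) (bridge_var q \<sigma> T 0 t)) \<and>
    (AE \<omega> in M. ((\<lambda>t. U t \<omega>) \<longlongrightarrow> b) (at_left T)) \<and>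
    tendsto_prob M U (\<lambda>_. b) (at_left T) \<and>
    tendsto_L2 M U (\<lambda>_. b) (at_left T) \<and>
    (\<exists>V :: real \<Rightarrow> 'w \<Rightarrow> real.
      (\<forall>t\<in>{0..<T}. \<forall>\<omega>\<in>space M. V t \<omega> = U t \<omega>) \<and>
      (AE \<omega> in M. V 0 \<omega> = a) \<and> (\<forall>\<omega>\<in>space M. V T \<omega> = b) \<and>
      (AE \<omega> in M. continuous_on {0..T} (\<lambda>t. V t \<omega>)) \<and>
      (\<forall>t\<in>{0..T}. tendsto_prob M V (V t) (at t within {0..T})) \<and>
      (\<forall>t\<in>{0..T}. tendsto_L2 M V (V t) (at t within {0..T})) \<and>
      gauss_process M {0..T} V \<and> markov_process M {0..T} V \<and>
      has_transition_density M {0..<T} V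
        (\<lambda>s t x y. 1 / sqrt (2 * pi * bridge_var q \<sigma> T s t) *
           exp (- (y - bridge_mean q \<sigma> r T x b s t)\<^sup>2 / (2 * bridge_var q \<sigma> T s t))))"
proof -
  interpret prob_space M using assms(4) by (simp add: wiener_process_def)
  interpret W: wiener M B by unfold_locales (rule assms(4))
  interpret C: bridge_coeffs q \<sigma> r T using assms(1-3,5,6) by unfold_locales
  \<comment> \<open>Division by the factor that depends only on \<open>t\<close> leaves integrals of
    the single integrand \<open>h\<close>.\<close>
  define Z where "Z t \<omega> = 1 / (C.E t * C.D t) * J t \<omega>" for t \<omega>
  define \<mu> where "\<mu> t = bridge_mean q \<sigma> r T a b 0 t" for t
  define V where "V t \<omega> = (if t < T then U t \<omega> else b)" for t \<omega>
  have Z_int: "has_wiener_integral M B 0 t C.h (Z t)" if t: "t \<in> {0..<T}" for t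
  proof -
    have "has_wiener_integral M B 0 t (\<lambda>s. (C.E t * C.D t) * C.h s) (J t)"
      by (rule has_wiener_integral_cong[OF J_integral[OF t]]) (use t C.integrand_eq in auto)
    moreover have "1 / (C.E t * C.D t) * ((C.E t * C.D t) * y) = y" for y
      using C.D_pos[of t] t by simp
    ultimately show ?thesis
      using has_wiener_integral_cmult[of M B 0 t "\<lambda>s. (C.E t * C.D t) * C.h s" "J t" "1 / (C.E t * C.D t)"]
      by (simp only: Z_def[abs_def])
  qed
  have \<mu>: "\<mu> t = C.E t * (C.R t + (b / C.E T - C.R T) + C.D t / C.D 0 * (a - (b / C.E T - C.R T)))"
    if "t \<in> {0..T}" for t
    using that assms(6) by (simp add: \<mu>_def C.bridge_mean_eq C.E_0 C.R_def)
  have \<mu>_T: "\<mu> T = b" using \<mu>[of T] assms(6) by (simp add: C.D_T)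
  interpret gaussian_bridge M Z C.D T C.E \<mu> V
  proof unfold_locales
    show "0 < T" by fact
    show Zm: "Z t \<in> borel_measurable M" if "t \<in> {0..<T}" for t
      using Z_int[OF that] unfolding has_wiener_integral_def by (auto simp: tendsto_L2_def sq_integrable_def)
    show "AE \<omega> in M. Z 0 \<omega> = 0" using W.wiener_integral_trivial[OF Z_int[of 0]] assms(6) by simp
    fix s t assume st: "0 \<le> s" "s \<le> t" "t < T"
    then show "indep_of M (natural_filtration M {0..<T} Z s) (\<lambda>\<omega>. Z t \<omega> - Z s \<omega>)"
      by (intro W.wiener_integral_process_indep[of "{0..<T}" C.h] Z_int) auto
    have "has_normal_law M (\<lambda>\<omega>. Z t \<omega> - Z s \<omega>) 0 (\<integral>x. (C.h x)\<^sup>2 \<partial>restrict_space lborel {s<..t})"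
      using st by (intro W.wiener_integral_increment(2) Z_int) auto
    then show "has_normal_law M (\<lambda>\<omega>. Z t \<omega> - Z s \<omega>) 0 (1 / C.D t - 1 / C.D s)"
      using C.integral_h_sq[OF st] by simp
  next
    show "AE \<omega> in M. continuous_on {0..<T} (\<lambda>t. Z t \<omega>)"
      using J_continuous
    proof eventually_elim
      case (elim \<omega>)
      have sub: "{0..<T} \<subseteq> {0..T}" by auto
      have "C.E t * C.D t \<noteq> 0" if "t \<in> {0..<T}" for t using C.D_pos[of t] that by simp
      then show ?case unfolding Z_def
        by (intro continuous_intros elim continuous_on_subset[OF C.E_cont sub] continuous_on_subset[OF C.D_cont sub]) auto
    qed
    show "continuous_on {0..T} C.D" by (rule C.D_cont)
    show "C.D T = 0" by (rule C.D_T)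
    show "C.D t < C.D s" if "0 \<le> s" "s < t" "t \<le> T" for s t using that by (rule C.D_strict)
    show "continuous_on {0..T} C.E" by (rule C.E_cont)
    show "0 < C.E t" for t by simp
    have "continuous_on {0..T} (\<lambda>t. C.E t * (C.R t + (b / C.E T - C.R T) + C.D t / C.D 0 * (a - (b / C.E T - C.R T))))"
      using C.D_pos[of 0] assms(6) by (intro continuous_intros C.E_cont C.R_cont C.D_cont) auto
    then show "continuous_on {0..T} \<mu>" using \<mu> by (subst continuous_on_cong[OF refl]) auto
    show "V t \<omega> = \<mu> t + C.E t * C.D t * Z t \<omega>" if "t \<in> {0..<T}" "\<omega> \<in> space M" for t \<omega>
      using U[OF that] C.D_pos[of t] that(1) by (simp add: V_def Z_def \<mu>_def)
    show "V T \<omega> = \<mu> T" for \<omega> by (simp add: V_def \<mu>_T)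
  qed
  \<comment> \<open>The regression of \<open>V t\<close> on \<open>V s\<close> must agree with the
    mean of a bridge started in \<open>x\<close> at time \<open>s\<close>. It does because all
    bridge means to \<open>b\<close> share the same affine form in \<open>D\<close>, independent of
    the starting value except for the slope.\<close>
  have mean: "\<mu> t + g t / g s * (x - \<mu> s) = bridge_mean q \<sigma> r T x b s t"
    if "s \<in> {0..<T}" "t \<in> {0..<T}" "s < t" for s t x
  proof -
    have nz: "C.D s \<noteq> 0" "C.D 0 \<noteq> 0" using C.D_pos[of s] C.D_pos[of 0] that assms(6) by auto
    \<comment> \<open>\<open>\<beta>\<close> is the transformed terminal value and \<open>k\<close>
      the initial offset from it; the contributions of \<open>k\<close>, which carry the dependence
      on \<open>a\<close>, cancel between \<open>\<mu> t\<close> and \<open>\<mu> s\<close>.\<close>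
    define \<beta> k where "\<beta> = b / C.E T - C.R T" and "k = a - \<beta>"
    have eq: "C.E t * C.D t / (C.E s * C.D s) * (x - C.E s * (C.R s + \<beta> + C.D s / C.D 0 * k)) =
        C.E t * (C.D t / C.D s * (x / C.E s - C.R s - \<beta>)) - C.E t * (C.D t / C.D 0 * k)"
      using nz by (simp add: field_simps)
    have "bridge_mean q \<sigma> r T x b s t =
        C.E t * (C.R t + \<beta> + C.D t / C.D s * (x / C.E s - C.R s - \<beta>))"
      unfolding \<beta>_def using that by (intro C.bridge_mean_eq) auto
    moreover have "\<mu> s = C.E s * (C.R s + \<beta> + C.D s / C.D 0 * k)" "\<mu> t = C.E t * (C.R t + \<beta> + C.D t / C.D 0 * k)"
      unfolding \<beta>_def k_def using that by (intro \<mu>; simp)+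
    ultimately show ?thesis unfolding g_def by (simp only: eq) (simp add: distrib_left)
  qed
  have VU: "V t = U t" if "t < T" for t using that by (simp add: V_def fun_eq_iff)
  have left: "at T within {0..T} = at_left T" using assms(6) by (rule at_within_Icc_at_left)
  have ev: "\<forall>\<^sub>F t in at_left T. V t = U t"
    using eventually_at_left_real[OF assms(6)] by eventually_elim (simp add: VU)
  have T_in: "T \<in> {0..T}" using assms(6) by simp
  have L2: "tendsto_L2 M U (\<lambda>_. b) (at_left T)"
    using V_L2_continuous[OF T_in] unfolding left
    by (rule tendsto_L2_cong_eventually[OF _ ev]) (simp add: V_def)
  have AE_lim: "AE \<omega> in M. ((\<lambda>t. U t \<omega>) \<longlongrightarrow> b) (at_left T)"
    using V_continuous
  proof eventually_elim
    case (elim \<omega>)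
    from elim[unfolded continuous_on_def, rule_format, OF T_in, unfolded left]
    have "((\<lambda>t. V t \<omega>) \<longlongrightarrow> b) (at_left T)" by (simp add: V_def)
    moreover have "\<forall>\<^sub>F t in at_left T. V t \<omega> = U t \<omega>" using ev by eventually_elim simp
    ultimately show ?case by (rule Lim_transform_eventually)
  qed
  have law: "has_normal_law M (U t) (bridge_mean q \<sigma> r T a b 0 t) (bridge_var q \<sigma> T 0 t)" if "t \<in> {0..<T}" for t
    using V_normal[OF that] C.bridge_var_eq[of 0 t] VU[of t] that by (simp add: \<mu>_def g_def)
  have V0: "AE \<omega> in M. V 0 \<omega> = a"
  proof -
    have \<mu>0: "\<mu> 0 = a" using \<mu>[of 0] C.D_pos[of 0] assms(6) by (simp add: C.E_0 C.R_def)
    show ?thesis using Z_0 AE_space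
      by eventually_elim (use V_eq[of 0] \<mu>0 assms(6) in auto)
  qed
  have dens: "has_transition_density M {0..<T} V
        (\<lambda>s t x y. 1 / sqrt (2 * pi * bridge_var q \<sigma> T s t) *
           exp (- (y - bridge_mean q \<sigma> r T x b s t)\<^sup>2 / (2 * bridge_var q \<sigma> T s t)))"
  proof (rule has_transition_density_cong[OF V_transition_density])
    fix s t x y assume st: "s \<in> {0..<T}" "t \<in> {0..<T}" "s < t"
    have v: "(g t)\<^sup>2 * (1 / C.D t - 1 / C.D s) = bridge_var q \<sigma> T s t"
      using C.bridge_var_eq[of s t] st by (simp add: g_def)
    have "1 / C.D s \<le> 1 / C.D t" using C.D_strict[of s t] C.D_pos[of t] st by (intro divide_left_mono) auto
    then have "0 \<le> bridge_var q \<sigma> T s t" unfolding v[symmetric] by simp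
    then show "normal_density (\<mu> t + g t / g s * (x - \<mu> s)) (sqrt ((g t)\<^sup>2 * (1 / C.D t - 1 / C.D s))) y =
      1 / sqrt (2 * pi * bridge_var q \<sigma> T s t) *
        exp (- (y - bridge_mean q \<sigma> r T x b s t)\<^sup>2 / (2 * bridge_var q \<sigma> T s t))"
      unfolding mean[OF st] v by (simp add: normal_density_def)
  qed
  show ?thesis
  proof (intro conjI ballI exI[of _ V])
    show "V t \<omega> = U t \<omega>" if "t \<in> {0..<T}" for t \<omega> using that VU[of t] by simp
    show "tendsto_prob M U (\<lambda>_. b) (at_left T)" by (rule tendsto_L2_imp_prob[OF prob_space_axioms L2])
    show "tendsto_prob M V (V t) (at t within {0..T})" if "t \<in> {0..T}" for t
      by (rule tendsto_L2_imp_prob[OF prob_space_axioms V_L2_continuous[OF that]])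
    show "V T \<omega> = b" for \<omega> by (simp add: V_def)
  qed (rule AE_lim L2 V0 V_continuous V_gauss V_markov dens | erule law V_L2_continuous)+
qed

end
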